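(* Let $\tilde F$ be the foliation on $\mathbb{CP}^2$, with homogeneous coordinates $(x:y:z)$, defined by the homogeneous $1$-form $\tilde\omega = A\,dx+B\,dy+C\,dz$, where \begin{align*} A ={}& -x^7y - x^7z + 4x^6y^2 + 4x^6yz + 2x^6 z^2 - 5x^5 y^3 - 4 x^5 y^2 z + x^5 y z^2 + x^4 y^4 - 4 x^4 y^3 z \\ & - 3 x^4 y^2 z^2 - 3 x^4 y z^3 - x^4 z^4 + 4 x^3 y^5 + 9 x^3 y^4 z + 12 x^3 y^3 z^2 + 5 x^3 y^2 z^3 \\ & - 6 x^2 y^6 - 15 x^2 y^5 z - 9 x^2 y^4 z^2 + 6 x y^7 + 7 x y^6 z - 2 y^8,\\ B ={}& x^8 - 4 x^7 y - 2 x^7 z + 5 x^6 y^2 + 3 x^6 y z - x^5 y^3 + 2 x^5 y^2 z - 4 x^4 y^4 - 6 x^4 y^3 z - 6 x^4 y^2 z^2 - 2 x^4 y z^3 \\ & + 6 x^3 y^5 + 12 x^3 y^4 z + 6 x^3 y^3 z^2 - 6 x^2 y^6 - 6 x^2 y^5 z + 2 x y^7,\\ C ={}& x^8 - 2 x^7 y - 2 x^7 z + x^6 y^2 - x^6 y z + 2 x^5 y^3 + 3 x^5 y^2 z + 3 x^5 y z^2 + x^5 z^3 \\ & - 3 x^4 y^4 - 6 x^4 y^3 z - 3 x^4 y^2 z^2 + 3 x^3 y^5 + 3 x^3 y^4 z - x^2 y^6. \end{align*} Then $\tilde F$ is a foliation of degree $7$ whose only singular point is $(0:0:1)$. This singularity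 is non-dicritical, has multiplicity $4$ and Milnor number $57$, and there is a divergent separatrix of $\tilde F$ through it. Moreover, the line $x=0$ is invariant by $\tilde F$, and $\tilde F$ is not a foliation of second type.
   Context: A (codimension one holomorphic) foliation of degree $d$ on $\mathbb{CP}^2$ is given, up to a nonzero scalar, by a homogeneous $1$-form $\omega=A\,dx+B\,dy+C\,dz$ with $A,B,C\in\mathbb{C}[x,y,z]$ homogeneous of degree $d+1$ without common factor and satisfying $xA+yB+zC=0$. Singular points are the common zeros of $A,B,C$. An algebraic curve $f=0$ is invariant if $f$ divides $\omega\wedge df$. If in local coordinates $(u,v)$ centered at a singular point $p$ the foliation is given by $a\,du+b\,dv$ with $a,b$ having no common factor, its Milnor number at $p$ is $\dim_{\mathbb C}\mathcal{O}_{\mathbb C^2,0}/(a,b)$ and its multiplicity at $p$ is the minimum of the orders of $a$ and $b$ at $0$. A (possibly formal) separatrix through $p$ is an irreducible formal curve germ $f=0$, $f\in\mathbb{C}[[u,v]]$, such that $f$ divides $(a\,du+b\,dv)\wedge df$; it is divergent if it has no convergent equation, i.e. no unit multiple of $f$ is a convergent power series. Reduction of singularities: after finitely many point blow-ups, all singular points of the transformed foliation are reduced, i.e. either saddle-nodes (linear part of a local defining vector field with exactly one zero eigenvalue) or hyperbolic singularities (nonzero eigenvalues $\lambda_1,\lambda_2$ with $\lambda_1/\lambda_2\notin\mathbb{Q}_{>0}$). A singular point is dicritical if some component of the exceptional divisor produced over it in the reduction process is not invariant by the transformed foliation, and non-dicritical otherwise. The weak separatrix of a saddle-node is its unique (possibly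 only formal) separatrix tangent to the eigendirection of the zero eigenvalue. The foliation is of second type if, for every saddle-node in its reduction process, the weak separatrix is not contained in any component of the exceptional divisor. *)

theory Defs
  imports
    "HOL-Computational_Algebra.Computational_Algebra"
    "HOL-Analysis.Infinite_Sum"
    "HOL-Library.Extended_Nat"
    "Jordan_Normal_Form.Char_Poly"
begin

section \<open>Polynomials in three variables and foliations on the projective plane\<close>

text \<open>\<open>\<complex>[x,y,z]\<close> is represented as \<open>\<complex>[x][y][z]\<close>: the outermost variable is \<open>z\<close>,
  the innermost one is \<open>x\<close>.\<close>

type_synonym poly3 = "complex poly poly poly"

definition X :: poly3 where "X = [:[:[:0, 1:]:]:]"
definition Y :: poly3 where "Y = [:[:0, 1:]:]"
definition Z :: poly3 where "Z = [:0, 1:]"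

definition coeff3 :: "poly3 \<Rightarrow> nat \<Rightarrow> nat \<Rightarrow> nat \<Rightarrow> complex" where
  "coeff3 F i j k = coeff (coeff (coeff F k) j) i"

definition homogeneous :: "nat \<Rightarrow> poly3 \<Rightarrow> bool" where
  "homogeneous n F \<longleftrightarrow> (\<forall>i j k. coeff3 F i j k \<noteq> 0 \<longrightarrow> i + j + k = n)"

definition deriv_x :: "poly3 \<Rightarrow> poly3" where "deriv_x = map_poly (map_poly pderiv)"
definition deriv_y :: "poly3 \<Rightarrow> poly3" where "deriv_y = map_poly pderiv"
definition deriv_z :: "poly3 \<Rightarrow> poly3" where "deriv_z = pderiv"

text \<open>Evaluation at a point with coordinates in a commutative ring \<open>'r\<close>, where
  \<open>h : \<complex> \<rightarrow> 'r\<close> is the structure map.\<close>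

definition eval3 :: "(complex \<Rightarrow> 'r::comm_ring_1) \<Rightarrow> poly3 \<Rightarrow> 'r \<Rightarrow> 'r \<Rightarrow> 'r \<Rightarrow> 'r" where
  "eval3 h F x y z =
     (\<Sum>k\<le>degree F. \<Sum>j\<le>degree (coeff F k). \<Sum>i\<le>degree (coeff (coeff F k) j).
        h (coeff3 F i j k) * x ^ i * y ^ j * z ^ k)"

text \<open>The triple \<open>(A, B, C)\<close> stands for the form \<open>A dx + B dy + C dz\<close>.\<close>

type_synonym form3 = "poly3 \<times> poly3 \<times> poly3"

fun foliation :: "nat \<Rightarrow> form3 \<Rightarrow> bool" where
  "foliation d (A, B, C) \<longleftrightarrow>
     homogeneous (d + 1) A \<and> homogeneous (d + 1) B \<and> homogeneous (d + 1) C \<and>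
     (\<forall>D. D dvd A \<and> D dvd B \<and> D dvd C \<longrightarrow> D dvd 1) \<and>
     X * A + Y * B + Z * C = 0"

text \<open>\<open>F\<close> divides the three coefficients of \<open>\<omega> \<and> dF\<close>.\<close>

fun invariant_curve :: "form3 \<Rightarrow> poly3 \<Rightarrow> bool" where
  "invariant_curve (A, B, C) F \<longleftrightarrow>
     F dvd A * deriv_y F - B * deriv_x F \<and>
     F dvd A * deriv_z F - C * deriv_x F \<and>
     F dvd B * deriv_z F - C * deriv_y F"

type_synonym pt3 = "complex \<times> complex \<times> complex"

text \<open>The point \<open>(x : y : z)\<close> of the projective plane, as the set of its homogeneous
  coordinate vectors.\<close>

fun proj_pt :: "pt3 \<Rightarrow> pt3 set" where
  "proj_pt (x, y, z) = {(c * x, c * y, c * z) | c. c \<noteq> 0}"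

fun zero_of_form :: "form3 \<Rightarrow> pt3 \<Rightarrow> bool" where
  "zero_of_form (A, B, C) (x, y, z) \<longleftrightarrow>
     eval3 id A x y z = 0 \<and> eval3 id B x y z = 0 \<and> eval3 id C x y z = 0"

definition singular_points :: "form3 \<Rightarrow> pt3 set set" where
  "singular_points \<omega> = {proj_pt p | p. p \<noteq> (0, 0, 0) \<and> zero_of_form \<omega> p}"


section \<open>Formal and convergent power series in two variables\<close>

text \<open>\<open>\<complex>[[u,v]]\<close> is represented as \<open>\<complex>[[u]][[v]]\<close>.\<close>

type_synonym series2 = "complex fps fps"

definition U :: series2 where "U = fps_const fps_X"
definition V :: series2 where "V = fps_X"

definition const2 :: "complex \<Rightarrow> series2" where "const2 c = fps_const (fps_const c)"

definition coeff2 :: "series2 \<Rightarrow> nat \<Rightarrow> nat \<Rightarrow> complex" where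
  "coeff2 f i j = fps_nth (fps_nth f j) i"

definition deriv_u :: "series2 \<Rightarrow> series2" where
  "deriv_u f = Abs_fps (\<lambda>j. fps_deriv (fps_nth f j))"

definition deriv_v :: "series2 \<Rightarrow> series2" where "deriv_v f = fps_deriv f"

text \<open>The order at the origin; it is \<open>\<infinity>\<close> for the zero series.\<close>

definition ord2 :: "series2 \<Rightarrow> enat" where
  "ord2 f = Inf {enat (i + j) | i j. coeff2 f i j \<noteq> 0}"

text \<open>The substitution \<open>f(g, h)\<close>, for \<open>g\<close> and \<open>h\<close> without constant term. Since
  \<open>g\<^sup>k h\<^sup>l\<close> has order at least \<open>k + l\<close>, the terms left out do not contribute to the
  coefficient of \<open>u\<^sup>i v\<^sup>j\<close>.\<close>

definition subst2 :: "series2 \<Rightarrow> series2 \<Rightarrow> series2 \<Rightarrow> series2" where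
  "subst2 f g h = Abs_fps (\<lambda>j. Abs_fps (\<lambda>i.
     \<Sum>k\<le>i + j. \<Sum>l\<le>i + j. coeff2 f k l * coeff2 (g ^ k * h ^ l) i j))"

text \<open>\<open>O2\<close> is the ring \<open>\<O>\<close> of germs of holomorphic functions at the origin.\<close>

definition O2 :: "series2 set" where
  "O2 = {f. \<exists>r>0. \<forall>x y. norm x < r \<and> norm y < r \<longrightarrow>
            (\<lambda>(i, j). coeff2 f i j * x ^ i * y ^ j) summable_on UNIV}"

definition ideal_O2 :: "series2 \<Rightarrow> series2 \<Rightarrow> series2 set" where
  "ideal_O2 a b = {a * f + b * g | f g. f \<in> O2 \<and> g \<in> O2}"

text \<open>The quotient \<open>E / W\<close> of complex vector spaces of power series has dimension \<open>n\<close>: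
  the residue classes of some \<open>e 0, \<dots>, e (n - 1)\<close> form a basis of it.\<close>

definition quotient_has_dim :: "series2 set \<Rightarrow> series2 set \<Rightarrow> nat \<Rightarrow> bool" where
  "quotient_has_dim E W n \<longleftrightarrow> (\<exists>e :: nat \<Rightarrow> series2.
     (\<forall>k<n. e k \<in> E) \<and>
     (\<forall>f\<in>E. \<exists>c. f - (\<Sum>k<n. const2 (c k) * e k) \<in> W) \<and>
     (\<forall>c. (\<Sum>k<n. const2 (c k) * e k) \<in> W \<longrightarrow> (\<forall>k<n. c k = 0)))"


section \<open>Germs of foliations\<close>

text \<open>The pair \<open>(a, b)\<close> stands for the germ \<open>a du + b dv\<close>.\<close>

type_synonym germ = "series2 \<times> series2"

text \<open>The germ at \<open>(x : y : z)\<close> in the standard affine chart given by the last nonzero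
  coordinate, translated so that the point becomes the origin. If \<open>A, B, C\<close> have no common
  factor, the relation \<open>xA + yB + zC = 0\<close> implies that the two coefficients have no common
  factor.\<close>

fun germ_at :: "form3 \<Rightarrow> pt3 \<Rightarrow> germ" where
  "germ_at (A, B, C) (x, y, z) =
    (if z \<noteq> 0 then
       (eval3 const2 A (const2 (x / z) + U) (const2 (y / z) + V) 1,
        eval3 const2 B (const2 (x / z) + U) (const2 (y / z) + V) 1)
     else if y \<noteq> 0 then
       (eval3 const2 A (const2 (x / y) + U) 1 (const2 (z / y) + V),
        eval3 const2 C (const2 (x / y) + U) 1 (const2 (z / y) + V))
     else
       (eval3 const2 B 1 (const2 (y / x) + U) (const2 (z / x) + V),
        eval3 const2 C 1 (const2 (y / x) + U) (const2 (z / x) + V)))"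

fun singular :: "germ \<Rightarrow> bool" where
  "singular (a, b) \<longleftrightarrow> coeff2 a 0 0 = 0 \<and> coeff2 b 0 0 = 0"

fun has_milnor_number :: "germ \<Rightarrow> nat \<Rightarrow> bool" where
  "has_milnor_number (a, b) n \<longleftrightarrow> quotient_has_dim O2 (ideal_O2 a b) n"

fun multiplicity_of :: "germ \<Rightarrow> enat" where
  "multiplicity_of (a, b) = min (ord2 a) (ord2 b)"

text \<open>\<open>f\<close> divides \<open>(a du + b dv) \<and> df\<close>.\<close>

fun invariant_germ :: "germ \<Rightarrow> series2 \<Rightarrow> bool" where
  "invariant_germ (a, b) f \<longleftrightarrow> f dvd a * deriv_v f - b * deriv_u f"

definition separatrix :: "germ \<Rightarrow> series2 \<Rightarrow> bool" where
  "separatrix \<omega> f \<longleftrightarrow> Factorial_Ring.irreducible f \<and> invariant_germ \<omega> f"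

definition divergent_curve :: "series2 \<Rightarrow> bool" where
  "divergent_curve f \<longleftrightarrow> (\<forall>w. w dvd 1 \<longrightarrow> w * f \<notin> O2)"

text \<open>The linear part at the origin of the vector field \<open>b \<partial>/\<partial>u - a \<partial>/\<partial>v\<close>, which is dual to
  \<open>a du + b dv\<close>.\<close>

fun linear_part :: "germ \<Rightarrow> complex mat" where
  "linear_part (a, b) = mat_of_rows_list 2
     [[coeff2 b 1 0, coeff2 b 0 1],
      [- coeff2 a 1 0, - coeff2 a 0 1]]"

definition has_eigenvalues :: "germ \<Rightarrow> complex \<Rightarrow> complex \<Rightarrow> bool" where
  "has_eigenvalues \<omega> l1 l2 \<longleftrightarrow> char_poly (linear_part \<omega>) = [:- l1, 1:] * [:- l2, 1:]"

definition saddle_node :: "germ \<Rightarrow> bool" where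
  "saddle_node \<omega> \<longleftrightarrow> singular \<omega> \<and> (\<exists>l. l \<noteq> 0 \<and> has_eigenvalues \<omega> 0 l)"

definition hyperbolic :: "germ \<Rightarrow> bool" where
  "hyperbolic \<omega> \<longleftrightarrow> singular \<omega> \<and>
     (\<exists>l1 l2. has_eigenvalues \<omega> l1 l2 \<and> l1 \<noteq> 0 \<and> l2 \<noteq> 0 \<and>
        \<not> (\<exists>q::rat. q > 0 \<and> l1 / l2 = of_rat q))"

definition reduced :: "germ \<Rightarrow> bool" where
  "reduced \<omega> \<longleftrightarrow> saddle_node \<omega> \<or> hyperbolic \<omega>"

text \<open>The curve \<open>f = 0\<close> is tangent to the direction \<open>(s, t)\<close> at the origin: the initial form
  of \<open>f\<close> vanishes there.\<close>

definition tangent_to :: "series2 \<Rightarrow> complex \<Rightarrow> complex \<Rightarrow> bool" where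
  "tangent_to f s t \<longleftrightarrow>
     (\<forall>n. ord2 f = enat n \<longrightarrow> (\<Sum>i\<le>n. coeff2 f i (n - i) * s ^ i * t ^ (n - i)) = 0)"

definition weak_separatrix :: "germ \<Rightarrow> series2 \<Rightarrow> bool" where
  "weak_separatrix \<omega> f \<longleftrightarrow> separatrix \<omega> f \<and>
     (\<exists>w. eigenvector (linear_part \<omega>) w 0 \<and> tangent_to f (vec_index w 0) (vec_index w 1))"


section \<open>Reduction of singularities\<close>

text \<open>A blow-up is written near a point of the exceptional divisor as
  \<open>\<pi>(u, v) = (g(u, v), h(u, v))\<close>, where \<open>e = 0\<close> is the exceptional divisor. The points of the
  divisor are \<open>v = c\<close> in the chart \<open>(u, v) \<mapsto> (u, u v)\<close> and the origin of the chart
  \<open>(u, v) \<mapsto> (u v, v)\<close>.\<close>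

inductive blowup_chart :: "series2 \<Rightarrow> series2 \<Rightarrow> series2 \<Rightarrow> bool" where
  "blowup_chart U (U * (const2 c + V)) U"
| "blowup_chart (U * V) V V"

fun pullback :: "series2 \<Rightarrow> series2 \<Rightarrow> germ \<Rightarrow> germ" where
  "pullback g h (a, b) =
     (subst2 a g h * deriv_u g + subst2 b g h * deriv_u h,
      subst2 a g h * deriv_v g + subst2 b g h * deriv_v h)"

text \<open>The transformed foliation is obtained by dividing the pulled-back form by the largest
  possible power of \<open>e\<close>; likewise for the strict transform of a curve.\<close>

fun transform_germ :: "series2 \<Rightarrow> series2 \<Rightarrow> series2 \<Rightarrow> germ \<Rightarrow> germ \<Rightarrow> bool" where
  "transform_germ g h e \<omega> (a', b') \<longleftrightarrow>
     (\<exists>k. pullback g h \<omega> = (e ^ k * a', e ^ k * b')) \<and> \<not> (e dvd a' \<and> e dvd b')"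

definition strict_transform :: "series2 \<Rightarrow> series2 \<Rightarrow> series2 \<Rightarrow> series2 \<Rightarrow> series2 \<Rightarrow> bool" where
  "strict_transform g h e f f' \<longleftrightarrow> (\<exists>k. subst2 f g h = e ^ k * f') \<and> \<not> e dvd f'"

text \<open>\<open>infinitely_near \<omega>0 \<omega> D\<close>: in the process which starts with \<open>\<omega>0\<close> and blows up all singular
  points that are not reduced as long as there are any, a point occurs at which the
  transformed foliation is given by \<open>\<omega>\<close> and the components of the exceptional divisor through
  the point have the local equations in \<open>D\<close>.\<close>

inductive infinitely_near :: "germ \<Rightarrow> germ \<Rightarrow> series2 set \<Rightarrow> bool" for \<omega>0 :: germ where
  start: "infinitely_near \<omega>0 \<omega>0 {}"
| blowup: "infinitely_near \<omega>0 \<omega> D \<Longrightarrow> singular \<omega> \<Longrightarrow> \<not> reduced \<omega> \<Longrightarrow> blowup_chart g h e \<Longrightarrow>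
    transform_germ g h e \<omega> \<omega>' \<Longrightarrow>
    infinitely_near \<omega>0 \<omega>'
      (insert e {f'. coeff2 f' 0 0 = 0 \<and> (\<exists>f\<in>D. strict_transform g h e f f')})"

definition dicritical :: "germ \<Rightarrow> bool" where
  "dicritical \<omega>0 \<longleftrightarrow> (\<exists>\<omega> D f. infinitely_near \<omega>0 \<omega> D \<and> f \<in> D \<and> \<not> invariant_germ \<omega> f)"

text \<open>An irreducible curve \<open>s = 0\<close> is contained in \<open>f = 0\<close> if and only if \<open>s\<close> divides \<open>f\<close>.\<close>

definition second_type_germ :: "germ \<Rightarrow> bool" where
  "second_type_germ \<omega>0 \<longleftrightarrow>
     (\<forall>\<omega> D s f. infinitely_near \<omega>0 \<omega> D \<and> saddle_node \<omega> \<and> weak_separatrix \<omega> s \<and> f \<in> D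
        \<longrightarrow> \<not> s dvd f)"

definition second_type :: "form3 \<Rightarrow> bool" where
  "second_type \<omega> \<longleftrightarrow>
     (\<forall>p. p \<noteq> (0, 0, 0) \<and> zero_of_form \<omega> p \<longrightarrow> second_type_germ (germ_at \<omega> p))"


section \<open>The foliation of the theorem\<close>

definition A_tilde :: poly3 where
  "A_tilde =
     - (X ^ 7 * Y) - X ^ 7 * Z + 4 * X ^ 6 * Y ^ 2 + 4 * X ^ 6 * Y * Z + 2 * X ^ 6 * Z ^ 2
     - 5 * X ^ 5 * Y ^ 3 - 4 * X ^ 5 * Y ^ 2 * Z + X ^ 5 * Y * Z ^ 2 + X ^ 4 * Y ^ 4
     - 4 * X ^ 4 * Y ^ 3 * Z - 3 * X ^ 4 * Y ^ 2 * Z ^ 2 - 3 * X ^ 4 * Y * Z ^ 3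
     - X ^ 4 * Z ^ 4 + 4 * X ^ 3 * Y ^ 5 + 9 * X ^ 3 * Y ^ 4 * Z
     + 12 * X ^ 3 * Y ^ 3 * Z ^ 2 + 5 * X ^ 3 * Y ^ 2 * Z ^ 3 - 6 * X ^ 2 * Y ^ 6
     - 15 * X ^ 2 * Y ^ 5 * Z - 9 * X ^ 2 * Y ^ 4 * Z ^ 2 + 6 * X * Y ^ 7
     + 7 * X * Y ^ 6 * Z - 2 * Y ^ 8"

definition B_tilde :: poly3 where
  "B_tilde =
     X ^ 8 - 4 * X ^ 7 * Y - 2 * X ^ 7 * Z + 5 * X ^ 6 * Y ^ 2 + 3 * X ^ 6 * Y * Z
     - X ^ 5 * Y ^ 3 + 2 * X ^ 5 * Y ^ 2 * Z - 4 * X ^ 4 * Y ^ 4 - 6 * X ^ 4 * Y ^ 3 * Z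
     - 6 * X ^ 4 * Y ^ 2 * Z ^ 2 - 2 * X ^ 4 * Y * Z ^ 3 + 6 * X ^ 3 * Y ^ 5
     + 12 * X ^ 3 * Y ^ 4 * Z + 6 * X ^ 3 * Y ^ 3 * Z ^ 2 - 6 * X ^ 2 * Y ^ 6
     - 6 * X ^ 2 * Y ^ 5 * Z + 2 * X * Y ^ 7"

definition C_tilde :: poly3 where
  "C_tilde =
     X ^ 8 - 2 * X ^ 7 * Y - 2 * X ^ 7 * Z + X ^ 6 * Y ^ 2 - X ^ 6 * Y * Z
     + 2 * X ^ 5 * Y ^ 3 + 3 * X ^ 5 * Y ^ 2 * Z + 3 * X ^ 5 * Y * Z ^ 2 + X ^ 5 * Z ^ 3
     - 3 * X ^ 4 * Y ^ 4 - 6 * X ^ 4 * Y ^ 3 * Z - 3 * X ^ 4 * Y ^ 2 * Z ^ 2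
     + 3 * X ^ 3 * Y ^ 5 + 3 * X ^ 3 * Y ^ 4 * Z - X ^ 2 * Y ^ 6"

definition \<omega>_tilde :: form3 where "\<omega>_tilde = (A_tilde, B_tilde, C_tilde)"

end

theory Submission
  imports "HOL-Complex_Analysis.Laurent_Convergence" Defs
begin

text \<open>In the affine chart \<open>x = 1\<close> the polynomial \<open>t = y + z - y\<^sup>2\<close> may replace the coordinate \<open>z\<close>, and
  the foliation becomes \<open>(1 - 2 t - t y + t\<^sup>3) dt - t\<^sup>3 dy = 0\<close>. This is a linear equation for \<open>y\<close> with an
  irregular singularity at \<open>t = 0\<close>: its formal solution with a pole is \<open>Y(t) / t\<close> for a series \<open>Y\<close> with
  factorially growing coefficients, which parametrizes a smooth formal curve through \<open>(0:0:1)\<close>. Were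
  this curve convergent, the implicit function theorem would yield the convergence of \<open>Y\<close>.

  The same form of the equation keeps the formulas manageable along the blow-ups over \<open>(0:0:1)\<close>; only
  six points of the reduction process are not reduced. With \<open>T = u v + u - v\<^sup>2\<close> and
  \<open>P = u\<^sup>6 - 2 T u\<^sup>4 - T v u\<^sup>3 + T\<^sup>3\<close> the coefficients of the germ are \<open>P (v\<^sup>2 - T) + u v T\<^sup>3\<close> and
  \<open>u ((u - 2 v) P - u T\<^sup>3)\<close>, and the additivity of intersection numbers gives the Milnor number
  \<open>8 + 7 + 6 + 3 * 6 * 2 = 57\<close>.\<close>

subsection \<open>Coefficients of series in two variables\<close>

text \<open>Non-dicriticality quantifies over all paths of blow-ups, so it is an induction whose
  invariant must name every germ that is blown up again. Germs are compared as pairs of series, not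
  up to units: removing the exact power of the exceptional equation makes the transform unique, and
  every node is written so that the pullback literally reproduces the next one. The Milnor number
  lives in the ring of convergent series; no preparation theorem enters, because each intersection
  number reduces to one with the line \<open>u = 0\<close>, where powers of \<open>v\<close> form a
  basis and only division by \<open>u\<close> has to preserve convergence. For divergence, all unit
  multiples of an equation have to be excluded, and the growth of \<open>Y\<close>, a series in
  \<open>t\<close>, has to be transported to a graph over \<open>v\<close>. This rests on recovering
  \<open>t = (u v + u - v^2) / u^2\<close> and \<open>Y = t v / u\<close> from the graph by
  convergent operations. The term \<open>t^3 dt\<close> is the source of the divergence: without it
  the solution would be the polynomial \<open>Y = 1 - t\<close>.\<close>

lemma series2_eqI: "(\<And>i j. coeff2 f i j = coeff2 g i j) \<Longrightarrow> f = g"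
  by (simp add: coeff2_def fps_eq_iff)

lemma coeff2_linear [simp]:
  "coeff2 (f + g) i j = coeff2 f i j + coeff2 g i j"
  "coeff2 (f - g) i j = coeff2 f i j - coeff2 g i j"
  "coeff2 (- f) i j = - coeff2 f i j"
  "coeff2 0 i j = 0"
  by (simp_all add: coeff2_def)

lemma coeff2_sum: "coeff2 (\<Sum>k\<in>K. f k) i j = (\<Sum>k\<in>K. coeff2 (f k) i j)"
  by (simp add: coeff2_def fps_sum_nth)

lemma coeff2_mult:
  "coeff2 (f * g) i j =
     (\<Sum>q\<le>j. \<Sum>p\<le>i. coeff2 f p q * coeff2 g (i - p) (j - q))"
  by (simp add: coeff2_def fps_mult_nth fps_sum_nth atLeast0AtMost)

lemma coeff2_const2_mult [simp]: "coeff2 (const2 c * f) i j = c * coeff2 f i j"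
  by (simp add: coeff2_def const2_def)

lemma coeff2_U_mult: "coeff2 (U * f) i j = (if i = 0 then 0 else coeff2 f (i - 1) j)"
  by (simp add: coeff2_def U_def)

lemma coeff2_V_mult: "coeff2 (V * f) i j = (if j = 0 then 0 else coeff2 f i (j - 1))"
  by (simp add: coeff2_def V_def)

lemma const2_hom [simp]:
  "const2 0 = 0" "const2 1 = 1" "const2 (numeral n) = numeral n"
  "const2 (c + d) = const2 c + const2 d" "const2 (c - d) = const2 c - const2 d"
  "const2 (- c) = - const2 c" "const2 (c * d) = const2 c * const2 d" "const2 (c ^ k) = const2 c ^ k"
  by (simp_all add: const2_def fps_const_power flip: fps_const_add fps_const_sub fps_const_neg
      fps_const_mult fps_numeral_fps_const)

lemma coeff2_basic [simp]:
  "coeff2 (const2 c) i j = (if i = 0 \<and> j = 0 then c else 0)"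
  "coeff2 1 i j = (if i = 0 \<and> j = 0 then 1 else 0)"
  "coeff2 (numeral n) i j = (if i = 0 \<and> j = 0 then numeral n else 0)"
  "coeff2 U i j = (if i = 1 \<and> j = 0 then 1 else 0)"
  "coeff2 V i j = (if i = 0 \<and> j = 1 then 1 else 0)"
  by (simp_all add: coeff2_def const2_def U_def V_def fps_one_nth fps_numeral_nth fps_X_def)

text \<open>The product rule on 1-jets: linear parts of large unexpanded products are read off
  factor by factor, without multiplying the series out. The eigenvalue computations rest on
  it.\<close>

lemma coeff2_jet [simp]:
  "coeff2 (f * g) 0 0 = coeff2 f 0 0 * coeff2 g 0 0"
  "coeff2 (f * g) (Suc 0) 0 = coeff2 f 0 0 * coeff2 g (Suc 0) 0 + coeff2 f (Suc 0) 0 * coeff2 g 0 0"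
  "coeff2 (f * g) 0 (Suc 0) = coeff2 f 0 0 * coeff2 g 0 (Suc 0) + coeff2 f 0 (Suc 0) * coeff2 g 0 0"
  by (simp_all add: coeff2_mult)

lemma coeff2_power_0_0 [simp]: "coeff2 (f ^ n) 0 0 = coeff2 f 0 0 ^ n"
  by (induction n) simp_all

lemma coeff2_power_jet [simp]:
  "coeff2 (f ^ n) (Suc 0) 0 = of_nat n * coeff2 f 0 0 ^ (n - 1) * coeff2 f (Suc 0) 0"
  "coeff2 (f ^ n) 0 (Suc 0) = of_nat n * coeff2 f 0 0 ^ (n - 1) * coeff2 f 0 (Suc 0)"
proof (induction n)
  case (Suc n)
  { case 1 show ?case using Suc by (cases n) (simp_all add: algebra_simps) }
  { case 2 show ?case using Suc by (cases n) (simp_all add: algebra_simps) }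
qed simp_all

subsection \<open>The primes \<open>u\<close> and \<open>v\<close>\<close>

text \<open>Restriction to the line \<open>u = 0\<close>, a ring homomorphism whose kernel is
  generated by \<open>U\<close>; divisibility by \<open>U\<close> thus becomes the vanishing of a
  series in one variable, and \<open>U\<close> is prime because the target is a domain.\<close>

definition set_u_0 :: "series2 \<Rightarrow> complex fps" where
  "set_u_0 f = Abs_fps (\<lambda>j. coeff2 f 0 j)"

definition set_v_0 :: "series2 \<Rightarrow> complex fps" where
  "set_v_0 f = fps_nth f 0"

lemma set_u_0_hom [simp]:
  "set_u_0 (f + g) = set_u_0 f + set_u_0 g" "set_u_0 (f - g) = set_u_0 f - set_u_0 g"
  "set_u_0 (- f) = - set_u_0 f" "set_u_0 (f * g) = set_u_0 f * set_u_0 g"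
  "set_u_0 (const2 c) = fps_const c" "set_u_0 U = 0" "set_u_0 V = fps_X"
  "set_u_0 0 = 0" "set_u_0 1 = 1" "set_u_0 (numeral n) = numeral n"
  by (auto simp: set_u_0_def fps_eq_iff coeff2_mult fps_mult_nth atLeast0AtMost fps_X_def
      fps_one_nth fps_numeral_nth)

lemma set_u_0_power [simp]: "set_u_0 (f ^ n) = set_u_0 f ^ n"
  by (induction n) simp_all

lemma set_v_0_hom [simp]:
  "set_v_0 (f + g) = set_v_0 f + set_v_0 g" "set_v_0 (f - g) = set_v_0 f - set_v_0 g"
  "set_v_0 (- f) = - set_v_0 f" "set_v_0 (f * g) = set_v_0 f * set_v_0 g"
  "set_v_0 (const2 c) = fps_const c" "set_v_0 U = fps_X" "set_v_0 V = 0"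
  "set_v_0 0 = 0" "set_v_0 1 = 1" "set_v_0 (numeral n) = numeral n"
  by (simp_all add: set_v_0_def const2_def U_def V_def fps_numeral_nth)

lemma set_v_0_power [simp]: "set_v_0 (f ^ n) = set_v_0 f ^ n"
  by (induction n) simp_all

lemma U_dvd_iff: "U dvd f \<longleftrightarrow> set_u_0 f = 0"
proof
  assume f: "set_u_0 f = 0"
  have "f = U * Abs_fps (\<lambda>j. Abs_fps (\<lambda>i. coeff2 f (Suc i) j))"
  proof (rule series2_eqI)
    fix i j
    have "coeff2 f 0 j = 0"
      using f by (simp add: set_u_0_def fps_eq_iff)
    then show "coeff2 f i j = coeff2 (U * Abs_fps (\<lambda>j. Abs_fps (\<lambda>i. coeff2 f (Suc i) j))) i j"
      by (cases i) (simp_all add: coeff2_U_mult, simp add: coeff2_def)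
  qed
  then show "U dvd f" by (metis dvd_triv_left)
qed auto

lemma V_dvd_iff: "V dvd f \<longleftrightarrow> set_v_0 f = 0"
proof
  assume f: "set_v_0 f = 0"
  have "f = V * Abs_fps (\<lambda>j. fps_nth f (Suc j))"
  proof (rule series2_eqI)
    fix i j
    have "coeff2 f i 0 = 0"
      using f by (simp add: set_v_0_def coeff2_def)
    then show "coeff2 f i j = coeff2 (V * Abs_fps (\<lambda>j. fps_nth f (Suc j))) i j"
      by (cases j) (simp_all add: coeff2_V_mult, simp add: coeff2_def)
  qed
  then show "V dvd f" by (metis dvd_triv_left)
qed auto

lemma U_nonzero [simp]: "U \<noteq> 0" and V_nonzero [simp]: "V \<noteq> 0"
  by (metis set_v_0_hom(6,8) fps_X_neq_zero, metis set_u_0_hom(7,8) fps_X_neq_zero)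

lemma prime_U: "prime_elem U"
  unfolding prime_elem_def by (auto simp: U_dvd_iff)

subsection \<open>Substitution into polynomials\<close>

definition vanishes :: "nat \<Rightarrow> series2 \<Rightarrow> bool" where
  "vanishes n f \<longleftrightarrow> (\<forall>i j. i + j < n \<longrightarrow> coeff2 f i j = 0)"

lemma vanishes_mult:
  assumes "vanishes m f" "vanishes n g"
  shows "vanishes (m + n) (f * g)"
  unfolding vanishes_def
proof (intro allI impI)
  fix i j assume ij: "i + j < m + n"
  have "coeff2 f p q * coeff2 g (i - p) (j - q) = 0" if "p \<le> i" "q \<le> j" for p q
  proof (cases "p + q < m")
    case True
    then show ?thesis using assms(1) by (simp add: vanishes_def)
  next
    case False
    then have "i - p + (j - q) < n" using ij that by linarith
    then show ?thesis using assms(2) by (simp add: vanishes_def)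
  qed
  then show "coeff2 (f * g) i j = 0"
    unfolding coeff2_mult by (intro sum.neutral ballI) (simp only: atMost_iff)
qed

lemma vanishes_power: "coeff2 g 0 0 = 0 \<Longrightarrow> vanishes k (g ^ k)"
proof (induction k)
  case (Suc k)
  have "vanishes 1 g" using Suc.prems by (simp add: vanishes_def)
  then show ?case using vanishes_mult[of 1 g k "g ^ k"] Suc by simp
qed (simp add: vanishes_def)

text \<open>A finite sum whose low coefficients agree with those of \<open>subst2\<close>. The
  bounds are independent because multiplying \<open>f\<close> by \<open>U\<close> or
  \<open>V\<close> shifts only one of the two summation indices.\<close>

definition trunc_subst2 :: "nat \<Rightarrow> nat \<Rightarrow> series2 \<Rightarrow> series2 \<Rightarrow> series2 \<Rightarrow> series2" where
  "trunc_subst2 K L f g h = (\<Sum>k<K. \<Sum>l<L. const2 (coeff2 f k l) * (g ^ k * h ^ l))"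

context
  fixes g h :: series2
  assumes g0: "coeff2 g 0 0 = 0" and h0: "coeff2 h 0 0 = 0"
begin

lemma coeff2_subst2:
  assumes "i + j < K" "i + j < L"
  shows "coeff2 (subst2 f g h) i j = coeff2 (trunc_subst2 K L f g h) i j"
proof -
  have zero: "coeff2 (g ^ k * h ^ l) i j = 0" if "i + j < k + l" for k l
    using vanishes_mult[OF vanishes_power[OF g0, of k] vanishes_power[OF h0, of l]] that
    by (simp add: vanishes_def)
  have "coeff2 (trunc_subst2 K L f g h) i j =
          (\<Sum>k<K. \<Sum>l<L. coeff2 f k l * coeff2 (g ^ k * h ^ l) i j)"
    by (simp add: trunc_subst2_def coeff2_sum)
  also have "\<dots> = (\<Sum>k\<le>i + j. \<Sum>l<L. coeff2 f k l * coeff2 (g ^ k * h ^ l) i j)"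
    using assms by (intro sum.mono_neutral_right) (auto simp: zero)
  also have "\<dots> = (\<Sum>k\<le>i + j. \<Sum>l\<le>i + j. coeff2 f k l * coeff2 (g ^ k * h ^ l) i j)"
    using assms by (intro sum.cong refl sum.mono_neutral_right) (auto simp: zero)
  finally show ?thesis
    by (simp add: subst2_def coeff2_def)
qed

lemma subst2_add: "subst2 (f + f') g h = subst2 f g h + subst2 f' g h"
  by (rule series2_eqI) (simp add: subst2_def coeff2_def algebra_simps sum.distrib)

lemma subst2_const2_mult: "subst2 (const2 c * f) g h = const2 c * subst2 f g h"
  by (rule series2_eqI)
    (simp add: coeff2_subst2[where K = "Suc _" and L = "Suc _", OF lessI lessI]
      trunc_subst2_def coeff2_sum sum_distrib_left mult.assoc del: sum.lessThan_Suc)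

lemma coeff2_mult_subst2:
  assumes "i + j < N"
  shows "coeff2 (e * subst2 f g h) i j = coeff2 (e * trunc_subst2 N N f g h) i j"
proof -
  have "coeff2 (subst2 f g h) (i - p) (j - q) = coeff2 (trunc_subst2 N N f g h) (i - p) (j - q)"
    for p q using assms by (intro coeff2_subst2) auto
  then show ?thesis by (simp only: coeff2_mult)
qed

lemma subst2_U_mult: "subst2 (U * f) g h = g * subst2 f g h"
proof (rule series2_eqI)
  fix i j
  define N where "N = Suc (i + j)"
  have "coeff2 (subst2 (U * f) g h) i j = coeff2 (trunc_subst2 (Suc N) N (U * f) g h) i j"
    by (rule coeff2_subst2) (simp_all add: N_def)
  also have "trunc_subst2 (Suc N) N (U * f) g h = g * trunc_subst2 N N f g h"
    unfolding trunc_subst2_def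
    by (subst sum.lessThan_Suc_shift) (simp add: coeff2_U_mult sum_distrib_left mult_ac)
  also have "coeff2 \<dots> i j = coeff2 (g * subst2 f g h) i j"
    by (rule coeff2_mult_subst2[symmetric]) (simp add: N_def)
  finally show "coeff2 (subst2 (U * f) g h) i j = coeff2 (g * subst2 f g h) i j" .
qed

lemma subst2_V_mult: "subst2 (V * f) g h = h * subst2 f g h"
proof (rule series2_eqI)
  fix i j
  define N where "N = Suc (i + j)"
  have "coeff2 (subst2 (V * f) g h) i j = coeff2 (trunc_subst2 N (Suc N) (V * f) g h) i j"
    by (rule coeff2_subst2) (simp_all add: N_def)
  also have "trunc_subst2 N (Suc N) (V * f) g h = h * trunc_subst2 N N f g h"
    unfolding trunc_subst2_def
    by (subst sum.lessThan_Suc_shift) (simp add: coeff2_V_mult sum_distrib_left mult_ac)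
  also have "coeff2 \<dots> i j = coeff2 (h * subst2 f g h) i j"
    by (rule coeff2_mult_subst2[symmetric]) (simp add: N_def)
  finally show "coeff2 (subst2 (V * f) g h) i j = coeff2 (h * subst2 f g h) i j" .
qed

lemma subst2_1: "subst2 1 g h = 1"
  by (rule series2_eqI) (simp add: coeff2_subst2[where K = "Suc _" and L = "Suc _", OF lessI lessI]
      trunc_subst2_def coeff2_sum sum.lessThan_Suc_shift del: sum.lessThan_Suc)

end

text \<open>The subring generated by constants, \<open>U\<close> and \<open>V\<close>. As an
  inductive predicate it allows multiplicativity of \<open>subst2\<close> to be proved by induction
  on a polynomial left factor instead of by a convolution of infinite series.\<close>

inductive polynomial2 :: "series2 \<Rightarrow> bool" where
  const2: "polynomial2 (const2 c)"
| U: "polynomial2 U"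
| V: "polynomial2 V"
| add: "polynomial2 f \<Longrightarrow> polynomial2 g \<Longrightarrow> polynomial2 (f + g)"
| mult: "polynomial2 f \<Longrightarrow> polynomial2 g \<Longrightarrow> polynomial2 (f * g)"

declare polynomial2.intros [simp, intro]

lemma polynomial2_numeral [simp, intro]: "polynomial2 1" "polynomial2 (numeral n)"
  using polynomial2.const2[of 1] polynomial2.const2[of "numeral n"] by simp_all

lemma polynomial2_minus [simp, intro]: "polynomial2 f \<Longrightarrow> polynomial2 (- f)"
  using polynomial2.mult[OF polynomial2.const2[of "- 1"]] by (simp add: const2_hom(6))

lemma polynomial2_diff [simp, intro]: "polynomial2 f \<Longrightarrow> polynomial2 g \<Longrightarrow> polynomial2 (f - g)"
  using polynomial2.add[OF _ polynomial2_minus] by fastforce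

lemma polynomial2_power [simp, intro]: "polynomial2 f \<Longrightarrow> polynomial2 (f ^ n)"
  by (induction n) simp_all

context
  fixes g h :: series2
  assumes gh: "coeff2 g 0 0 = 0" "coeff2 h 0 0 = 0"
begin

lemma subst2_basic:
  "subst2 U g h = g" "subst2 V g h = h" "subst2 (const2 c) g h = const2 c"
  using subst2_U_mult[OF gh, of 1] subst2_V_mult[OF gh, of 1] subst2_const2_mult[OF gh, of c 1]
  by (simp_all add: subst2_1[OF gh])

lemma subst2_numeral: "subst2 (numeral n) g h = numeral n"
  using subst2_basic(3)[of "numeral n"] by simp

lemma subst2_mult:
  assumes "polynomial2 f"
  shows "subst2 (f * f') g h = subst2 f g h * subst2 f' g h"
  using assms
proof (induction f arbitrary: f')
  case (mult p q)
  then show ?case by (simp add: mult.assoc)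
qed (simp_all add: subst2_basic subst2_add[OF gh] subst2_U_mult[OF gh] subst2_V_mult[OF gh]
    subst2_const2_mult[OF gh] distrib_right)

lemma subst2_minus: "subst2 (- f) g h = - subst2 f g h"
  using subst2_const2_mult[OF gh, of "- 1" f] by (simp add: const2_hom(6))

lemma subst2_diff: "subst2 (f - f') g h = subst2 f g h - subst2 f' g h"
  using subst2_add[OF gh, of f "- f'"] by (simp add: subst2_minus)

lemma subst2_power: "polynomial2 f \<Longrightarrow> subst2 (f ^ n) g h = subst2 f g h ^ n"
  by (induction n) (simp_all add: subst2_1[OF gh] subst2_mult)

lemmas subst2_simps = subst2_basic subst2_1[OF gh] subst2_numeral subst2_add[OF gh] subst2_minus
  subst2_diff subst2_mult subst2_power

end

subsection \<open>Derivatives\<close>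

lemma fps_nth_deriv_u: "fps_nth (deriv_u f) j = fps_deriv (fps_nth f j)"
  by (simp add: deriv_u_def)

lemma deriv_u_simps [simp]:
  "deriv_u (f + g) = deriv_u f + deriv_u g"
  "deriv_u (f - g) = deriv_u f - deriv_u g"
  "deriv_u (const2 c) = 0" "deriv_u U = 1" "deriv_u V = 0"
  by (simp_all add: deriv_u_def fps_eq_iff[where 'a = "complex fps"] U_def V_def const2_def)

lemma deriv_u_mult [simp]: "deriv_u (f * g) = deriv_u f * g + f * deriv_u g"
proof (rule fps_ext)
  fix n
  have "fps_nth (deriv_u (f * g)) n =
      (\<Sum>i = 0..n. fps_nth f i * fps_deriv (fps_nth g (n - i))) +
      (\<Sum>i = 0..n. fps_deriv (fps_nth f i) * fps_nth g (n - i))"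
    by (simp only: fps_nth_deriv_u fps_mult_nth fps_deriv_sum fps_deriv_mult sum.distrib)
  then show "fps_nth (deriv_u (f * g)) n = fps_nth (deriv_u f * g + f * deriv_u g) n"
    by (simp only: fps_nth_deriv_u fps_mult_nth fps_add_nth add.commute)
qed

lemma deriv_v_simps [simp]:
  "deriv_v (f + g) = deriv_v f + deriv_v g"
  "deriv_v (f - g) = deriv_v f - deriv_v g"
  "deriv_v (f * g) = deriv_v f * g + f * deriv_v g"
  "deriv_v (const2 c) = 0" "deriv_v U = 0" "deriv_v V = 1"
  by (simp_all add: deriv_v_def U_def V_def const2_def)

subsection \<open>Transforms\<close>

text \<open>Power series form a domain, so two different exponents would leave a factor
  \<open>e\<close> in both coefficients of one side after cancellation. One explicit pullback
  therefore determines the transform.\<close>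

lemma transform_germ_unique:
  assumes "pullback g h \<omega> = (e ^ k * a, e ^ k * b)" and "\<not> (e dvd a \<and> e dvd b)"
    and "transform_germ g h e \<omega> \<omega>'" and "e \<noteq> 0"
  shows "\<omega>' = (a, b)"
proof -
  obtain a' b' where \<omega>': "\<omega>' = (a', b')" by (cases \<omega>')
  obtain m where m: "e ^ k * a = e ^ m * a'" "e ^ k * b = e ^ m * b'" and
    nd: "\<not> (e dvd a' \<and> e dvd b')"
    using assms(1,3) by (auto simp: \<omega>')
  have dvd: "e dvd x" if "e ^ k * x = e ^ m * y" "k < m" for x y :: series2 and k m
  proof -
    obtain d where "m = k + Suc d" using less_imp_Suc_add[OF \<open>k < m\<close>] by auto
    then have "e ^ k * x = e ^ k * (e * (e ^ d * y))"
      using that(1) by (simp add: power_add mult_ac)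
    then show ?thesis using \<open>e \<noteq> 0\<close> by simp
  qed
  consider "k < m" | "m < k" | "k = m" by linarith
  then show ?thesis
  proof cases
    case 1
    then show ?thesis using dvd m assms(2) by blast
  next
    case 2
    then show ?thesis using dvd[of m _ k] m[symmetric] nd by metis
  next
    case 3
    then show ?thesis using m \<omega>' \<open>e \<noteq> 0\<close> by simp
  qed
qed

lemma strict_transform_unique:
  assumes "subst2 f g h = e ^ k * p" and "\<not> e dvd p"
    and "strict_transform g h e f f'" and "e \<noteq> 0"
  shows "f' = p"
proof -
  obtain m where m: "e ^ k * p = e ^ m * f'" and nd: "\<not> e dvd f'"
    using assms(1,3) by (auto simp: strict_transform_def)
  have dvd: "e dvd x" if "e ^ k * x = e ^ m * y" "k < m" for x y :: series2 and k m
  proof -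
    obtain d where "m = k + Suc d" using less_imp_Suc_add[OF \<open>k < m\<close>] by auto
    then have "e ^ k * x = e ^ k * (e * (e ^ d * y))"
      using that(1) by (simp add: power_add mult_ac)
    then show ?thesis using \<open>e \<noteq> 0\<close> by simp
  qed
  consider "k < m" | "m < k" | "k = m" by linarith
  then show ?thesis
    using dvd[of k p m f'] dvd[of m f' k p] m assms(2,4) nd by cases auto
qed

subsection \<open>The infinitely near points that are not reduced\<close>

text \<open>With \<open>y = v / u\<close> and \<open>t = (u v + u - v\<^sup>2) / u\<^sup>2\<close> the germ at the origin is
  \<open>u\<^sup>9 ((1 - 2 t - t y + t\<^sup>3) dt - t\<^sup>3 dy)\<close>. At the later points \<open>y = 1 / u\<close>, and \<open>t\<close> is
  \<open>S1 / (u\<^sup>2 v)\<close>, \<open>S2 / (u\<^sup>2 W)\<close>, \<open>S2 / (u W3)\<close>, \<open>S2 / W4\<close> and \<open>S5 / (u W5)\<close>, respectively. The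
  point \<open>N1\<close> lies on the blow-up of \<open>N0\<close>, \<open>N2\<close> on that of \<open>N1\<close>, \<open>N3\<close> and \<open>N5\<close> on that of \<open>N2\<close>,
  and \<open>N4\<close> on that of \<open>N3\<close>. The exceptional divisor has at each of them a single component, \<open>v = 0\<close>
  at \<open>N1\<close> and \<open>u = 0\<close> at the others.\<close>

definition "T0 = U * V + U - V ^ 2"
definition "P0 = U ^ 6 - 2 * T0 * U ^ 4 - T0 * V * U ^ 3 + T0 ^ 3"
definition N0 :: germ where
  "N0 = (P0 * (2 * V ^ 2 - U * V - U) + U * V * T0 ^ 3, U * ((U - 2 * V) * P0 - U * T0 ^ 3))"

definition "S1 = U + U * V - V"
definition "Q1 = U ^ 6 * V ^ 3 - 2 * S1 * U ^ 4 * V ^ 2 + S1 ^ 3 - U ^ 3 * S1 * V ^ 2"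
definition N1 :: germ where
  "N1 = (Q1 * V * (2 * V - U - U * V) + U * S1 ^ 3 * V ^ 2, - (U ^ 2 * Q1))"

definition "W = 1 + V"
definition "S2 = U * W - V"
definition "Q2 = U ^ 6 * W ^ 3 - 2 * S2 * U ^ 4 * W ^ 2 + S2 ^ 3 - U ^ 3 * S2 * W ^ 2"
definition N2 :: germ where
  "N2 = (Q2 * W * (2 * V - U * W) + U * S2 ^ 3 * W ^ 2, - (U * Q2))"

definition "W3 = 1 + U * W"
definition "Q3 = U ^ 3 * W3 ^ 3 - 2 * S2 * U ^ 2 * W3 ^ 2 + S2 ^ 3 - U * S2 * W3 ^ 2"
definition N3 :: germ where
  "N3 = (Q3 * (W3 * (2 * W - W3) - W) + S2 ^ 3 * W3 ^ 2, - (U * Q3))"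

definition "W4 = 1 + U * W3"
definition "Q4 = U * (W4 ^ 3 - 2 * S2 * W4 ^ 2 + S2 ^ 3) - S2 * W4 ^ 2"
definition N4 :: germ where
  "N4 = (U * Q4 * (2 * W * W3 - W3 ^ 2) + S2 ^ 3 * W4 ^ 2, - (U * Q4))"

definition "W5 = 1 + U * V"
definition "S5 = W5 - V"
definition "Q5 = U ^ 3 * W5 ^ 3 - 2 * S5 * U ^ 2 * W5 ^ 2 + S5 ^ 3 - U * S5 * W5 ^ 2"
definition N5 :: germ where
  "N5 = (Q5 * (W5 * (2 * V - W5) - V) + S5 ^ 3 * W5 ^ 2, - (U * Q5))"

lemmas aux_defs = T0_def P0_def S1_def Q1_def W_def S2_def Q2_def W3_def Q3_def W4_def Q4_def
  W5_def S5_def Q5_def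

lemma polynomial2_aux [simp]:
  "polynomial2 T0" "polynomial2 P0" "polynomial2 S1" "polynomial2 Q1" "polynomial2 W"
  "polynomial2 S2" "polynomial2 Q2" "polynomial2 W3" "polynomial2 Q3" "polynomial2 W4"
  "polynomial2 Q4" "polynomial2 W5" "polynomial2 S5" "polynomial2 Q5"
  by (simp_all add: aux_defs)

text \<open>The power of \<open>U\<close> split off is the multiplicity of the germ: 4 here, and 5,
  4, 3, 2, 1 for \<open>N1\<close> to \<open>N5\<close>. The \<open>dv\<close>-coefficient keeps a
  further factor \<open>U\<close>, which makes the exceptional line invariant.\<close>

lemma N0_U:
  fixes c defines "y \<equiv> const2 c + V" defines "t \<equiv> 1 + U * y - U * y ^ 2"
  defines "p \<equiv> U ^ 3 - 2 * U ^ 2 * t - U ^ 2 * y * t + t ^ 3"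
  shows "pullback U (U * (const2 c + V)) N0 =
    (U ^ 4 * - p, U ^ 4 * (U ^ 2 * ((1 - 2 * y) * p - t ^ 3)))"
proof -
  have "coeff2 U 0 0 = 0" "coeff2 (U * y) 0 0 = 0" by simp_all
  note s = subst2_simps[OF this]
  have d: "deriv_u y = 0" "deriv_v y = 1" by (simp_all add: y_def)
  have 1: "subst2 T0 U (U * y) = U * t"
    unfolding T0_def t_def by (simp add: s algebra_simps power2_eq_square)
  have 2: "subst2 P0 U (U * y) = U ^ 3 * p"
    unfolding P0_def p_def by (simp add: s 1 algebra_simps eval_nat_numeral)
  show ?thesis unfolding y_def[symmetric]
    unfolding N0_def pullback.simps prod.inject
    by (simp add: s 1 2 d) (simp add: algebra_simps eval_nat_numeral)
qed

lemma N0_V: "pullback (U * V) V N0 = (V ^ 4 * fst N1, V ^ 4 * snd N1)"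
proof -
  have "coeff2 (U * V) 0 0 = 0" "coeff2 V 0 0 = 0" by simp_all
  note s = subst2_simps[OF this]
  have 1: "subst2 T0 (U * V) V = V * S1"
    unfolding T0_def S1_def by (simp add: s algebra_simps power2_eq_square)
  have 2: "subst2 P0 (U * V) V = V ^ 3 * Q1"
    unfolding P0_def Q1_def by (simp add: s 1 algebra_simps eval_nat_numeral)
  show ?thesis unfolding N0_def N1_def pullback.simps prod.inject
    by (simp add: s 1 2) (simp add: algebra_simps eval_nat_numeral)
qed

lemma N1_U:
  fixes c defines "y \<equiv> const2 c + V" defines "r \<equiv> 1 + U * y - y"
  defines "q \<equiv> U ^ 6 * y ^ 3 - 2 * U ^ 4 * r * y ^ 2 + r ^ 3 - U ^ 3 * r * y ^ 2"
  shows "pullback U (U * (const2 c + V)) N1 =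
    (U ^ 5 * (y * (q * (2 * y - 2 - U * y) + U * r ^ 3 * y)), U ^ 5 * - (U * q))"
proof -
  have "coeff2 U 0 0 = 0" "coeff2 (U * y) 0 0 = 0" by simp_all
  note s = subst2_simps[OF this]
  have d: "deriv_u y = 0" "deriv_v y = 1" by (simp_all add: y_def)
  have 1: "subst2 S1 U (U * y) = U * r"
    unfolding S1_def r_def by (simp add: s algebra_simps power2_eq_square)
  have 2: "subst2 Q1 U (U * y) = U ^ 3 * q"
    unfolding Q1_def q_def by (simp add: s 1 algebra_simps eval_nat_numeral)
  show ?thesis unfolding y_def[symmetric]
    unfolding N1_def pullback.simps prod.inject
    by (simp add: s 1 2 d) (simp add: algebra_simps eval_nat_numeral)
qed

lemma N1_V:
  defines "r \<equiv> U + U * V - 1" defines "q \<equiv> U ^ 6 * V ^ 6 - 2 * r * U ^ 4 * V ^ 4 + r ^ 3 - U ^ 3 * V ^ 3 * r"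
  shows "pullback (U * V) V N1 =
    (V ^ 5 * (V * (q * (2 - U - U * V) + U * V * r ^ 3)), V ^ 5 * (U * (q * (2 - 2 * U - U * V) + U * V * r ^ 3)))"
proof -
  have "coeff2 (U * V) 0 0 = 0" "coeff2 V 0 0 = 0" by simp_all
  note s = subst2_simps[OF this]
  have 1: "subst2 S1 (U * V) V = V * r"
    unfolding S1_def r_def by (simp add: s  algebra_simps eval_nat_numeral)
  have 2: "subst2 Q1 (U * V) V = V ^ 3 * q"
    unfolding Q1_def q_def by (simp add: s 1 algebra_simps eval_nat_numeral)
  show ?thesis
    unfolding N1_def pullback.simps prod.inject
    by (simp add: s 1 2) (simp add:  algebra_simps eval_nat_numeral)
qed

lemma N2_U:
  fixes c defines "y \<equiv> const2 c + V" defines "w \<equiv> 1 + U * y" defines "r \<equiv> w - y" defines "q \<equiv> U ^ 3 * w ^ 3 - 2 * r * U ^ 2 * w ^ 2 + r ^ 3 - U * r * w ^ 2"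
  shows "pullback U (U * (const2 c + V)) N2 =
    (U ^ 4 * (q * (w * (2 * y - w) - y) + r ^ 3 * w ^ 2), U ^ 4 * (- (U * q)))"
proof -
  have "coeff2 U 0 0 = 0" "coeff2 (U * y) 0 0 = 0" by simp_all
  note s = subst2_simps[OF this]
  have d: "deriv_u y = 0" "deriv_v y = 1" by (simp_all add: y_def)
  have 1: "subst2 W U (U * y) = w"
    unfolding W_def w_def by (simp add: s  algebra_simps eval_nat_numeral)
  have 2: "subst2 S2 U (U * y) = U * r"
    unfolding S2_def r_def by (simp add: s 1 algebra_simps eval_nat_numeral)
  have 3: "subst2 Q2 U (U * y) = U ^ 3 * q"
    unfolding Q2_def q_def by (simp add: s 1 2 algebra_simps eval_nat_numeral)
  show ?thesis unfolding y_def[symmetric]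
    unfolding N2_def pullback.simps prod.inject
    by (simp add: s 1 2 3 d) (simp add:  algebra_simps eval_nat_numeral)
qed

lemma N2_V:
  defines "r \<equiv> U * W - 1" defines "q \<equiv> U ^ 6 * V ^ 3 * W ^ 3 - 2 * r * U ^ 4 * V ^ 2 * W ^ 2 + r ^ 3 - U ^ 3 * V * r * W ^ 2"
  shows "pullback (U * V) V N2 =
    (V ^ 4 * (V * (q * W * (2 - U * W) + U * r ^ 3 * W ^ 2)), V ^ 4 * (U * (q * W * (2 - U * W) + U * r ^ 3 * W ^ 2 - q)))"
proof -
  have "coeff2 (U * V) 0 0 = 0" "coeff2 V 0 0 = 0" by simp_all
  note s = subst2_simps[OF this]
  have 1: "subst2 W (U * V) V = W"
    unfolding W_def W_def by (simp add: s  algebra_simps eval_nat_numeral)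
  have 2: "subst2 S2 (U * V) V = V * r"
    unfolding S2_def r_def by (simp add: s 1 algebra_simps eval_nat_numeral)
  have 3: "subst2 Q2 (U * V) V = V ^ 3 * q"
    unfolding Q2_def q_def by (simp add: s 1 2 algebra_simps eval_nat_numeral)
  show ?thesis
    unfolding N2_def pullback.simps prod.inject
    by (simp add: s 1 2 3) (simp add:  algebra_simps eval_nat_numeral)
qed

lemma N3_U:
  fixes c defines "y \<equiv> const2 c + V" defines "z \<equiv> 1 + U * y" defines "w \<equiv> 1 + U * z" defines "r \<equiv> z - y" defines "q \<equiv> U * w ^ 3 - 2 * U * r * w ^ 2 + U * r ^ 3 - r * w ^ 2" defines "m \<equiv> y + 2 * U * y * z - U * z ^ 2"
  shows "pullback U (U * (const2 c + V)) N3 =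
    (U ^ 3 * (q * m + r ^ 3 * w ^ 2 - y * q), U ^ 3 * (- (U * q)))"
proof -
  have "coeff2 U 0 0 = 0" "coeff2 (U * y) 0 0 = 0" by simp_all
  note s = subst2_simps[OF this]
  have d: "deriv_u y = 0" "deriv_v y = 1" by (simp_all add: y_def)
  have 1: "subst2 W U (U * y) = z"
    unfolding W_def z_def by (simp add: s  algebra_simps eval_nat_numeral)
  have 2: "subst2 W3 U (U * y) = w"
    unfolding W3_def w_def by (simp add: s 1 algebra_simps eval_nat_numeral)
  have 3: "subst2 S2 U (U * y) = U * r"
    unfolding S2_def r_def by (simp add: s 1 2 algebra_simps eval_nat_numeral)
  have 4: "subst2 Q3 U (U * y) = U ^ 2 * q"
    unfolding Q3_def q_def by (simp add: s 1 2 3 algebra_simps eval_nat_numeral)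
  show ?thesis unfolding y_def[symmetric]
    unfolding N3_def pullback.simps prod.inject
    by (simp add: s 1 2 3 4 d) (simp add: w_def m_def z_def algebra_simps eval_nat_numeral)
qed

lemma N3_V:
  defines "w \<equiv> 1 + U * V * W" defines "r \<equiv> U * W - 1" defines "q \<equiv> U ^ 3 * V * w ^ 3 - 2 * r * U ^ 2 * V * w ^ 2 + V * r ^ 3 - U * r * w ^ 2" defines "m \<equiv> 1 + 2 * U * V * W - U ^ 2 * V * W ^ 2"
  shows "pullback (U * V) V N3 =
    (V ^ 3 * (V * (q * m + r ^ 3 * w ^ 2)), V ^ 3 * (U * (q * m + r ^ 3 * w ^ 2 - q)))"
proof -
  have "coeff2 (U * V) 0 0 = 0" "coeff2 V 0 0 = 0" by simp_all
  note s = subst2_simps[OF this]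
  have 1: "subst2 W (U * V) V = W"
    unfolding W_def W_def by (simp add: s  algebra_simps eval_nat_numeral)
  have 2: "subst2 W3 (U * V) V = w"
    unfolding W3_def w_def by (simp add: s 1 algebra_simps eval_nat_numeral)
  have 3: "subst2 S2 (U * V) V = V * r"
    unfolding S2_def r_def by (simp add: s 1 2 algebra_simps eval_nat_numeral)
  have 4: "subst2 Q3 (U * V) V = V ^ 2 * q"
    unfolding Q3_def q_def by (simp add: s 1 2 3 algebra_simps eval_nat_numeral)
  show ?thesis
    unfolding N3_def pullback.simps prod.inject
    by (simp add: s 1 2 3 4) (simp add: w_def m_def W_def algebra_simps eval_nat_numeral)
qed

lemma N4_U:
  fixes c defines "y \<equiv> const2 c + V" defines "z \<equiv> 1 + U * y" defines "x \<equiv> 1 + U * z" defines "w \<equiv> 1 + U * x" defines "r \<equiv> z - y" defines "q \<equiv> w ^ 3 - 2 * U * r * w ^ 2 + U ^ 3 * r ^ 3 - r * w ^ 2"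
  shows "pullback U (U * (const2 c + V)) N4 =
    (U ^ 2 * (q * (2 * z * x - x ^ 2) + U * r ^ 3 * w ^ 2 - y * q), U ^ 2 * (- (U * q)))"
proof -
  have "coeff2 U 0 0 = 0" "coeff2 (U * y) 0 0 = 0" by simp_all
  note s = subst2_simps[OF this]
  have d: "deriv_u y = 0" "deriv_v y = 1" by (simp_all add: y_def)
  have 1: "subst2 W U (U * y) = z"
    unfolding W_def z_def by (simp add: s  algebra_simps eval_nat_numeral)
  have 2: "subst2 W3 U (U * y) = x"
    unfolding W3_def x_def by (simp add: s 1 algebra_simps eval_nat_numeral)
  have 3: "subst2 W4 U (U * y) = w"
    unfolding W4_def w_def by (simp add: s 1 2 algebra_simps eval_nat_numeral)
  have 4: "subst2 S2 U (U * y) = U * r"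
    unfolding S2_def r_def by (simp add: s 1 2 3 algebra_simps eval_nat_numeral)
  have 5: "subst2 Q4 U (U * y) = U * q"
    unfolding Q4_def q_def by (simp add: s 1 2 3 4 algebra_simps eval_nat_numeral)
  show ?thesis unfolding y_def[symmetric]
    unfolding N4_def pullback.simps prod.inject
    by (simp add: s 1 2 3 4 5 d) (simp add:  algebra_simps eval_nat_numeral)
qed

lemma N4_V:
  defines "x \<equiv> 1 + U * V * W" defines "w \<equiv> 1 + U * V * x" defines "r \<equiv> U * W - 1" defines "q \<equiv> U * (w ^ 3 - 2 * V * r * w ^ 2 + V ^ 3 * r ^ 3) - r * w ^ 2"
  shows "pullback (U * V) V N4 =
    (V ^ 2 * (V * (U * q * (2 * W * x - x ^ 2) + V * r ^ 3 * w ^ 2)), V ^ 2 * (U * (U * q * (2 * W * x - x ^ 2) + V * r ^ 3 * w ^ 2 - q)))"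
proof -
  have "coeff2 (U * V) 0 0 = 0" "coeff2 V 0 0 = 0" by simp_all
  note s = subst2_simps[OF this]
  have 1: "subst2 W (U * V) V = W"
    unfolding W_def W_def by (simp add: s  algebra_simps eval_nat_numeral)
  have 2: "subst2 W3 (U * V) V = x"
    unfolding W3_def x_def by (simp add: s 1 algebra_simps eval_nat_numeral)
  have 3: "subst2 W4 (U * V) V = w"
    unfolding W4_def w_def by (simp add: s 1 2 algebra_simps eval_nat_numeral)
  have 4: "subst2 S2 (U * V) V = V * r"
    unfolding S2_def r_def by (simp add: s 1 2 3 algebra_simps eval_nat_numeral)
  have 5: "subst2 Q4 (U * V) V = V * q"
    unfolding Q4_def q_def by (simp add: s 1 2 3 4 algebra_simps eval_nat_numeral)
  show ?thesis
    unfolding N4_def pullback.simps prod.inject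
    by (simp add: s 1 2 3 4 5) (simp add:  algebra_simps eval_nat_numeral)
qed

lemma N5_U:
  fixes c defines "y \<equiv> const2 c + V" defines "w \<equiv> 1 + U ^ 2 * y" defines "r \<equiv> w - U * y" defines "p \<equiv> U ^ 2 * w ^ 3 - 2 * r * U * w ^ 2 - r * w ^ 2"
  shows "pullback U (U * (const2 c + V)) N5 =
    (U ^ 1 * (r ^ 3 * y * (2 * w - 1) + p * (U * y * (2 * w - 1) - w ^ 2) - y * (r ^ 3 + U * p)), U ^ 1 * (- (U * (r ^ 3 + U * p))))"
proof -
  have "coeff2 U 0 0 = 0" "coeff2 (U * y) 0 0 = 0" by simp_all
  note s = subst2_simps[OF this]
  have d: "deriv_u y = 0" "deriv_v y = 1" by (simp_all add: y_def)
  have 1: "subst2 W5 U (U * y) = w"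
    unfolding W5_def w_def by (simp add: s  algebra_simps eval_nat_numeral)
  have 2: "subst2 S5 U (U * y) = r"
    unfolding S5_def r_def by (simp add: s 1 algebra_simps eval_nat_numeral)
  have 3: "subst2 Q5 U (U * y) = r ^ 3 + U * p"
    unfolding Q5_def p_def by (simp add: s 1 2 algebra_simps eval_nat_numeral)
  show ?thesis unfolding y_def[symmetric]
    unfolding N5_def pullback.simps prod.inject
    by (simp add: s 1 2 3 d) (simp add:  algebra_simps eval_nat_numeral)
qed

lemma N5_V:
  defines "w \<equiv> 1 + U * V ^ 2" defines "r \<equiv> w - V" defines "p \<equiv> U ^ 2 * V ^ 2 * w ^ 3 - 2 * r * U * V * w ^ 2 - r * w ^ 2" defines "m \<equiv> r ^ 3 * (2 * w - 1) + U * p * (V * (2 * w - 1) - w ^ 2)"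
  shows "pullback (U * V) V N5 =
    (V ^ 1 * (V * m), V ^ 1 * (U * (m - r ^ 3 - U * V * p)))"
proof -
  have "coeff2 (U * V) 0 0 = 0" "coeff2 V 0 0 = 0" by simp_all
  note s = subst2_simps[OF this]
  have 1: "subst2 W5 (U * V) V = w"
    unfolding W5_def w_def by (simp add: s  algebra_simps eval_nat_numeral)
  have 2: "subst2 S5 (U * V) V = r"
    unfolding S5_def r_def by (simp add: s 1 algebra_simps eval_nat_numeral)
  have 3: "subst2 Q5 (U * V) V = r ^ 3 + U * V * p"
    unfolding Q5_def p_def by (simp add: s 1 2 algebra_simps eval_nat_numeral)
  show ?thesis
    unfolding N5_def pullback.simps prod.inject
    by (simp add: s 1 2 3) (simp add: m_def algebra_simps eval_nat_numeral)
qed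

subsection \<open>Eigenvalues\<close>

lemma char_poly_2:
  fixes A :: "complex mat"
  assumes "A \<in> carrier_mat 2 2"
  shows "char_poly A = [:A $$ (0, 0) * A $$ (1, 1) - A $$ (0, 1) * A $$ (1, 0), - A $$ (0, 0) - A $$ (1, 1), 1:]"
proof -
  define B where "B = char_poly_matrix A"
  have B: "B \<in> carrier_mat 2 2" using assms by (simp add: B_def)
  have "det B = (\<Sum>i<2. B $$ (i, 0) * cofactor B i 0)"
    by (rule laplace_expansion_column[OF B]) simp
  also have "\<dots> = B $$ (0, 0) * B $$ (1, 1) - B $$ (1, 0) * B $$ (0, 1)"
    using B by (simp add: numeral_2_eq_2 cofactor_def mat_delete_def det_single)
  finally show ?thesis
    using assms by (simp add: char_poly_def B_def char_poly_matrix_def algebra_simps)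
qed

lemma has_eigenvalues_iff:
  "has_eigenvalues (a, b) l1 l2 \<longleftrightarrow>
     l1 + l2 = coeff2 b 1 0 - coeff2 a 0 1 \<and>
     l1 * l2 = coeff2 b 0 1 * coeff2 a 1 0 - coeff2 b 1 0 * coeff2 a 0 1"
proof -
  have "linear_part (a, b) \<in> carrier_mat 2 2"
    by (simp add: mat_of_rows_list_def numeral_2_eq_2)
  then have "char_poly (linear_part (a, b)) =
      [:coeff2 b 0 1 * coeff2 a 1 0 - coeff2 b 1 0 * coeff2 a 0 1, coeff2 a 0 1 - coeff2 b 1 0, 1:]"
    by (simp add: char_poly_2 mat_of_rows_list_def numeral_2_eq_2)
  moreover have "[:- l1, 1:] * [:- l2, 1:] = [:l1 * l2, - l1 - l2, 1:]"
    by simp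
  ultimately show ?thesis
    unfolding has_eigenvalues_def by (auto simp: algebra_simps)
qed

lemma saddle_nodeI:
  assumes "singular (a, b)" "coeff2 b 1 0 \<noteq> coeff2 a 0 1"
    "coeff2 b 0 1 * coeff2 a 1 0 = coeff2 b 1 0 * coeff2 a 0 1"
  shows "saddle_node (a, b)"
  using assms by (auto simp: saddle_node_def has_eigenvalues_iff)

text \<open>One off-diagonal entry of the linear part vanishes, so the eigenvalues are the diagonal
  entries \<open>l1\<close> and \<open>- l2\<close>; their ratio is a negative real number.\<close>

lemma hyperbolicI:
  assumes "singular (a, b)" "coeff2 b 0 1 * coeff2 a 1 0 = 0"
    "coeff2 b 1 0 = complex_of_real l1" "coeff2 a 0 1 = complex_of_real l2" "l1 * l2 > 0"
  shows "hyperbolic (a, b)"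
proof -
  have False if "q > 0" "complex_of_real l1 / - complex_of_real l2 = of_rat q" for q :: rat
  proof -
    have "complex_of_real (of_rat q) = of_rat q"
      by (cases q) (simp add: of_rat_rat)
    then have "complex_of_real (l1 / - l2) = complex_of_real (of_rat q)"
      using that(2) by simp
    then have "l1 / - l2 = of_rat q" by (simp only: of_real_eq_iff)
    moreover have "l1 / - l2 < 0"
      using \<open>l1 * l2 > 0\<close> by (auto simp: zero_less_mult_iff divide_less_0_iff zero_less_divide_iff)
    ultimately show False using \<open>q > 0\<close> by (metis of_rat_less_0_iff less_asym)
  qed
  moreover have "l1 \<noteq> 0" "l2 \<noteq> 0" using assms(5) by auto
  ultimately show ?thesis
    unfolding hyperbolic_def has_eigenvalues_iff using assms
    by (intro conjI exI[of _ "complex_of_real l1"] exI[of _ "- complex_of_real l2"]) auto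
qed

lemma not_reduced_if_linear_part_0:
  assumes "coeff2 a 1 0 = 0" "coeff2 a 0 1 = 0" "coeff2 b 1 0 = 0" "coeff2 b 0 1 = 0"
  shows "\<not> reduced (a, b)"
  using assms by (auto simp: reduced_def saddle_node_def hyperbolic_def has_eigenvalues_iff)

subsection \<open>Divisors\<close>

lemma not_V_dvd_U: "\<not> V dvd U" and not_U_dvd_V: "\<not> U dvd V"
  by (simp_all add: U_dvd_iff V_dvd_iff)

lemma chart_U_subst2:
  "subst2 U U (U * (const2 c + V)) = U" "subst2 V U (U * (const2 c + V)) = U * (const2 c + V)"
  by (simp_all add: subst2_basic)

lemma chart_V_subst2: "subst2 U (U * V) V = U * V" "subst2 V (U * V) V = V"
  by (simp_all add: subst2_basic)

lemma const_plus_fps_X_nonzero: "fps_const c + fps_X \<noteq> (0 :: complex fps)"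
proof
  assume "fps_const c + fps_X = 0"
  then have "fps_nth (fps_const c + fps_X) 1 = 0" by simp
  then show False by simp
qed

text \<open>At the point \<open>v = c\<close> of the new divisor the old line \<open>v = 0\<close>
  becomes \<open>c + v = 0\<close>, which passes through the origin only for \<open>c = 0\<close>;
  the old line \<open>u = 0\<close> pulls back to the new divisor alone and leaves a unit.\<close>

lemma strict_transform_chart_U:
  assumes "strict_transform U (U * (const2 c + V)) U f f'" "f \<in> {U, V}" "coeff2 f' 0 0 = 0"
  shows "f = V \<and> c = 0 \<and> f' = V"
proof (cases "f = V")
  case True
  have "f' = const2 c + V"
  proof (rule strict_transform_unique)
    show "subst2 V U (U * (const2 c + V)) = U ^ 1 * (const2 c + V)"
      by (simp add: chart_U_subst2)
    show "\<not> U dvd const2 c + V"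
      by (simp add: U_dvd_iff const_plus_fps_X_nonzero)
    show "strict_transform U (U * (const2 c + V)) U V f'" using assms(1) True by simp
  qed simp
  then show ?thesis using True assms(3) by simp
next
  case False
  have "f' = 1"
  proof (rule strict_transform_unique)
    show "subst2 U U (U * (const2 c + V)) = U ^ 1 * 1"
      by (simp add: chart_U_subst2)
    show "\<not> U dvd 1" by (simp add: U_dvd_iff)
    show "strict_transform U (U * (const2 c + V)) U U f'" using assms(1,2) False by simp
  qed simp
  then show ?thesis using assms(3) by simp
qed

lemma strict_transform_chart_V:
  assumes "strict_transform (U * V) V V f f'" "f \<in> {U, V}" "coeff2 f' 0 0 = 0"
  shows "f' = U"
proof (cases "f = U")
  case True
  show ?thesis
  proof (rule strict_transform_unique)
    show "subst2 U (U * V) V = V ^ 1 * U"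
      by (simp add: chart_V_subst2)
    show "strict_transform (U * V) V V U f'" using assms(1) True by simp
  qed (simp_all add: not_V_dvd_U)
next
  case False
  have "f' = 1"
  proof (rule strict_transform_unique)
    show "subst2 V (U * V) V = V ^ 1 * 1"
      by (simp add: chart_V_subst2)
    show "\<not> V dvd 1" by (simp add: V_dvd_iff)
    show "strict_transform (U * V) V V V f'" using assms(1,2) False by simp
  qed simp
  then show ?thesis using assms(3) by simp
qed

lemma invariant_U: "U dvd b \<Longrightarrow> invariant_germ (a, b) U"
  and invariant_V: "V dvd a \<Longrightarrow> invariant_germ (a, b) V"
  by simp_all

subsection \<open>The reduction process\<close>

text \<open>The induction invariant. The process stops at nonsingular and reduced points, so there
  only the invariance of the components is recorded; a germ that is blown up again must be one of
  the six nodes, with the possible component through it.\<close>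

definition tracked :: "germ \<Rightarrow> series2 set \<Rightarrow> bool" where
  "tracked \<omega> D \<longleftrightarrow> (\<forall>f\<in>D. invariant_germ \<omega> f) \<and>
     (\<not> singular \<omega> \<or> reduced \<omega> \<or> \<omega> = N0 \<and> D = {} \<or> \<omega> = N1 \<and> D \<subseteq> {V} \<or>
      \<omega> \<in> {N2, N3, N4, N5} \<and> D \<subseteq> {U})"

text \<open>Nonvanishing of \<open>a\<close> on \<open>u = 0\<close> shows that the full power of
  \<open>U\<close> has been removed. As \<open>U\<close> divides \<open>b\<close>, the singular
  points of the chart are the zeros of \<open>a\<close> on the divisor, so an argument is required
  only for those \<open>c\<close> with \<open>coeff2 a 0 0 = 0\<close>. An old component
  \<open>v = 0\<close> is met at \<open>c = 0\<close> only.\<close>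

lemma tracked_chart_U:
  assumes "transform_germ U (U * (const2 c + V)) U \<omega> \<omega>'" "D \<subseteq> {U, V}"
    and "pullback U (U * (const2 c + V)) \<omega> = (U ^ k * a, U ^ k * b)"
    and "set_u_0 a \<noteq> 0" "U dvd b" "V \<in> D \<Longrightarrow> c = 0 \<Longrightarrow> V dvd a"
    and "coeff2 a 0 0 = 0 \<Longrightarrow> reduced (a, b) \<or> (a, b) \<in> {N2, N3, N4, N5} \<and> (V \<notin> D \<or> c \<noteq> 0)"
  shows "tracked \<omega>' (insert U {f'. coeff2 f' 0 0 = 0 \<and>
    (\<exists>f\<in>D. strict_transform U (U * (const2 c + V)) U f f')})"
    (is "tracked _ (insert U ?D)")
proof -
  have "\<omega>' = (a, b)"
    using assms(4) by (intro transform_germ_unique[OF assms(3) _ assms(1)]) (simp_all add: U_dvd_iff)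
  moreover have D: "f' = V \<and> V \<in> D \<and> c = 0" if "f' \<in> ?D" for f'
    using that strict_transform_chart_U assms(2) by blast
  moreover have "\<forall>f'\<in>insert U ?D. invariant_germ (a, b) f'"
  proof
    fix f' assume "f' \<in> insert U ?D"
    then consider "f' = U" | "f' = V" "V \<in> D" "c = 0" using D by blast
    then show "invariant_germ (a, b) f'"
      using invariant_U[OF assms(5)] invariant_V[OF assms(6)] by cases blast+
  qed
  moreover have "?D = {}" if "V \<notin> D \<or> c \<noteq> 0"
    using D that by blast
  ultimately show ?thesis
    using assms(7) unfolding tracked_def by auto
qed

text \<open>The origin is the only point of the divisor that the other chart does not show, so a
  single germ has to be examined.\<close>

lemma tracked_chart_V:
  assumes "transform_germ (U * V) V V \<omega> \<omega>'" "D \<subseteq> {U, V}"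
    and "pullback (U * V) V \<omega> = (V ^ k * a, V ^ k * b)"
    and "set_v_0 b \<noteq> 0" "U dvd b" "V dvd a"
    and "reduced (a, b) \<or> (a, b) = N1 \<and> D = {}"
  shows "tracked \<omega>' (insert V {f'. coeff2 f' 0 0 = 0 \<and> (\<exists>f\<in>D. strict_transform (U * V) V V f f')})"
    (is "tracked _ (insert V ?D)")
proof -
  have "\<omega>' = (a, b)"
    using assms(4) by (intro transform_germ_unique[OF assms(3) _ assms(1)]) (simp_all add: V_dvd_iff)
  moreover have D: "f' = U" if "f' \<in> ?D" for f'
    using that strict_transform_chart_V assms(2) by blast
  moreover have "\<forall>f'\<in>insert V ?D. invariant_germ (a, b) f'"
  proof
    fix f' assume "f' \<in> insert V ?D"
    then consider "f' = V" | "f' = U" using D by blast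
    then show "invariant_germ (a, b) f'"
      using invariant_U[OF assms(5)] invariant_V[OF assms(6)] by cases blast+
  qed
  moreover have "?D = {}" if "D = {}"
    using that by blast
  ultimately show ?thesis
    using assms(7) unfolding tracked_def by auto
qed

lemma nonzero_facts:
  "fps_const c + fps_X \<noteq> (0 :: complex fps)" "1 - (fps_const c + fps_X) \<noteq> (0 :: complex fps)"
  "fps_X - 1 \<noteq> (0 :: complex fps)" "1 - fps_X \<noteq> (0 :: complex fps)"
proof -
  show "fps_const c + fps_X \<noteq> (0 :: complex fps)" for c
    by (rule const_plus_fps_X_nonzero)
  from this[of "c - 1"] show "1 - (fps_const c + fps_X) \<noteq> (0 :: complex fps)"
    by (simp add: algebra_simps flip: fps_const_sub)
  from const_plus_fps_X_nonzero[of "- 1"] show "fps_X - 1 \<noteq> (0 :: complex fps)"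
    by (simp flip: fps_const_neg)
  then show "1 - fps_X \<noteq> (0 :: complex fps)" by simp
qed

lemma deriv_1 [simp]: "deriv_u 1 = 0" "deriv_v 1 = 0"
  using deriv_u_simps(3)[of 1] deriv_v_simps(4)[of 1] by simp_all

text \<open>The general formula at \<open>c = 1\<close> has to be matched with \<open>N2\<close>.
  Repeating the substitution with \<open>W\<close> in place of \<open>c + V\<close> yields literally
  that germ, and cancelling \<open>U ^ 5\<close> from the two descriptions of the same pullback
  identifies them.\<close>

lemma N1_U_1: "pullback U (U * (const2 1 + V)) N1 = (U ^ 5 * fst N2, U ^ 5 * snd N2)"
proof -
  have y: "const2 1 + V = W" by (simp add: W_def)
  have "coeff2 U 0 0 = 0" "coeff2 (U * W) 0 0 = 0" by simp_all
  note s = subst2_simps[OF this]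
  have d: "deriv_u W = 0" "deriv_v W = 1" by (simp_all add: W_def)
  have 1: "subst2 S1 U (U * W) = U * S2"
    unfolding S1_def by (simp add: s ) (simp add: S2_def W_def algebra_simps eval_nat_numeral)
  have 2: "subst2 Q1 U (U * W) = U ^ 3 * Q2"
    unfolding Q1_def by (simp add: s 1) (simp add: Q2_def algebra_simps eval_nat_numeral)
  show ?thesis unfolding y
    unfolding N1_def N2_def pullback.simps prod.inject fst_conv snd_conv
    by (simp add: s 1 2 d) (simp add: W_def algebra_simps eval_nat_numeral)
qed

lemma N2_U_0: "pullback U (U * (const2 0 + V)) N2 = (U ^ 4 * fst N5, U ^ 4 * snd N5)"
proof -
  have y: "const2 0 + V = V" by simp
  have "coeff2 U 0 0 = 0" "coeff2 (U * V) 0 0 = 0" by simp_all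
  note s = subst2_simps[OF this]
  have d: "deriv_u V = 0" "deriv_v V = 1" by (simp_all)
  have 1: "subst2 W U (U * V) = W5"
    by (subst (1) W_def) (simp add: s W5_def)
  have 2: "subst2 S2 U (U * V) = U * S5"
    unfolding S2_def by (simp add: s 1) (simp add: S5_def algebra_simps eval_nat_numeral)
  have 3: "subst2 Q2 U (U * V) = U ^ 3 * Q5"
    unfolding Q2_def by (simp add: s 1 2) (simp add: Q5_def algebra_simps eval_nat_numeral)
  show ?thesis unfolding y
    unfolding N2_def N5_def pullback.simps prod.inject fst_conv snd_conv
    by (simp add: s 1 2 3 d) (simp add: W5_def algebra_simps eval_nat_numeral)
qed

lemma N2_U_1: "pullback U (U * (const2 1 + V)) N2 = (U ^ 4 * fst N3, U ^ 4 * snd N3)"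
proof -
  have y: "const2 1 + V = W" by (simp add: W_def)
  have "coeff2 U 0 0 = 0" "coeff2 (U * W) 0 0 = 0" by simp_all
  note s = subst2_simps[OF this]
  have d: "deriv_u W = 0" "deriv_v W = 1" by (simp_all add: W_def)
  have 1: "subst2 W U (U * W) = W3"
    by (subst (1) W_def) (simp add: s W3_def)
  have 2: "subst2 S2 U (U * W) = U * S2"
    unfolding S2_def by (simp add: s 1) (simp add: S2_def W3_def W_def algebra_simps eval_nat_numeral)
  have 3: "subst2 Q2 U (U * W) = U ^ 3 * Q3"
    unfolding Q2_def by (simp add: s 1 2) (simp add: Q3_def algebra_simps eval_nat_numeral)
  show ?thesis unfolding y
    unfolding N2_def N3_def pullback.simps prod.inject fst_conv snd_conv
    by (simp add: s 1 2 3 d) (simp add: W3_def W_def algebra_simps eval_nat_numeral)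
qed

lemma N3_U_1: "pullback U (U * (const2 1 + V)) N3 = (U ^ 3 * fst N4, U ^ 3 * snd N4)"
proof -
  have y: "const2 1 + V = W" by (simp add: W_def)
  have "coeff2 U 0 0 = 0" "coeff2 (U * W) 0 0 = 0" by simp_all
  note s = subst2_simps[OF this]
  have d: "deriv_u W = 0" "deriv_v W = 1" by (simp_all add: W_def)
  have 1: "subst2 W U (U * W) = W3"
    by (subst (1) W_def) (simp add: s W3_def)
  have 2: "subst2 W3 U (U * W) = W4"
    unfolding W3_def by (simp add: s 1) (simp add: W4_def algebra_simps eval_nat_numeral)
  have 3: "subst2 S2 U (U * W) = U * S2"
    unfolding S2_def by (simp add: s 1 2) (simp add: S2_def W3_def W_def algebra_simps eval_nat_numeral)
  have 4: "subst2 Q3 U (U * W) = U ^ 2 * Q4"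
    unfolding Q3_def by (simp add: s 1 2 3) (simp add: Q4_def algebra_simps eval_nat_numeral)
  show ?thesis unfolding y
    unfolding N3_def N4_def pullback.simps prod.inject fst_conv snd_conv
    by (simp add: s 1 2 3 4 d) (simp add: W4_def W3_def W_def algebra_simps eval_nat_numeral)
qed

section \<open>The blow-ups of the six nodes, chart by chart\<close>

lemma tracked_N0_U:
  assumes "transform_germ U (U * (const2 c + V)) U N0 \<omega>'" "D \<subseteq> {}"
  shows "tracked \<omega>' (insert U {f'. coeff2 f' 0 0 = 0 \<and>
    (\<exists>f\<in>D. strict_transform U (U * (const2 c + V)) U f f')})"
proof -
  define y where "y = const2 c + V"
  define t where "t = 1 + U * y - U * y ^ 2"
  define p where "p = U ^ 3 - 2 * U ^ 2 * t - U ^ 2 * y * t + t ^ 3"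
  define a where "a = - p"
  define b where "b = U ^ 2 * ((1 - 2 * y) * p - t ^ 3)"
  have pull: "pullback U (U * (const2 c + V)) N0 = (U ^ 4 * a, U ^ 4 * b)"
    unfolding a_def b_def p_def t_def y_def by (rule N0_U)
  define x where "x = fps_const c + fps_X"
  have x: "x \<noteq> 0" "1 - x \<noteq> 0"
    unfolding x_def by (rule nonzero_facts)+
  have y: "set_u_0 y = x" "coeff2 y 0 0 = c"
    by (simp_all add: y_def x_def)
  \<comment> \<open>A nonzero constant: the only tangent direction of \<open>N0\<close> is that of
    \<open>u = 0\<close>, which belongs to the other chart.\<close>
  have "set_u_0 a = - 1"
    by (simp add: a_def t_def p_def y) (simp add: algebra_simps eval_nat_numeral)?
  then have "set_u_0 a \<noteq> 0" using x by simp
  moreover have "coeff2 a 0 0 \<noteq> 0"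
    by (simp add: a_def t_def p_def y) (simp add: algebra_simps eval_nat_numeral)?
  moreover have "U dvd b" by (simp add: b_def)
  moreover have "D \<subseteq> {U, V}" "V \<notin> D" using assms(2) not_V_dvd_U by auto
  ultimately show ?thesis
    by (intro tracked_chart_U[OF assms(1) _ pull]) auto
qed

lemma tracked_N0_V:
  assumes "transform_germ (U * V) V V N0 \<omega>'" "D \<subseteq> {}"
  shows "tracked \<omega>' (insert V {f'. coeff2 f' 0 0 = 0 \<and>
    (\<exists>f\<in>D. strict_transform (U * V) V V f f')})"
proof (rule tracked_chart_V[OF assms(1) _ N0_V])
  have "set_v_0 (snd N1) = - (fps_X ^ 5)"
    by (simp add: N1_def Q1_def S1_def eval_nat_numeral)
  then show "set_v_0 (snd N1) \<noteq> 0" by simp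
qed (use assms(2) in \<open>auto simp: N1_def eval_nat_numeral\<close>)

lemma tracked_N1_U:
  assumes "transform_germ U (U * (const2 c + V)) U N1 \<omega>'" "D \<subseteq> {V}"
  shows "tracked \<omega>' (insert U {f'. coeff2 f' 0 0 = 0 \<and>
    (\<exists>f\<in>D. strict_transform U (U * (const2 c + V)) U f f')})"
proof -
  define y where "y = const2 c + V"
  define r where "r = 1 + U * y - y"
  define q where "q = U ^ 6 * y ^ 3 - 2 * U ^ 4 * r * y ^ 2 + r ^ 3 - U ^ 3 * r * y ^ 2"
  define a where "a = y * (q * (2 * y - 2 - U * y) + U * r ^ 3 * y)"
  define b where "b = - (U * q)"
  have pull: "pullback U (U * (const2 c + V)) N1 = (U ^ 5 * a, U ^ 5 * b)"
    unfolding a_def b_def q_def r_def y_def by (rule N1_U)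
  define x where "x = fps_const c + fps_X"
  have x: "x \<noteq> 0" "1 - x \<noteq> 0"
    unfolding x_def by (rule nonzero_facts)+
  have y: "set_u_0 y = x" "coeff2 y 0 0 = c"
    by (simp_all add: y_def x_def)
  \<comment> \<open>Here \<open>x\<close> is the coordinate on the divisor. The singular points are
    the corner \<open>x = 0\<close>, where the old component \<open>v = 0\<close> meets the new one,
    and the fourfold root \<open>x = 1\<close>, which gives \<open>N2\<close>.\<close>
  have "set_u_0 a = - 2 * x * (1 - x) ^ 4"
    by (simp add: a_def r_def q_def y) (simp add: algebra_simps eval_nat_numeral)?
  then have "set_u_0 a \<noteq> 0" using x by simp
  moreover have a0: "coeff2 a 0 0 = - 2 * c * (1 - c) ^ 4"
    by (simp add: a_def r_def q_def y) (simp add: algebra_simps eval_nat_numeral)?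
  moreover have "reduced (a, b)" if "c = 0"
  proof -
    have "hyperbolic (a, b)"
      by (rule hyperbolicI[where ?l1.0 = "- 1" and ?l2.0 = "- 2"])
        (use that in \<open>simp_all add: a_def b_def y_def r_def q_def\<close>)
    then show ?thesis by (simp add: reduced_def)
  qed
  moreover have "(a, b) = N2" if "c = 1"
    using pull N1_U_1[folded that] by (simp add: prod_eq_iff)
  moreover have "U dvd b" by (simp add: b_def)
  moreover have "V dvd a" if "c = 0" using that by (simp add: a_def y_def)
  moreover have "D \<subseteq> {U, V}" using assms(2) not_V_dvd_U by auto
  ultimately show ?thesis
    by (intro tracked_chart_U[OF assms(1) _ pull]) auto
qed

lemma tracked_N1_V:
  assumes "transform_germ (U * V) V V N1 \<omega>'" "D \<subseteq> {V}"
  shows "tracked \<omega>' (insert V {f'. coeff2 f' 0 0 = 0 \<and>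
    (\<exists>f\<in>D. strict_transform (U * V) V V f f')})"
proof -
  define r where "r = U + U * V - 1"
  define q where "q = U ^ 6 * V ^ 6 - 2 * r * U ^ 4 * V ^ 4 + r ^ 3 - U ^ 3 * V ^ 3 * r"
  define a where "a = V * (q * (2 - U - U * V) + U * V * r ^ 3)"
  define b where "b = U * (q * (2 - 2 * U - U * V) + U * V * r ^ 3)"
  have pull: "pullback (U * V) V N1 = (V ^ 5 * a, V ^ 5 * b)"
    unfolding a_def b_def q_def r_def by (rule N1_V)
  have "set_v_0 b = - 2 * fps_X * (fps_X - 1) ^ 4"
    by (simp add: b_def r_def q_def W_def) (simp add: algebra_simps eval_nat_numeral)?
  then have "set_v_0 b \<noteq> 0" using nonzero_facts(3,4) by simp
  moreover have "U dvd b" "V dvd a" by (simp_all add: a_def b_def)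
  moreover have "hyperbolic (a, b)"
    by (rule hyperbolicI[where ?l1.0 = "- 2" and ?l2.0 = "- 2"])
      (simp_all add: a_def b_def r_def q_def W_def)
  moreover have "D \<subseteq> {U, V}" using assms(2) by auto
  ultimately show ?thesis
    by (intro tracked_chart_V[OF assms(1) _ pull]) (auto simp: reduced_def)
qed

lemma tracked_N2_U:
  assumes "transform_germ U (U * (const2 c + V)) U N2 \<omega>'" "D \<subseteq> {U}"
  shows "tracked \<omega>' (insert U {f'. coeff2 f' 0 0 = 0 \<and>
    (\<exists>f\<in>D. strict_transform U (U * (const2 c + V)) U f f')})"
proof -
  define y where "y = const2 c + V"
  define w where "w = 1 + U * y"
  define r where "r = w - y"
  define q where "q = U ^ 3 * w ^ 3 - 2 * r * U ^ 2 * w ^ 2 + r ^ 3 - U * r * w ^ 2"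
  define a where "a = q * (w * (2 * y - w) - y) + r ^ 3 * w ^ 2"
  define b where "b = - (U * q)"
  have pull: "pullback U (U * (const2 c + V)) N2 = (U ^ 4 * a, U ^ 4 * b)"
    unfolding a_def b_def q_def r_def w_def y_def by (rule N2_U)
  define x where "x = fps_const c + fps_X"
  have x: "x \<noteq> 0" "1 - x \<noteq> 0"
    unfolding x_def by (rule nonzero_facts)+
  have y: "set_u_0 y = x" "coeff2 y 0 0 = c"
    by (simp_all add: y_def x_def)
  \<comment> \<open>The process branches here: the simple root \<open>x = 0\<close> leads to
    \<open>N5\<close>, the triple root \<open>x = 1\<close> to \<open>N3\<close>.\<close>
  have "set_u_0 a = x * (1 - x) ^ 3"
    by (simp add: a_def w_def r_def q_def y) (simp add: algebra_simps eval_nat_numeral)?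
  then have "set_u_0 a \<noteq> 0" using x by simp
  moreover have a0: "coeff2 a 0 0 = c * (1 - c) ^ 3"
    by (simp add: a_def w_def r_def q_def y) (simp add: algebra_simps eval_nat_numeral)?
  moreover have "(a, b) = N5" if "c = 0"
    using pull N2_U_0[folded that] by (simp add: prod_eq_iff)
  moreover have "(a, b) = N3" if "c = 1"
    using pull N2_U_1[folded that] by (simp add: prod_eq_iff)
  moreover have "U dvd b" by (simp add: b_def)
  moreover have "D \<subseteq> {U, V}" "V \<notin> D" using assms(2) not_V_dvd_U by auto
  ultimately show ?thesis
    by (intro tracked_chart_U[OF assms(1) _ pull]) auto
qed

lemma tracked_N2_V:
  assumes "transform_germ (U * V) V V N2 \<omega>'" "D \<subseteq> {U}"
  shows "tracked \<omega>' (insert V {f'. coeff2 f' 0 0 = 0 \<and>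
    (\<exists>f\<in>D. strict_transform (U * V) V V f f')})"
proof -
  define r where "r = U * W - 1"
  define q where "q = U ^ 6 * V ^ 3 * W ^ 3 - 2 * r * U ^ 4 * V ^ 2 * W ^ 2 + r ^ 3 - U ^ 3 * V * r * W ^ 2"
  define a where "a = V * (q * W * (2 - U * W) + U * r ^ 3 * W ^ 2)"
  define b where "b = U * (q * W * (2 - U * W) + U * r ^ 3 * W ^ 2 - q)"
  have pull: "pullback (U * V) V N2 = (V ^ 4 * a, V ^ 4 * b)"
    unfolding a_def b_def q_def r_def by (rule N2_V)
  have "set_v_0 b = fps_X * (fps_X - 1) ^ 3"
    by (simp add: b_def r_def q_def W_def) (simp add: algebra_simps eval_nat_numeral)?
  then have "set_v_0 b \<noteq> 0" using nonzero_facts(3,4) by simp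
  moreover have "U dvd b" "V dvd a" by (simp_all add: a_def b_def)
  moreover have "hyperbolic (a, b)"
    by (rule hyperbolicI[where ?l1.0 = "- 1" and ?l2.0 = "- 2"])
      (simp_all add: a_def b_def r_def q_def W_def)
  moreover have "D \<subseteq> {U, V}" using assms(2) by auto
  ultimately show ?thesis
    by (intro tracked_chart_V[OF assms(1) _ pull]) (auto simp: reduced_def)
qed

lemma tracked_N3_U:
  assumes "transform_germ U (U * (const2 c + V)) U N3 \<omega>'" "D \<subseteq> {U}"
  shows "tracked \<omega>' (insert U {f'. coeff2 f' 0 0 = 0 \<and>
    (\<exists>f\<in>D. strict_transform U (U * (const2 c + V)) U f f')})"
proof -
  define y where "y = const2 c + V"
  define z where "z = 1 + U * y"
  define w where "w = 1 + U * z"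
  define r where "r = z - y"
  define q where "q = U * w ^ 3 - 2 * U * r * w ^ 2 + U * r ^ 3 - r * w ^ 2"
  define m where "m = y + 2 * U * y * z - U * z ^ 2"
  define a where "a = q * m + r ^ 3 * w ^ 2 - y * q"
  define b where "b = - (U * q)"
  have pull: "pullback U (U * (const2 c + V)) N3 = (U ^ 3 * a, U ^ 3 * b)"
    unfolding a_def b_def m_def q_def r_def w_def z_def y_def by (rule N3_U)
  define x where "x = fps_const c + fps_X"
  have x: "x \<noteq> 0" "1 - x \<noteq> 0"
    unfolding x_def by (rule nonzero_facts)+
  have y: "set_u_0 y = x" "coeff2 y 0 0 = c"
    by (simp_all add: y_def x_def)
  have "set_u_0 a = (1 - x) ^ 3"
    by (simp add: a_def z_def w_def r_def q_def m_def y) (simp add: algebra_simps eval_nat_numeral)?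
  then have "set_u_0 a \<noteq> 0" using x by simp
  moreover have a0: "coeff2 a 0 0 = (1 - c) ^ 3"
    by (simp add: a_def z_def w_def r_def q_def m_def y) (simp add: algebra_simps eval_nat_numeral)?
  moreover have "(a, b) = N4" if "c = 1"
    using pull N3_U_1[folded that] by (simp add: prod_eq_iff)
  moreover have "U dvd b" by (simp add: b_def)
  moreover have "D \<subseteq> {U, V}" "V \<notin> D" using assms(2) not_V_dvd_U by auto
  ultimately show ?thesis
    by (intro tracked_chart_U[OF assms(1) _ pull]) auto
qed

lemma tracked_N3_V:
  assumes "transform_germ (U * V) V V N3 \<omega>'" "D \<subseteq> {U}"
  shows "tracked \<omega>' (insert V {f'. coeff2 f' 0 0 = 0 \<and>
    (\<exists>f\<in>D. strict_transform (U * V) V V f f')})"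
proof -
  define w where "w = 1 + U * V * W"
  define r where "r = U * W - 1"
  define q where "q = U ^ 3 * V * w ^ 3 - 2 * r * U ^ 2 * V * w ^ 2 + V * r ^ 3 - U * r * w ^ 2"
  define m where "m = 1 + 2 * U * V * W - U ^ 2 * V * W ^ 2"
  define a where "a = V * (q * m + r ^ 3 * w ^ 2)"
  define b where "b = U * (q * m + r ^ 3 * w ^ 2 - q)"
  have pull: "pullback (U * V) V N3 = (V ^ 3 * a, V ^ 3 * b)"
    unfolding a_def b_def m_def q_def r_def w_def by (rule N3_V)
  have "set_v_0 b = fps_X * (fps_X - 1) ^ 3"
    by (simp add: b_def w_def r_def q_def m_def W_def) (simp add: algebra_simps eval_nat_numeral)?
  then have "set_v_0 b \<noteq> 0" using nonzero_facts(3,4) by simp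
  moreover have "U dvd b" "V dvd a" by (simp_all add: a_def b_def)
  moreover have "hyperbolic (a, b)"
    by (rule hyperbolicI[where ?l1.0 = "- 1" and ?l2.0 = "- 1"])
      (simp_all add: a_def b_def w_def r_def q_def m_def W_def)
  moreover have "D \<subseteq> {U, V}" using assms(2) by auto
  ultimately show ?thesis
    by (intro tracked_chart_V[OF assms(1) _ pull]) (auto simp: reduced_def)
qed

lemma tracked_N4_U:
  assumes "transform_germ U (U * (const2 c + V)) U N4 \<omega>'" "D \<subseteq> {U}"
  shows "tracked \<omega>' (insert U {f'. coeff2 f' 0 0 = 0 \<and>
    (\<exists>f\<in>D. strict_transform U (U * (const2 c + V)) U f f')})"
proof -
  define y where "y = const2 c + V"
  define z where "z = 1 + U * y"
  define s where "s = 1 + U * z"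
  define w where "w = 1 + U * s"
  define r where "r = z - y"
  define q where "q = w ^ 3 - 2 * U * r * w ^ 2 + U ^ 3 * r ^ 3 - r * w ^ 2"
  define a where "a = q * (2 * z * s - s ^ 2) + U * r ^ 3 * w ^ 2 - y * q"
  define b where "b = - (U * q)"
  have pull: "pullback U (U * (const2 c + V)) N4 = (U ^ 2 * a, U ^ 2 * b)"
    unfolding a_def b_def q_def r_def w_def s_def z_def y_def by (rule N4_U)
  define x where "x = fps_const c + fps_X"
  have x: "x \<noteq> 0" "1 - x \<noteq> 0"
    unfolding x_def by (rule nonzero_facts)+
  have y: "set_u_0 y = x" "coeff2 y 0 0 = c"
    by (simp_all add: y_def x_def)
  have "set_u_0 a = x * (1 - x)"
    by (simp add: a_def z_def s_def w_def r_def q_def y) (simp add: algebra_simps eval_nat_numeral)?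
  then have "set_u_0 a \<noteq> 0" using x by simp
  moreover have a0: "coeff2 a 0 0 = c * (1 - c)"
    by (simp add: a_def z_def s_def w_def r_def q_def y) (simp add: algebra_simps eval_nat_numeral)?
  moreover have "reduced (a, b)" if "c = 0"
  proof -
    \<comment> \<open>On the divergent separatrix the quotient \<open>v / u\<close> of the
      coordinates at \<open>N4\<close> tends to 0, so its strict transform passes through this
      point. The kernel of the linear part is transverse to the divisor
      \<open>u = 0\<close>.\<close>
    have "saddle_node (a, b)"
      by (rule saddle_nodeI) (use that in \<open>simp_all add: a_def b_def y_def z_def s_def w_def r_def q_def\<close>)
    then show ?thesis by (simp add: reduced_def)
  qed
  moreover have "reduced (a, b)" if "c = 1"
  proof -
    have "hyperbolic (a, b)"
      by (rule hyperbolicI[where ?l1.0 = "- 1" and ?l2.0 = "- 1"])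
        (use that in \<open>simp_all add: a_def b_def y_def z_def s_def w_def r_def q_def\<close>)
    then show ?thesis by (simp add: reduced_def)
  qed
  moreover have "U dvd b" by (simp add: b_def)
  moreover have "D \<subseteq> {U, V}" "V \<notin> D" using assms(2) not_V_dvd_U by auto
  ultimately show ?thesis
    by (intro tracked_chart_U[OF assms(1) _ pull]) auto
qed

lemma tracked_N4_V:
  assumes "transform_germ (U * V) V V N4 \<omega>'" "D \<subseteq> {U}"
  shows "tracked \<omega>' (insert V {f'. coeff2 f' 0 0 = 0 \<and>
    (\<exists>f\<in>D. strict_transform (U * V) V V f f')})"
proof -
  define s where "s = 1 + U * V * W"
  define w where "w = 1 + U * V * s"
  define r where "r = U * W - 1"
  define q where "q = U * (w ^ 3 - 2 * V * r * w ^ 2 + V ^ 3 * r ^ 3) - r * w ^ 2"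
  define a where "a = V * (U * q * (2 * W * s - s ^ 2) + V * r ^ 3 * w ^ 2)"
  define b where "b = U * (U * q * (2 * W * s - s ^ 2) + V * r ^ 3 * w ^ 2 - q)"
  have pull: "pullback (U * V) V N4 = (V ^ 2 * a, V ^ 2 * b)"
    unfolding a_def b_def q_def r_def w_def s_def by (rule N4_V)
  have "set_v_0 b = fps_X * (fps_X - 1)"
    by (simp add: b_def s_def w_def r_def q_def W_def) (simp add: algebra_simps eval_nat_numeral)?
  then have "set_v_0 b \<noteq> 0" using nonzero_facts(3,4) by simp
  moreover have "U dvd b" "V dvd a" by (simp_all add: a_def b_def)
  moreover have "saddle_node (a, b)"
    by (rule saddle_nodeI) (simp_all add: a_def b_def s_def w_def r_def q_def W_def)
  moreover have "D \<subseteq> {U, V}" using assms(2) by auto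
  ultimately show ?thesis
    by (intro tracked_chart_V[OF assms(1) _ pull]) (auto simp: reduced_def)
qed

text \<open>The linear part of \<open>N5\<close> is a Jordan block with double eigenvalue
  \<open>- 1\<close>. The ratio 1 makes the point non-reduced; since the block is not
  diagonalizable, the new divisor is nevertheless invariant, and this chart contains no singular
  point.\<close>

lemma tracked_N5_U:
  assumes "transform_germ U (U * (const2 c + V)) U N5 \<omega>'" "D \<subseteq> {U}"
  shows "tracked \<omega>' (insert U {f'. coeff2 f' 0 0 = 0 \<and>
    (\<exists>f\<in>D. strict_transform U (U * (const2 c + V)) U f f')})"
proof -
  define y where "y = const2 c + V"
  define w where "w = 1 + U ^ 2 * y"
  define r where "r = w - U * y"
  define p where "p = U ^ 2 * w ^ 3 - 2 * r * U * w ^ 2 - r * w ^ 2"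
  define a where "a = r ^ 3 * y * (2 * w - 1) + p * (U * y * (2 * w - 1) - w ^ 2) - y * (r ^ 3 + U * p)"
  define b where "b = - (U * (r ^ 3 + U * p))"
  have pull: "pullback U (U * (const2 c + V)) N5 = (U ^ 1 * a, U ^ 1 * b)"
    unfolding a_def b_def p_def r_def w_def y_def by (rule N5_U)
  define x where "x = fps_const c + fps_X"
  have x: "x \<noteq> 0" "1 - x \<noteq> 0"
    unfolding x_def by (rule nonzero_facts)+
  have y: "set_u_0 y = x" "coeff2 y 0 0 = c"
    by (simp_all add: y_def x_def)
  have "set_u_0 a = 1"
    by (simp add: a_def w_def r_def p_def y) (simp add: algebra_simps eval_nat_numeral)?
  then have "set_u_0 a \<noteq> 0" using x by simp
  moreover have "coeff2 a 0 0 \<noteq> 0"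
    by (simp add: a_def w_def r_def p_def y) (simp add: algebra_simps eval_nat_numeral)?
  moreover have "U dvd b" by (simp add: b_def)
  moreover have "D \<subseteq> {U, V}" "V \<notin> D" using assms(2) not_V_dvd_U by auto
  ultimately show ?thesis
    by (intro tracked_chart_U[OF assms(1) _ pull]) auto
qed

lemma tracked_N5_V:
  assumes "transform_germ (U * V) V V N5 \<omega>'" "D \<subseteq> {U}"
  shows "tracked \<omega>' (insert V {f'. coeff2 f' 0 0 = 0 \<and>
    (\<exists>f\<in>D. strict_transform (U * V) V V f f')})"
proof -
  define w where "w = 1 + U * V ^ 2"
  define r where "r = w - V"
  define p where "p = U ^ 2 * V ^ 2 * w ^ 3 - 2 * r * U * V * w ^ 2 - r * w ^ 2"
  define m where "m = r ^ 3 * (2 * w - 1) + U * p * (V * (2 * w - 1) - w ^ 2)"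
  define a where "a = V * m"
  define b where "b = U * (m - r ^ 3 - U * V * p)"
  have pull: "pullback (U * V) V N5 = (V ^ 1 * a, V ^ 1 * b)"
    unfolding a_def b_def m_def p_def r_def w_def by (rule N5_V)
  \<comment> \<open>The Jordan block at \<open>N5\<close> makes its two tangent directions coincide,
    whence the double root and a saddle-node at the corner.\<close>
  have "set_v_0 b = fps_X * fps_X"
    by (simp add: b_def w_def r_def p_def m_def W_def) (simp add: algebra_simps eval_nat_numeral)?
  then have "set_v_0 b \<noteq> 0" using nonzero_facts(3,4) by simp
  moreover have "U dvd b" "V dvd a" by (simp_all add: a_def b_def)
  moreover have "saddle_node (a, b)"
    by (rule saddle_nodeI) (simp_all add: a_def b_def w_def r_def p_def m_def W_def)
  moreover have "D \<subseteq> {U, V}" using assms(2) by auto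
  ultimately show ?thesis
    by (intro tracked_chart_V[OF assms(1) _ pull]) (auto simp: reduced_def)
qed

lemma infinitely_near_N0: "infinitely_near N0 \<omega> D \<Longrightarrow> tracked \<omega> D"
proof (induction rule: infinitely_near.induct)
  case start
  show ?case by (simp add: tracked_def)
next
  case (blowup \<omega> D g h e \<omega>')
  then consider "\<omega> = N0" "D \<subseteq> {}" | "\<omega> = N1" "D \<subseteq> {V}" | "\<omega> = N2" "D \<subseteq> {U}" | "\<omega> = N3" "D \<subseteq> {U}"
    | "\<omega> = N4" "D \<subseteq> {U}" | "\<omega> = N5" "D \<subseteq> {U}"
    unfolding tracked_def by blast
  note cases = this
  from \<open>blowup_chart g h e\<close> show ?case
  proof cases
    case (1 c)
    note tr = \<open>transform_germ g h e \<omega> \<omega>'\<close>[unfolded 1]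
    show ?thesis
      unfolding 1 using cases tr
      by cases (simp_all only: tracked_N0_U tracked_N1_U tracked_N2_U tracked_N3_U tracked_N4_U
          tracked_N5_U)
  next
    case 2
    note tr = \<open>transform_germ g h e \<omega> \<omega>'\<close>[unfolded 2]
    show ?thesis
      unfolding 2 using cases tr
      by cases (simp_all only: tracked_N0_V tracked_N1_V tracked_N2_V tracked_N3_V tracked_N4_V
          tracked_N5_V)
  qed
qed

lemma not_dicritical_N0: "\<not> dicritical N0"
  using infinitely_near_N0 by (auto simp: dicritical_def tracked_def)

text \<open>The corner of the exceptional divisor over \<open>N4\<close> is a saddle-node whose weak separatrix is the
  component \<open>u = 0\<close>.\<close>

lemma infinitely_nearI:
  assumes "infinitely_near \<omega>0 \<omega> D" "singular \<omega>" "\<not> reduced \<omega>" "blowup_chart g h e"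
    and "pullback g h \<omega> = (e ^ k * fst \<omega>', e ^ k * snd \<omega>')" "\<not> (e dvd fst \<omega>' \<and> e dvd snd \<omega>')"
  shows "infinitely_near \<omega>0 \<omega>'
    (insert e {f'. coeff2 f' 0 0 = 0 \<and> (\<exists>f\<in>D. strict_transform g h e f f')})"
proof (rule infinitely_near.blowup[OF assms(1-4)])
  show "transform_germ g h e \<omega> \<omega>'"
    using assms(5,6) by (cases \<omega>') auto
qed

lemma not_reduced_nodes:
  "singular N0" "\<not> reduced N0" "singular N1" "\<not> reduced N1" "singular N2" "\<not> reduced N2"
  "singular N3" "\<not> reduced N3" "singular N4" "\<not> reduced N4"
  unfolding N0_def N1_def N2_def N3_def N4_def
  by (simp; fail | rule not_reduced_if_linear_part_0; simp add: aux_defs; fail | simp add: aux_defs)+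

lemma infinitely_near_N4: "\<exists>D. infinitely_near N0 N4 D \<and> U \<in> D"
proof -
  obtain D1 where "infinitely_near N0 N1 D1"
    using infinitely_nearI[OF infinitely_near.start not_reduced_nodes(1,2) blowup_chart.intros(2) N0_V]
    by (force simp: V_dvd_iff N1_def aux_defs)
  from infinitely_nearI[OF this not_reduced_nodes(3,4) blowup_chart.intros(1) N1_U_1]
  obtain D2 where "infinitely_near N0 N2 D2"
    by (force simp: U_dvd_iff N2_def aux_defs)
  have "set_u_0 (fst N3) = - (fps_X ^ 3 * (fps_const 1 + fps_X))"
    by (simp add: N3_def aux_defs) (simp add: algebra_simps eval_nat_numeral)?
  then have "set_u_0 (fst N3) \<noteq> 0"
    using const_plus_fps_X_nonzero[of 1] by simp
  from this infinitely_nearI[OF \<open>infinitely_near N0 N2 D2\<close> not_reduced_nodes(5,6)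
      blowup_chart.intros(1) N2_U_1]
  obtain D where "infinitely_near N0 N3 D"
    by (auto simp: U_dvd_iff)
  from infinitely_nearI[OF this not_reduced_nodes(7,8) blowup_chart.intros(1) N3_U_1]
  show ?thesis
    by (force simp: U_dvd_iff N4_def aux_defs)
qed

lemma ord2_U: "ord2 U = enat 1"
proof -
  have "{enat (i + j) | i j. coeff2 U i j \<noteq> 0} = {enat 1}"
    by (auto split: if_splits)
  then show ?thesis by (simp add: ord2_def)
qed

lemma not_second_type_N0: "\<not> second_type_germ N0"
proof -
  obtain D where D: "infinitely_near N0 N4 D" "U \<in> D"
    using infinitely_near_N4 by blast
  define s where "s = 1 + U * V * W"
  define w where "w = 1 + U * V * s"
  define r where "r = U * W - 1"
  define q where "q = U * (w ^ 3 - 2 * V * r * w ^ 2 + V ^ 3 * r ^ 3) - r * w ^ 2"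
  define a where "a = V * (U * q * (2 * W * s - s ^ 2) + V * r ^ 3 * w ^ 2)"
  define b where "b = U * (U * q * (2 * W * s - s ^ 2) + V * r ^ 3 * w ^ 2 - q)"
  have pull: "pullback (U * V) V N4 = (V ^ 2 * fst (a, b), V ^ 2 * snd (a, b))"
    unfolding fst_conv snd_conv a_def b_def q_def r_def w_def s_def by (rule N4_V)
  define D' where "D' = insert V {f'. coeff2 f' 0 0 = 0 \<and> (\<exists>f\<in>D. strict_transform (U * V) V V f f')}"
  have "set_v_0 b = fps_X * (fps_X - 1)"
    by (simp add: b_def q_def r_def w_def s_def W_def)
  then have "\<not> V dvd b"
    using nonzero_facts(3) by (simp add: V_dvd_iff)
  then have "infinitely_near N0 (a, b) D'"
    unfolding D'_def
    by (intro infinitely_nearI[OF D(1) not_reduced_nodes(9,10) blowup_chart.intros(2) pull]) simp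
  moreover have "U \<in> D'"
  proof -
    have "subst2 U (U * V) V = V ^ 1 * U" by (simp add: chart_V_subst2)
    then have "strict_transform (U * V) V V U U"
      unfolding strict_transform_def using not_V_dvd_U by blast
    then show ?thesis using D(2) by (auto simp: D'_def)
  qed
  \<comment> \<open>The linear part has the single nonzero entry \<open>- 1\<close>, coming from
    \<open>b\<close>; its kernel is the direction \<open>(0, 1)\<close> of the line
    \<open>u = 0\<close>.\<close>
  moreover have lin: "coeff2 a 0 0 = 0" "coeff2 a (Suc 0) 0 = 0" "coeff2 a 0 (Suc 0) = 0"
      "coeff2 b 0 0 = 0" "coeff2 b (Suc 0) 0 = - 1" "coeff2 b 0 (Suc 0) = 0"
    by (simp_all add: a_def b_def q_def r_def w_def s_def W_def)
  have "saddle_node (a, b)"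
    by (rule saddle_nodeI) (simp_all add: lin)
  moreover have "weak_separatrix (a, b) U"
  proof -
    have "separatrix (a, b) U"
      using prime_elem_imp_irreducible[OF prime_U] by (simp add: separatrix_def b_def)
    moreover have "eigenvector (linear_part (a, b)) (vec_of_list [0, 1]) 0"
      by (auto simp: eigenvector_def mat_of_rows_list_def lin vec_eq_iff scalar_prod_def
          less_2_cases_iff numeral_2_eq_2 less_Suc_eq)
    moreover have "tangent_to U 0 1"
      by (simp add: tangent_to_def ord2_U)
    ultimately show ?thesis
      unfolding weak_separatrix_def by (intro conjI exI[of _ "vec_of_list [0, 1]"]) simp_all
  qed
  ultimately show ?thesis
    unfolding second_type_germ_def not_all
    by (intro exI[of _ "(a, b)"] exI[of _ D'] exI[of _ U]) simp
qed

subsection \<open>Evaluation of polynomials in three variables\<close>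

lemma poly_map_poly_eq_sum:
  fixes h :: "'a::zero \<Rightarrow> 'b::comm_semiring_1"
  assumes "h 0 = 0"
  shows "poly (map_poly h p) x = (\<Sum>i\<le>degree p. h (coeff p i) * x ^ i)"
proof -
  have "poly (map_poly h p) x = (\<Sum>i\<le>degree (map_poly h p). h (coeff p i) * x ^ i)"
    using assms by (simp add: poly_altdef coeff_map_poly)
  also have "\<dots> = (\<Sum>i\<le>degree p. h (coeff p i) * x ^ i)"
  proof (rule sum.mono_neutral_left)
    show "\<forall>i\<in>{..degree p} - {..degree (map_poly h p)}. h (coeff p i) * x ^ i = 0"
    proof
      fix i assume "i \<in> {..degree p} - {..degree (map_poly h p)}"
      then have "coeff (map_poly h p) i = 0" by (simp add: coeff_eq_0)
      then show "h (coeff p i) * x ^ i = 0" using assms by (simp add: coeff_map_poly)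
    qed
  qed (use degree_map_poly_le[of h p] in auto)
  finally show ?thesis .
qed

lemma comm_ring_hom_poly_map_poly:
  assumes "comm_ring_hom h"
  shows "comm_ring_hom (\<lambda>p. poly (map_poly h p) x)"
proof -
  interpret h: comm_ring_hom h by fact
  interpret m: map_poly_comm_ring_hom h ..
  show ?thesis
    by unfold_locales (simp_all add: m.hom_add m.hom_mult)
qed

context
  fixes h :: "complex \<Rightarrow> 'r::comm_ring_1" and x y z :: 'r
  assumes h: "comm_ring_hom h"
begin

text \<open>Evaluation in three nested stages, in \<open>x\<close>, then \<open>y\<close>, then
  \<open>z\<close>. Each stage is a ring homomorphism, a property that the triple sum in
  \<open>eval3\<close> does not display.\<close>

definition "ev1 = (\<lambda>p. poly (map_poly h p) x)"
definition "ev2 = (\<lambda>p. poly (map_poly ev1 p) y)"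
definition "ev3 = (\<lambda>p. poly (map_poly ev2 p) z)"

lemma ev_hom: "comm_ring_hom ev1" "comm_ring_hom ev2" "comm_ring_hom ev3"
proof -
  show 1: "comm_ring_hom ev1"
    unfolding ev1_def by (rule comm_ring_hom_poly_map_poly[OF h])
  show 2: "comm_ring_hom ev2"
    unfolding ev2_def by (rule comm_ring_hom_poly_map_poly[OF 1])
  show "comm_ring_hom ev3"
    unfolding ev3_def by (rule comm_ring_hom_poly_map_poly[OF 2])
qed

lemma eval3_eq: "eval3 h F x y z = ev3 F"
proof -
  interpret h: comm_ring_hom h by (rule h)
  interpret e1: comm_ring_hom ev1 by (rule ev_hom)
  interpret e2: comm_ring_hom ev2 by (rule ev_hom)
  show ?thesis
    unfolding eval3_def coeff3_def ev3_def poly_map_poly_eq_sum[of ev2, OF e2.hom_zero]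
    unfolding ev2_def poly_map_poly_eq_sum[of ev1, OF e1.hom_zero]
    unfolding ev1_def poly_map_poly_eq_sum[of h, OF h.hom_zero]
    by (simp add: sum_distrib_right mult.assoc mult.left_commute)
qed

lemma eval3_simps:
  "eval3 h (F + G) x y z = eval3 h F x y z + eval3 h G x y z"
  "eval3 h (F - G) x y z = eval3 h F x y z - eval3 h G x y z"
  "eval3 h (- F) x y z = - eval3 h F x y z"
  "eval3 h (F * G) x y z = eval3 h F x y z * eval3 h G x y z"
  "eval3 h (F ^ n) x y z = eval3 h F x y z ^ n"
  "eval3 h (numeral k) x y z = numeral k"
  "eval3 h X x y z = x" "eval3 h Y x y z = y" "eval3 h Z x y z = z"
proof -
  interpret h: comm_ring_hom h by (rule h)
  interpret e1: comm_ring_hom ev1 by (rule ev_hom)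
  interpret e2: comm_ring_hom ev2 by (rule ev_hom)
  interpret e3: comm_ring_hom ev3 by (rule ev_hom)
  show "eval3 h (F + G) x y z = eval3 h F x y z + eval3 h G x y z"
    "eval3 h (F - G) x y z = eval3 h F x y z - eval3 h G x y z"
    "eval3 h (- F) x y z = - eval3 h F x y z"
    "eval3 h (F * G) x y z = eval3 h F x y z * eval3 h G x y z"
    "eval3 h (F ^ n) x y z = eval3 h F x y z ^ n"
    "eval3 h (numeral k) x y z = numeral k"
    by (simp_all add: eval3_eq e3.hom_add e3.hom_minus e3.hom_uminus e3.hom_mult e3.hom_power e3.hom_numeral)
  have 1: "ev1 [:0, 1:] = x"
    by (simp add: ev1_def poly_map_poly_eq_sum)
  have 2: "ev2 [:p:] = ev1 p" "ev2 [:0, 1:] = y" for p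
    by (simp_all add: ev2_def poly_map_poly_eq_sum)
  have 3: "ev3 [:p:] = ev2 p" "ev3 [:0, 1:] = z" for p
    by (simp_all add: ev3_def poly_map_poly_eq_sum)
  show "eval3 h X x y z = x" "eval3 h Y x y z = y" "eval3 h Z x y z = z"
    by (simp_all only: eval3_eq X_def Y_def Z_def 1 2 3)
qed

end

subsection \<open>Factored coefficients\<close>

text \<open>For \<open>x = 1\<close> these are \<open>t\<close> and the coefficient
  \<open>1 - 2 t - t y + t^3\<close> of \<open>dt\<close>; for \<open>z = 1\<close> they become
  \<open>T0\<close> and \<open>P0\<close>.\<close>

definition "T3 = X * Y + X * Z - Y ^ 2"
definition "P3 = X ^ 6 - 2 * T3 * X ^ 4 - T3 * Y * X ^ 3 + T3 ^ 3"

text \<open>With variables from a general commutative ring this is pure ring normalization; the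
  nested polynomials \<open>X\<close>, \<open>Y\<close>, \<open>Z\<close> are inserted
  afterwards.\<close>

lemma factored_coefficients:
  fixes x y z :: "'a::comm_ring_1"
  defines "t \<equiv> x * y + x * z - y ^ 2"
  defines "p \<equiv> x ^ 6 - 2 * t * x ^ 4 - t * y * x ^ 3 + t ^ 3"
  shows
    " - (x ^ 7 * y) - x ^ 7 * z + 4 * x ^ 6 * y ^ 2 + 4 * x ^ 6 * y * z + 2 * x ^ 6 * z ^ 2
     - 5 * x ^ 5 * y ^ 3 - 4 * x ^ 5 * y ^ 2 * z + x ^ 5 * y * z ^ 2 + x ^ 4 * y ^ 4
     - 4 * x ^ 4 * y ^ 3 * z - 3 * x ^ 4 * y ^ 2 * z ^ 2 - 3 * x ^ 4 * y * z ^ 3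
     - x ^ 4 * z ^ 4 + 4 * x ^ 3 * y ^ 5 + 9 * x ^ 3 * y ^ 4 * z
     + 12 * x ^ 3 * y ^ 3 * z ^ 2 + 5 * x ^ 3 * y ^ 2 * z ^ 3 - 6 * x ^ 2 * y ^ 6
     - 15 * x ^ 2 * y ^ 5 * z - 9 * x ^ 2 * y ^ 4 * z ^ 2 + 6 * x * y ^ 7
     + 7 * x * y ^ 6 * z - 2 * y ^ 8
     = p * (2 * y ^ 2 - x * y - x * z) + x * y * t ^ 3"
    " x ^ 8 - 4 * x ^ 7 * y - 2 * x ^ 7 * z + 5 * x ^ 6 * y ^ 2 + 3 * x ^ 6 * y * z
     - x ^ 5 * y ^ 3 + 2 * x ^ 5 * y ^ 2 * z - 4 * x ^ 4 * y ^ 4 - 6 * x ^ 4 * y ^ 3 * z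
     - 6 * x ^ 4 * y ^ 2 * z ^ 2 - 2 * x ^ 4 * y * z ^ 3 + 6 * x ^ 3 * y ^ 5
     + 12 * x ^ 3 * y ^ 4 * z + 6 * x ^ 3 * y ^ 3 * z ^ 2 - 6 * x ^ 2 * y ^ 6
     - 6 * x ^ 2 * y ^ 5 * z + 2 * x * y ^ 7
     = x * ((x - 2 * y) * p - x * t ^ 3)"
    " x ^ 8 - 2 * x ^ 7 * y - 2 * x ^ 7 * z + x ^ 6 * y ^ 2 - x ^ 6 * y * z
     + 2 * x ^ 5 * y ^ 3 + 3 * x ^ 5 * y ^ 2 * z + 3 * x ^ 5 * y * z ^ 2 + x ^ 5 * z ^ 3
     - 3 * x ^ 4 * y ^ 4 - 6 * x ^ 4 * y ^ 3 * z - 3 * x ^ 4 * y ^ 2 * z ^ 2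
     + 3 * x ^ 3 * y ^ 5 + 3 * x ^ 3 * y ^ 4 * z - x ^ 2 * y ^ 6
     = x ^ 2 * p"
  unfolding p_def t_def by (simp_all add: algebra_simps eval_nat_numeral)

lemma A_tilde_eq: "A_tilde = P3 * (2 * Y ^ 2 - X * Y - X * Z) + X * Y * T3 ^ 3"
  and B_tilde_eq: "B_tilde = X * ((X - 2 * Y) * P3 - X * T3 ^ 3)"
  and C_tilde_eq: "C_tilde = X ^ 2 * P3"
  unfolding A_tilde_def B_tilde_def C_tilde_def P3_def T3_def by (rule factored_coefficients)+

lemma comm_ring_hom_const2: "comm_ring_hom const2"
  by unfold_locales simp_all

lemma comm_ring_hom_id: "comm_ring_hom (id :: complex \<Rightarrow> complex)"
  by unfold_locales simp_all

lemma germ_at_origin: "germ_at \<omega>_tilde (0, 0, 1) = N0"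
proof -
  have "eval3 const2 A_tilde U V 1 = fst N0" "eval3 const2 B_tilde U V 1 = snd N0"
    by (simp_all only: A_tilde_eq B_tilde_eq P3_def T3_def N0_def P0_def T0_def fst_conv snd_conv
        eval3_simps[OF comm_ring_hom_const2] mult_1_right)
  moreover have "const2 (0 / 1) + U = U" "const2 (0 / 1) + V = V" by simp_all
  ultimately show ?thesis
    by (simp only: \<omega>_tilde_def germ_at.simps one_neq_zero if_True prod.collapse simp_thms)
qed

lemma zero_of_form_iff:
  "zero_of_form \<omega>_tilde (x, y, z) \<longleftrightarrow> x = 0 \<and> y = 0"
proof -
  define t where "t = x * y + x * z - y ^ 2"
  define p where "p = x ^ 6 - 2 * t * x ^ 4 - t * y * x ^ 3 + t ^ 3"
  have zero: "zero_of_form \<omega>_tilde (x, y, z) \<longleftrightarrow>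
      p * (2 * y ^ 2 - x * y - x * z) + x * y * t ^ 3 = 0 \<and>
      x * ((x - 2 * y) * p - x * t ^ 3) = 0 \<and> x ^ 2 * p = 0"
    by (simp only: \<omega>_tilde_def A_tilde_eq B_tilde_eq C_tilde_eq zero_of_form.simps
        eval3_simps[OF comm_ring_hom_id] P3_def T3_def p_def t_def)
  show ?thesis
  proof
    assume *: "zero_of_form \<omega>_tilde (x, y, z)"
    have "x = 0"
    proof (rule ccontr)
      assume "x \<noteq> 0"
      then have "p = 0" using * zero by simp
      moreover from this have "t = 0" using * zero \<open>x \<noteq> 0\<close> by simp
      ultimately have "p = 0" "t = 0" by simp_all
      then show False using \<open>x \<noteq> 0\<close> by (simp add: p_def)
    qed
    moreover from this have "t = - (y ^ 2)" "p = t ^ 3" by (simp_all add: p_def t_def)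
    moreover have "p * (2 * y ^ 2 - x * y - x * z) + x * y * t ^ 3 = 0" using * zero by blast
    ultimately show "x = 0 \<and> y = 0" by simp
  next
    assume "x = 0 \<and> y = 0"
    then show "zero_of_form \<omega>_tilde (x, y, z)"
      using zero by (simp add: p_def t_def)
  qed
qed

lemma proj_pt_z_axis:
  assumes "z \<noteq> 0"
  shows "proj_pt (0, 0, z) = proj_pt (0, 0, 1)"
proof -
  have "proj_pt (0, 0, w) = (\<lambda>c. (0, 0, c * w)) ` {c. c \<noteq> 0}" for w
    unfolding proj_pt.simps mult_zero_right by blast
  moreover have "(\<lambda>c. (0, 0, c * z)) ` {c. c \<noteq> 0} = (\<lambda>c. (0, 0, c * 1)) ` {c :: complex. c \<noteq> 0}"
  proof (intro subset_antisym image_subsetI)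
    fix c :: complex assume "c \<in> {c. c \<noteq> 0}"
    then show "(0, 0, c * 1) \<in> (\<lambda>c. (0, 0, c * z)) ` {c. c \<noteq> 0}"
      using assms by (intro image_eqI[of _ _ "c / z"]) simp_all
    show "(0, 0, c * z) \<in> (\<lambda>c. (0, 0, c * 1)) ` {c. c \<noteq> 0}"
      using assms \<open>c \<in> _\<close> by (intro image_eqI[of _ _ "c * z"]) simp_all
  qed
  ultimately show ?thesis by (simp only:)
qed

lemma singular_points_eq: "singular_points \<omega>_tilde = {proj_pt (0, 0, 1)}"
proof (intro subset_antisym subsetI)
  fix q assume "q \<in> singular_points \<omega>_tilde"
  then obtain p where p: "q = proj_pt p" "p \<noteq> (0, 0, 0)" "zero_of_form \<omega>_tilde p"
    unfolding singular_points_def by blast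
  obtain x y z where "p = (x, y, z)" by (cases p)
  with p have "p = (0, 0, z)" "z \<noteq> 0" by (simp_all add: zero_of_form_iff)
  then show "q \<in> {proj_pt (0, 0, 1)}" using p(1) proj_pt_z_axis by blast
next
  fix q assume "q \<in> {proj_pt (0, 0, 1)}"
  moreover have "zero_of_form \<omega>_tilde (0, 0, 1)" by (simp only: zero_of_form_iff)
  ultimately show "q \<in> singular_points \<omega>_tilde"
    unfolding singular_points_def by (intro CollectI exI[of _ "(0, 0, 1)"]) simp
qed

subsection \<open>Degree, and the absence of common factors\<close>

lemma coeff3_mult:
  "coeff3 (F * G) i j k =
    (\<Sum>r\<le>k. \<Sum>q\<le>j. \<Sum>p\<le>i. coeff3 F p q r * coeff3 G (i - p) (j - q) (k - r))"
  by (simp add: coeff3_def coeff_mult coeff_sum)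

lemma homogeneous_mult:
  assumes "homogeneous m F" "homogeneous n G"
  shows "homogeneous (m + n) (F * G)"
  unfolding homogeneous_def
proof (intro allI impI)
  fix i j k assume "coeff3 (F * G) i j k \<noteq> 0"
  then obtain p q r where le: "p \<le> i" "q \<le> j" "r \<le> k"
    and nz: "coeff3 F p q r * coeff3 G (i - p) (j - q) (k - r) \<noteq> 0"
    unfolding coeff3_mult by (meson sum.not_neutral_contains_not_neutral atMost_iff)
  from nz have "coeff3 F p q r \<noteq> 0" "coeff3 G (i - p) (j - q) (k - r) \<noteq> 0" by auto
  then have "p + q + r = m" "i - p + (j - q) + (k - r) = n"
    using assms unfolding homogeneous_def by blast+
  then show "i + j + k = m + n" using le by linarith
qed

lemma homogeneous_add: "homogeneous n F \<Longrightarrow> homogeneous n G \<Longrightarrow> homogeneous n (F + G)"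
  and homogeneous_diff: "homogeneous n F \<Longrightarrow> homogeneous n G \<Longrightarrow> homogeneous n (F - G)"
  and homogeneous_numeral: "homogeneous 0 (numeral c)"
  and homogeneous_1: "homogeneous 0 1"
  by (force simp: homogeneous_def coeff3_def, force simp: homogeneous_def coeff3_def,
      auto simp: homogeneous_def coeff3_def numeral_poly coeff_pCons split: nat.splits)

lemma homogeneous_vars: "homogeneous 1 X" "homogeneous 1 Y" "homogeneous 1 Z"
  by (auto simp: homogeneous_def coeff3_def X_def Y_def Z_def coeff_pCons split: nat.splits)

lemma homogeneous_power: "homogeneous n F \<Longrightarrow> homogeneous (k * n) (F ^ k)"
  by (induction k) (auto simp: homogeneous_1 intro: homogeneous_mult)

lemma homogeneous_8:
  "homogeneous 8 A_tilde" "homogeneous 8 B_tilde" "homogeneous 8 C_tilde"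
proof -
  note [intro!] = homogeneous_add homogeneous_diff
  have X: "homogeneous k (X ^ k)" and Y: "homogeneous k (Y ^ k)" for k
    using homogeneous_power[OF homogeneous_vars(1), of k] homogeneous_power[OF homogeneous_vars(2), of k]
    by simp_all
  note m = homogeneous_mult and n = homogeneous_numeral and v = homogeneous_vars
  have XY: "homogeneous 2 (X * Y)" "homogeneous 2 (X * Z)"
    using m[OF v(1,2)] m[OF v(1,3)] by (simp_all add: numeral_2_eq_2)
  then have T: "homogeneous 2 T3"
    unfolding T3_def using Y[of 2] by blast
  have "homogeneous 6 (2 * T3 * X ^ 4)" "homogeneous 6 (T3 * Y * X ^ 3)" "homogeneous 6 (T3 ^ 3)"
    using m[OF m[OF n T] X[of 4]] m[OF m[OF T v(2)] X[of 3]] homogeneous_power[OF T, of 3]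
    by simp_all
  then have P: "homogeneous 6 P3"
    unfolding P3_def using X[of 6] by blast
  have "homogeneous 2 (2 * Y ^ 2 - X * Y - X * Z)"
  proof -
    have "homogeneous (0 + 2) (2 * Y ^ 2)" by (rule m[OF n Y])
    then have "homogeneous 2 (2 * Y ^ 2)" by (simp only: add_0)
    then show ?thesis using XY by auto
  qed
  moreover have XYT: "homogeneous 8 (X * Y * T3 ^ 3)" "homogeneous 7 (X * T3 ^ 3)"
    using m[OF XY(1) homogeneous_power[OF T, of 3]] m[OF v(1) homogeneous_power[OF T, of 3]]
    by simp_all
  ultimately show "homogeneous 8 A_tilde"
    unfolding A_tilde_eq using m[OF P, of 2] by auto
  have "homogeneous 1 (X - 2 * Y)"
    using v m[OF n v(2)] by auto
  then have "homogeneous 7 ((X - 2 * Y) * P3)"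
    using m[OF _ P, of 1] by simp
  then have "homogeneous 7 ((X - 2 * Y) * P3 - X * T3 ^ 3)"
    using XYT by blast
  then show "homogeneous 8 B_tilde"
    unfolding B_tilde_eq using m[OF v(1), of 7] by simp
  show "homogeneous 8 C_tilde"
    unfolding C_tilde_eq using m[OF X[of 2] P] by simp
qed

lemma prime_X: "prime_elem X"
proof -
  have "[:0, 1:] dvd p \<longleftrightarrow> poly p 0 = 0" for p :: "complex poly"
    using poly_eq_0_iff_dvd[of p 0] by simp
  then have "prime_elem [:0, 1 :: complex:]"
    by (simp add: prime_elem_def)
  then show ?thesis by (simp add: X_def prime_elem_const_poly_iff)
qed

lemma dvd_prime_power_imp_unit:
  fixes p :: "'a::idom"
  assumes "prime_elem p" "d dvd p ^ n" "\<not> p dvd d"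
  shows "d dvd 1"
  using assms(2)
proof (induction n)
  case (Suc n)
  then obtain q where q: "p * p ^ n = d * q" by auto
  then have "p dvd d * q" by (metis dvd_triv_left)
  then obtain q' where "q = p * q'"
    using assms(1,3) by (auto simp: prime_elem_dvd_mult_iff)
  then have "p * p ^ n = p * (d * q')" using q by (simp add: mult_ac)
  then have "d dvd p ^ n" using assms(1) by simp
  then show ?case by (rule Suc.IH)
qed simp

lemma cube_identity:
  fixes x p t w :: "'a::comm_ring_1"
  shows "x ^ 3 * (p + t * w) ^ 3 =
    (x ^ 2 * p) * (x * (p ^ 2 + 3 * p * (t * w) + 3 * (t * w) ^ 2)) + (x ^ 3 * t ^ 3) * w ^ 3"
  by (simp add: algebra_simps eval_nat_numeral)

text \<open>A common divisor divides \<open>X ^ 2 * P3\<close> and \<open>X ^ 3 * T3 ^ 3\<close>,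
  which generate an ideal containing a power of the prime \<open>X\<close>. It cannot be divisible
  by \<open>X\<close> itself, since \<open>A_tilde\<close> restricts to \<open>- 2 Y ^ 8\<close> on
  \<open>x = 0\<close>.\<close>

lemma coprime_coefficients:
  assumes "D dvd A_tilde" "D dvd B_tilde" "D dvd C_tilde"
  shows "D dvd 1"
proof (rule dvd_prime_power_imp_unit[OF prime_X])
  define w where "w = 2 * X ^ 4 + Y * X ^ 3 - T3 ^ 2"
  have "D dvd X ^ 2 * P3" using assms(3) by (simp add: C_tilde_eq)
  moreover have "X ^ 3 * T3 ^ 3 = (X - 2 * Y) * (X ^ 2 * P3) - X * B_tilde"
    by (simp add: B_tilde_eq algebra_simps eval_nat_numeral)
  then have "D dvd X ^ 3 * T3 ^ 3"
    using assms(2) \<open>D dvd X ^ 2 * P3\<close> by (metis dvd_diff dvd_mult)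
  \<comment> \<open>Since \<open>X ^ 6 = P3 + T3 * w\<close>, every term of the cube contains
    \<open>P3\<close> or \<open>T3 ^ 3\<close>. The extra \<open>X ^ 3\<close> supplies the powers
    of \<open>X\<close> in the two generators, and \<open>3 + 3 * 6 = 21\<close>.\<close>
  moreover have "X ^ 21 = (X ^ 2 * P3) * (X * (P3 ^ 2 + 3 * P3 * (T3 * w) + 3 * (T3 * w) ^ 2)) +
      (X ^ 3 * T3 ^ 3) * w ^ 3"
  proof -
    have "X ^ 6 = P3 + T3 * w" by (simp add: P3_def w_def algebra_simps eval_nat_numeral)
    moreover have "X ^ 21 = X ^ 3 * (X ^ 6) ^ 3" by (simp flip: power_mult power_add)
    ultimately have "X ^ 21 = X ^ 3 * (P3 + T3 * w) ^ 3" by (simp only:)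
    also note cube_identity
    finally show ?thesis .
  qed
  ultimately show "D dvd X ^ 21" by (metis dvd_add dvd_mult2)
  show "\<not> X dvd D"
  proof
    assume "X dvd D"
    then have "X dvd A_tilde" using assms(1) by (rule dvd_trans)
    then obtain Q where "A_tilde = X * Q" ..
    moreover have "eval3 id (X * Q) 0 1 0 = 0"
      by (simp add: eval3_simps[OF comm_ring_hom_id])
    ultimately have "eval3 id A_tilde 0 1 0 = 0" by (simp only:)
    then show False
      by (simp add: A_tilde_eq P3_def T3_def eval3_simps[OF comm_ring_hom_id])
  qed
qed

lemma euler_identity:
  fixes x y z p t :: "'a::comm_ring_1"
  assumes "t = x * y + x * z - y ^ 2"
  shows "x * (p * (2 * y ^ 2 - x * y - x * z) + x * y * t ^ 3) +
    y * (x * ((x - 2 * y) * p - x * t ^ 3)) + z * (x ^ 2 * p) = 0"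
  by (simp add: algebra_simps eval_nat_numeral)

lemma foliation_\<omega>_tilde: "foliation 7 \<omega>_tilde"
proof -
  have "X * A_tilde + Y * B_tilde + Z * C_tilde = 0"
    unfolding A_tilde_eq B_tilde_eq C_tilde_eq by (rule euler_identity) (rule T3_def)
  then show ?thesis
    unfolding \<omega>_tilde_def foliation.simps using coprime_coefficients homogeneous_8 by simp
qed

lemma invariant_line: "invariant_curve \<omega>_tilde X"
proof -
  have "deriv_x X = 1" "deriv_y X = 0" "deriv_z X = 0"
    by (simp_all add: deriv_x_def deriv_y_def deriv_z_def X_def map_poly_pCons pderiv_pCons one_pCons)
  then show ?thesis
    by (simp add: \<omega>_tilde_def B_tilde_eq C_tilde_eq power2_eq_square)
qed

subsection \<open>Convergent power series\<close>

lemma sum_geometric_le: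
  fixes a :: real
  assumes "0 \<le> a" "a < 1"
  shows "(\<Sum>i\<le>n. a ^ i) \<le> 1 / (1 - a)"
proof -
  have "(\<Sum>i\<le>n. a ^ i) \<le> (\<Sum>i. a ^ i)"
    using assms by (intro sum_le_suminf summable_geometric) auto
  also have "\<dots> = 1 / (1 - a)" using assms by (intro suminf_geometric) auto
  finally show ?thesis .
qed

text \<open>A summable family at the point with both coordinates \<open>r / 2\<close> has bounded
  terms, which bounds the coefficients geometrically; conversely such a bound is dominated by a
  product of two geometric series. The closure properties of \<open>O2\<close> are proved on the
  coefficient side.\<close>

lemma O2_iff: "f \<in> O2 \<longleftrightarrow> (\<exists>M. \<exists>R>0. \<forall>i j. norm (coeff2 f i j) \<le> M * R ^ (i + j))"
proof
  assume "f \<in> O2"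
  then obtain r where r: "r > 0"
    and sum: "\<And>x y. norm x < r \<Longrightarrow> norm y < r \<Longrightarrow> (\<lambda>(i, j). coeff2 f i j * x ^ i * y ^ j) summable_on UNIV"
    by (auto simp: O2_def)
  define x where "x = complex_of_real (r / 2)"
  have x: "norm x = r / 2" using r by (simp add: x_def)
  have "(\<lambda>(i, j). coeff2 f i j * x ^ i * x ^ j) summable_on UNIV"
    using r x by (intro sum) auto
  then have abs: "(\<lambda>p. norm ((\<lambda>(i, j). coeff2 f i j * x ^ i * x ^ j) p)) summable_on UNIV"
    by (simp add: summable_on_iff_abs_summable_on_complex)
  define M where "M = infsum (\<lambda>p. norm ((\<lambda>(i, j). coeff2 f i j * x ^ i * x ^ j) p)) UNIV"
  have "norm (coeff2 f i j) \<le> M * (2 / r) ^ (i + j)" for i j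
  proof -
    have "norm (coeff2 f i j * x ^ i * x ^ j) \<le> M"
      using finite_sum_le_infsum[OF abs, of "{(i, j)}"] by (simp add: M_def)
    then have "norm (coeff2 f i j) * (r / 2) ^ (i + j) \<le> M"
      by (simp add: norm_mult norm_power x power_add mult.assoc)
    then have "norm (coeff2 f i j) * (r / 2) ^ (i + j) * (2 / r) ^ (i + j) \<le> M * (2 / r) ^ (i + j)"
      using r by (intro mult_right_mono) auto
    then show ?thesis using r by (simp add: mult.assoc flip: power_mult_distrib)
  qed
  then show "\<exists>M. \<exists>R>0. \<forall>i j. norm (coeff2 f i j) \<le> M * R ^ (i + j)"
    using r by (intro exI[of _ M] exI[of _ "2 / r"]) auto
next
  assume "\<exists>M. \<exists>R>0. \<forall>i j. norm (coeff2 f i j) \<le> M * R ^ (i + j)"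
  then obtain M R where R: "R > 0" and M: "\<And>i j. norm (coeff2 f i j) \<le> M * R ^ (i + j)"
    by blast
  have "M \<ge> 0" using M[of 0 0] by (simp add: order_trans[OF norm_ge_zero])
  have "(\<lambda>(i, j). coeff2 f i j * x ^ i * y ^ j) summable_on UNIV"
    if xy: "norm x < 1 / R" "norm y < 1 / R" for x y
  proof -
    define a where "a = R * norm x"
    define b where "b = R * norm y"
    have ab: "0 \<le> a" "a < 1" "0 \<le> b" "b < 1"
      using xy R by (simp_all add: a_def b_def field_simps)
    have bound: "norm (coeff2 f i j * x ^ i * y ^ j) \<le> M * (a ^ i * b ^ j)" for i j
    proof -
      have "norm (coeff2 f i j * x ^ i * y ^ j) = norm (coeff2 f i j) * (norm x ^ i * norm y ^ j)"
        by (simp add: norm_mult norm_power)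
      also have "\<dots> \<le> M * R ^ (i + j) * (norm x ^ i * norm y ^ j)"
        using M by (intro mult_right_mono) auto
      finally show ?thesis by (simp add: a_def b_def power_mult_distrib power_add mult_ac)
    qed
    have "(\<lambda>p. norm ((\<lambda>(i, j). coeff2 f i j * x ^ i * y ^ j) p)) summable_on UNIV"
    proof (rule nonneg_bdd_above_summable_on)
      show "bdd_above (sum (\<lambda>p. norm ((\<lambda>(i, j). coeff2 f i j * x ^ i * y ^ j) p)) ` {F. F \<subseteq> UNIV \<and> finite F})"
      proof (rule bdd_aboveI2)
        fix F :: "(nat \<times> nat) set" assume "F \<in> {F. F \<subseteq> UNIV \<and> finite F}"
        then have "finite F" by simp
        then have "finite (fst ` F \<union> snd ` F)" by simp
        then obtain n where n: "\<forall>m\<in>fst ` F \<union> snd ` F. m \<le> n"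
          unfolding finite_nat_set_iff_bounded_le by blast
        then have n: "F \<subseteq> {..n} \<times> {..n}" by force
        have "sum (\<lambda>p. norm ((\<lambda>(i, j). coeff2 f i j * x ^ i * y ^ j) p)) F \<le>
            sum (\<lambda>(i, j). M * (a ^ i * b ^ j)) F"
          using bound by (intro sum_mono) auto
        also have "\<dots> \<le> sum (\<lambda>(i, j). M * (a ^ i * b ^ j)) ({..n} \<times> {..n})"
          using n ab \<open>M \<ge> 0\<close> by (intro sum_mono2) auto
        also have "\<dots> = M * ((\<Sum>i\<le>n. a ^ i) * (\<Sum>j\<le>n. b ^ j))"
          by (subst sum_product) (simp add: sum_distrib_left sum.cartesian_product case_prod_unfold)
        also have "\<dots> \<le> M * (1 / (1 - a) * (1 / (1 - b)))"
          using \<open>M \<ge> 0\<close> ab by (intro mult_left_mono mult_mono sum_geometric_le sum_nonneg) auto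
        finally show "sum (\<lambda>p. norm ((\<lambda>(i, j). coeff2 f i j * x ^ i * y ^ j) p)) F \<le>
          M * (1 / (1 - a) * (1 / (1 - b)))" .
      qed
    qed simp
    then show ?thesis by (rule abs_summable_summable)
  qed
  then show "f \<in> O2"
    using R by (auto simp: O2_def intro!: exI[of _ "1 / R"])
qed

lemma O2_bound:
  assumes "f \<in> O2"
  shows "\<exists>M R. R > 0 \<and> M \<ge> 0 \<and> (\<forall>i j. norm (coeff2 f i j) \<le> M * R ^ (i + j))"
proof -
  from assms obtain M R where *: "R > 0" "\<forall>i j. norm (coeff2 f i j) \<le> M * R ^ (i + j)"
    unfolding O2_iff by blast
  have "norm (coeff2 f 0 0) \<le> M * R ^ (0 + 0)" using *(2) by blast
  then have "norm (coeff2 f 0 0) \<le> M" by simp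
  then have "M \<ge> 0" using norm_ge_zero[of "coeff2 f 0 0"] by linarith
  then show ?thesis using * by blast
qed

lemma O2_common_bound:
  assumes "f \<in> O2" "g \<in> O2"
  shows "\<exists>M R. R > 0 \<and> M \<ge> 0 \<and> (\<forall>i j. norm (coeff2 f i j) \<le> M * R ^ (i + j)) \<and>
    (\<forall>i j. norm (coeff2 g i j) \<le> M * R ^ (i + j))"
proof -
  obtain M R where *: "R > 0" "M \<ge> 0" "\<forall>i j. norm (coeff2 f i j) \<le> M * R ^ (i + j)"
    using O2_bound[OF assms(1)] by blast
  obtain M' R' where **: "R' > 0" "M' \<ge> 0" "\<forall>i j. norm (coeff2 g i j) \<le> M' * R' ^ (i + j)"
    using O2_bound[OF assms(2)] by blast
  have 1: "M * R ^ k \<le> max M M' * max R R' ^ k" for k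
    by (rule mult_mono[OF _ power_mono]) (use *(1,2) in simp_all)
  have 2: "M' * R' ^ k \<le> max M M' * max R R' ^ k" for k
    by (rule mult_mono[OF _ power_mono]) (use **(1,2) in simp_all)
  have pos: "max R R' > 0" "max M M' \<ge> 0" using *(1,2) by (simp_all add: max_def)
  have f: "norm (coeff2 f i j) \<le> max M M' * max R R' ^ (i + j)" for i j
    by (rule order_trans[OF *(3)[rule_format] 1])
  have g: "norm (coeff2 g i j) \<le> max M M' * max R R' ^ (i + j)" for i j
    by (rule order_trans[OF **(3)[rule_format] 2])
  show ?thesis
    by (rule exI[of _ "max M M'"], rule exI[of _ "max R R'"]) (intro conjI allI pos f g)
qed

lemma O2_add: "f \<in> O2 \<Longrightarrow> g \<in> O2 \<Longrightarrow> f + g \<in> O2"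
proof -
  assume "f \<in> O2" "g \<in> O2"
  from O2_common_bound[OF this] obtain M R where *: "R > 0" "M \<ge> 0" "\<forall>i j. norm (coeff2 f i j) \<le> M * R ^ (i + j)"
    "\<forall>i j. norm (coeff2 g i j) \<le> M * R ^ (i + j)"
    by blast
  have "norm (coeff2 (f + g) i j) \<le> (M + M) * R ^ (i + j)" for i j
    using *(3,4)[rule_format, of i j] by (auto simp: distrib_right intro: norm_triangle_le)
  then show ?thesis using *(1) by (auto simp: O2_iff)
qed

lemma O2_mult: "f \<in> O2 \<Longrightarrow> g \<in> O2 \<Longrightarrow> f * g \<in> O2"
proof -
  assume "f \<in> O2" "g \<in> O2"
  from O2_common_bound[OF this] obtain M R where *: "R > 0" "M \<ge> 0" "\<forall>i j. norm (coeff2 f i j) \<le> M * R ^ (i + j)"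
    "\<forall>i j. norm (coeff2 g i j) \<le> M * R ^ (i + j)"
    by blast
  \<comment> \<open>The convolution has \<open>(i + 1) (j + 1)\<close> terms, at most
    \<open>2 ^ (i + j)\<close>; this is the factor 2 in front of \<open>R\<close>.\<close>
  have "norm (coeff2 (f * g) i j) \<le> (M * M) * (2 * R) ^ (i + j)" for i j
  proof -
    have bound: "norm (coeff2 f p q * coeff2 g (i - p) (j - q)) \<le> M * M * R ^ (i + j)"
      if "p \<le> i" "q \<le> j" for p q
    proof -
      have "norm (coeff2 f p q * coeff2 g (i - p) (j - q)) \<le>
          (M * R ^ (p + q)) * (M * R ^ (i - p + (j - q)))"
        unfolding norm_mult by (rule mult_mono[OF *(3)[rule_format] *(4)[rule_format]]) (use *(1,2) in simp_all)
      also have "\<dots> = M * M * R ^ (p + q + (i - p + (j - q)))"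
        by (simp add: power_add)
      also have "p + q + (i - p + (j - q)) = i + j" using that by simp
      finally show ?thesis .
    qed
    have "norm (coeff2 (f * g) i j) \<le> (\<Sum>q\<le>j. \<Sum>p\<le>i. M * M * R ^ (i + j))"
      unfolding coeff2_mult by (intro sum_norm_le bound) auto
    also have "\<dots> = real (Suc i) * real (Suc j) * (M * M * R ^ (i + j))"
      by simp
    also have "\<dots> \<le> 2 ^ i * 2 ^ j * (M * M * R ^ (i + j))"
    proof -
      have "real (Suc n) \<le> 2 ^ n" for n
        by (induction n) auto
      note le = this
      have "real (Suc i) * real (Suc j) \<le> 2 ^ i * 2 ^ j"
        by (rule mult_mono[OF le le]) simp_all
      then show ?thesis
        by (rule mult_right_mono) (use *(1,2) in simp)
    qed
    finally show ?thesis by (simp add: power_add power_mult_distrib mult_ac)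
  qed
  then show ?thesis using *(1) unfolding O2_iff by (intro exI[of _ "M * M"] exI[of _ "2 * R"]) auto
qed

lemma polynomial2_O2: "polynomial2 f \<Longrightarrow> f \<in> O2"
proof (induction rule: polynomial2.induct)
  case (const2 c)
  show ?case unfolding O2_iff by (intro exI[of _ "norm c"] exI[of _ 1]) auto
next
  case U
  show ?case unfolding O2_iff by (intro exI[of _ 1] exI[of _ 1]) auto
next
  case V
  show ?case unfolding O2_iff by (intro exI[of _ 1] exI[of _ 1]) auto
qed (simp_all add: O2_add O2_mult)

lemma O2_const2 [simp]: "const2 c \<in> O2"
  by (rule polynomial2_O2) simp

lemma O2_0 [simp]: "0 \<in> O2" and O2_1 [simp]: "1 \<in> O2"
  using O2_const2[of 0] O2_const2[of 1] by simp_all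

lemma O2_minus: "f \<in> O2 \<Longrightarrow> - f \<in> O2"
  using O2_mult[of "- 1" f] polynomial2_O2[of "- 1"] by simp

lemma O2_diff: "f \<in> O2 \<Longrightarrow> g \<in> O2 \<Longrightarrow> f - g \<in> O2"
  using O2_add[OF _ O2_minus] by fastforce

lemma O2_power: "f \<in> O2 \<Longrightarrow> f ^ n \<in> O2"
  by (induction n) (simp_all add: O2_mult)

lemma O2_sum: "(\<And>k. k \<in> K \<Longrightarrow> f k \<in> O2) \<Longrightarrow> (\<Sum>k\<in>K. f k) \<in> O2"
  by (induction K rule: infinite_finite_induct) (simp_all add: O2_add)

text \<open>Division by \<open>u\<close> shifts one index, which costs only a factor
  \<open>R\<close>. Quotients found formally by primality of \<open>U\<close> therefore remain
  convergent.\<close>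

lemma O2_divide_U:
  assumes "U * f \<in> O2"
  shows "f \<in> O2"
proof -
  obtain M R where *: "R > 0" "\<And>i j. norm (coeff2 (U * f) i j) \<le> M * R ^ (i + j)"
    using assms by (auto simp: O2_iff)
  have "norm (coeff2 f i j) \<le> (M * R) * R ^ (i + j)" for i j
    using *(2)[of "Suc i" j] by (simp add: coeff2_U_mult mult_ac)
  then show ?thesis using *(1) by (auto simp: O2_iff)
qed

lemma O2_divide_U_power: "U ^ n * f \<in> O2 \<Longrightarrow> f \<in> O2"
  by (induction n) (auto simp: mult.assoc intro: O2_divide_U)

lemmas O2_intros = O2_add O2_mult O2_diff O2_minus O2_power

subsection \<open>Intersection numbers\<close>

lemma ideal_O2_subset:
  assumes "f \<in> ideal_O2 f' g'" "g \<in> ideal_O2 f' g'"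
  shows "ideal_O2 f g \<subseteq> ideal_O2 f' g'"
proof
  fix x assume "x \<in> ideal_O2 f g"
  then obtain p q where x: "x = f * p + g * q" and pq: "p \<in> O2" "q \<in> O2"
    by (auto simp: ideal_O2_def)
  from assms obtain a b c d where f: "f = f' * a + g' * b" and g: "g = f' * c + g' * d"
    and O2: "a \<in> O2" "b \<in> O2" "c \<in> O2" "d \<in> O2"
    by (auto simp: ideal_O2_def)
  have "x = f' * (a * p + c * q) + g' * (b * p + d * q)"
    by (simp add: x f g algebra_simps)
  moreover have "a * p + c * q \<in> O2" "b * p + d * q \<in> O2"
    using pq O2 by (auto intro!: O2_intros)
  ultimately show "x \<in> ideal_O2 f' g'"
    unfolding ideal_O2_def by blast
qed

lemma ideal_O2_I: "x = f * p + g * q \<Longrightarrow> p \<in> O2 \<Longrightarrow> q \<in> O2 \<Longrightarrow> x \<in> ideal_O2 f g"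
  by (auto simp: ideal_O2_def)

text \<open>Injectivity of multiplication by \<open>g\<close> on \<open>O2 / (f)\<close>, the
  condition for additivity of intersection numbers. The quotient \<open>r\<close> must lie in
  \<open>O2\<close>: divisibility is meant among convergent series.\<close>

definition nonzerodivisor_mod :: "series2 \<Rightarrow> series2 \<Rightarrow> bool" where
  "nonzerodivisor_mod f g \<longleftrightarrow>
     (\<forall>p\<in>O2. \<forall>q\<in>O2. g * p = f * q \<longrightarrow> (\<exists>r\<in>O2. p = f * r))"

lemma sum_lessThan_add:
  fixes F :: "nat \<Rightarrow> 'a::comm_monoid_add"
  shows "(\<Sum>k<m + n. F k) = (\<Sum>k<m. F k) + (\<Sum>k<n. F (m + k))"
  by (induction n) (simp_all add: add.assoc)

text \<open>The exact sequence \<open>0 -> O2/(f,h) -> O2/(f,gh) -> O2/(f,g) -> 0\<close>, whose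
  first map is multiplication by \<open>g\<close>: a basis in the middle consists of a basis of the
  last term and \<open>g\<close> times a basis of the first.\<close>

lemma quotient_has_dim_mult:
  assumes O2: "g \<in> O2" "h \<in> O2"
    and nz: "nonzerodivisor_mod f g"
    and dim_g: "quotient_has_dim O2 (ideal_O2 f g) m"
    and dim_h: "quotient_has_dim O2 (ideal_O2 f h) n"
  shows "quotient_has_dim O2 (ideal_O2 f (g * h)) (m + n)"
proof -
  obtain e1 where e1: "\<forall>k<m. e1 k \<in> O2"
    and span1: "\<forall>x\<in>O2. \<exists>c. x - (\<Sum>k<m. const2 (c k) * e1 k) \<in> ideal_O2 f g"
    and ind1: "\<forall>c. (\<Sum>k<m. const2 (c k) * e1 k) \<in> ideal_O2 f g \<longrightarrow> (\<forall>k<m. c k = 0)"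
    using dim_g unfolding quotient_has_dim_def by blast
  obtain e2 where e2: "\<forall>k<n. e2 k \<in> O2"
    and span2: "\<forall>x\<in>O2. \<exists>c. x - (\<Sum>k<n. const2 (c k) * e2 k) \<in> ideal_O2 f h"
    and ind2: "\<forall>c. (\<Sum>k<n. const2 (c k) * e2 k) \<in> ideal_O2 f h \<longrightarrow> (\<forall>k<n. c k = 0)"
    using dim_h unfolding quotient_has_dim_def by blast
  define e where "e k = (if k < m then e1 k else g * e2 (k - m))" for k
  have e_sum: "(\<Sum>k<m + n. const2 (c k) * e k) =
      (\<Sum>k<m. const2 (c k) * e1 k) + g * (\<Sum>k<n. const2 (c (m + k)) * e2 k)" for c
    by (simp add: sum_lessThan_add e_def sum_distrib_left mult.left_commute)
  show ?thesis
    unfolding quotient_has_dim_def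
  proof (intro exI[of _ e] conjI allI impI ballI)
    fix k assume "k < m + n"
    then show "e k \<in> O2" using e1 e2 O2 by (auto simp: e_def intro!: O2_mult)
  next
    fix x assume "x \<in> O2"
    with span1 obtain c p q where c: "x - (\<Sum>k<m. const2 (c k) * e1 k) = f * p + g * q"
      and pq: "p \<in> O2" "q \<in> O2"
      unfolding ideal_O2_def by blast
    with span2 obtain d p' q' where d: "q - (\<Sum>k<n. const2 (d k) * e2 k) = f * p' + h * q'"
      and pq': "p' \<in> O2" "q' \<in> O2"
      unfolding ideal_O2_def by blast
    define cd where "cd k = (if k < m then c k else d (k - m))" for k
    have "(\<Sum>k<m + n. const2 (cd k) * e k) =
        (\<Sum>k<m. const2 (c k) * e1 k) + g * (\<Sum>k<n. const2 (d k) * e2 k)"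
      by (simp add: e_sum cd_def)
    also have "\<dots> = (x - f * p - g * q) + g * (q - f * p' - h * q')"
      using c d by (simp add: algebra_simps)
    finally have "x - (\<Sum>k<m + n. const2 (cd k) * e k) = f * (p + g * p') + (g * h) * q'"
      by (simp add: algebra_simps)
    moreover have "p + g * p' \<in> O2" using pq pq' O2 by (auto intro!: O2_intros)
    ultimately have "x - (\<Sum>k<m + n. const2 (cd k) * e k) \<in> ideal_O2 f (g * h)"
      using pq' by (intro ideal_O2_I)
    then show "\<exists>c. x - (\<Sum>k<m + n. const2 (c k) * e k) \<in> ideal_O2 f (g * h)"
      by (rule exI[of _ cd])
  next
    fix c k assume "(\<Sum>k<m + n. const2 (c k) * e k) \<in> ideal_O2 f (g * h)" and k: "k < m + n"
    then obtain p q where pq: "p \<in> O2" "q \<in> O2" and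
      *: "(\<Sum>k<m. const2 (c k) * e1 k) + g * (\<Sum>k<n. const2 (c (m + k)) * e2 k) = f * p + g * h * q"
      unfolding ideal_O2_def e_sum by blast
    define s where "s = (\<Sum>k<n. const2 (c (m + k)) * e2 k)"
    have s: "s \<in> O2" using e2 by (auto simp: s_def intro!: O2_sum O2_mult)
    have "(\<Sum>k<m. const2 (c k) * e1 k) = f * p + g * (h * q - s)"
      using * by (simp add: s_def algebra_simps)
    moreover have hqs: "h * q - s \<in> O2" using pq O2 s by (auto intro!: O2_intros)
    ultimately have "(\<Sum>k<m. const2 (c k) * e1 k) \<in> ideal_O2 f g"
      using pq by (intro ideal_O2_I)
    then have c1: "\<forall>k<m. c k = 0" using ind1 by blast
    then have "g * (s - h * q) = f * p"
      using * by (simp add: s_def algebra_simps)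
    moreover have "s - h * q \<in> O2" using pq O2 s by (auto intro!: O2_intros)
    ultimately obtain r where "r \<in> O2" "s - h * q = f * r"
      using nz pq unfolding nonzerodivisor_mod_def by blast
    then have "s = f * r + h * q" by (simp add: algebra_simps)
    then have "s \<in> ideal_O2 f h"
      using pq \<open>r \<in> O2\<close> by (intro ideal_O2_I)
    then have "\<forall>k<n. c (m + k) = 0" using spec[OF ind2, of "\<lambda>k. c (m + k)"] by (simp add: s_def)
    then show "c k = 0"
      using c1 k by (metis add_diff_inverse_nat nat_add_left_cancel_less)
  qed
qed

lemma quotient_has_dim_power:
  assumes O2: "f \<in> O2" "g \<in> O2"
    and nz: "nonzerodivisor_mod f g"
    and dim: "quotient_has_dim O2 (ideal_O2 f g) m"
  shows "quotient_has_dim O2 (ideal_O2 f (g ^ n)) (n * m)"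
proof (induction n)
  case 0
  have "x \<in> ideal_O2 f 1" if "x \<in> O2" for x
    using that by (intro ideal_O2_I[of _ _ 0 _ x]) simp_all
  then show ?case by (simp add: quotient_has_dim_def)
next
  case (Suc n)
  then show ?case
    using quotient_has_dim_mult[OF O2(2) O2_power[OF O2(2)] nz dim, of n "n * m"] by simp
qed

lemma U_power_mult_eq:
  assumes "\<not> U dvd t" "t * x = U ^ n * y"
  obtains z where "x = U ^ n * z" "y = t * z"
  using assms(2)
proof (induction n arbitrary: x thesis)
  case 0
  then show ?case by simp
next
  case (Suc n)
  have "U dvd t * x" using Suc.prems(2) by (simp add: mult.assoc)
  then obtain x' where x': "x = U * x'"
    using assms(1) prime_U by (auto simp: prime_elem_dvd_mult_iff)
  then have "U * (t * x') = U * (U ^ n * y)"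
    using Suc.prems(2) by (simp add: mult_ac)
  then have "t * x' = U ^ n * y" by simp
  then obtain z where "x' = U ^ n * z" "y = t * z"
    using Suc.IH by blast
  then show ?case using Suc.prems(1) x' by (simp add: mult.assoc)
qed

lemma nonzerodivisor_mod_U:
  assumes "\<not> U dvd f"
  shows "nonzerodivisor_mod f U"
  unfolding nonzerodivisor_mod_def
proof (intro ballI impI)
  fix p q assume "p \<in> O2" "q \<in> O2" "U * p = f * q"
  then obtain z where "q = U ^ 1 * z" "p = f * z"
    using U_power_mult_eq[OF assms, of q 1 p] by (metis power_one_right)
  then show "\<exists>r\<in>O2. p = f * r"
    using \<open>q \<in> O2\<close> O2_divide_U by auto
qed

text \<open>The relation rewrites as \<open>t * (p - w * q) = U ^ n * q\<close>; as \<open>U\<close>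
  is prime and does not divide \<open>t\<close>, the series \<open>q\<close> is a multiple of
  \<open>t\<close>.\<close>

lemma nonzerodivisor_mod_U_power_add:
  assumes "\<not> U dvd t" "t \<in> O2" "w \<in> O2"
  shows "nonzerodivisor_mod (U ^ n + t * w) t"
  unfolding nonzerodivisor_mod_def
proof (intro ballI impI)
  fix p q assume pq: "p \<in> O2" "q \<in> O2" and eq: "t * p = (U ^ n + t * w) * q"
  then have "t * (p - w * q) = U ^ n * q" by (simp add: algebra_simps)
  then obtain z where z: "p - w * q = U ^ n * z" "q = t * z"
    using U_power_mult_eq[OF assms(1)] by blast
  have "p - w * q \<in> O2" using pq assms by (auto intro!: O2_intros)
  then have "z \<in> O2" using z(1) O2_divide_U_power by auto
  moreover have "p = (U ^ n + t * w) * z"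
    using z by (simp add: algebra_simps)
  ultimately show "\<exists>r\<in>O2. p = (U ^ n + t * w) * r" by blast
qed

lemma quotient_has_dim_V_power_U: "quotient_has_dim O2 (ideal_O2 (V ^ n) U) n"
  unfolding quotient_has_dim_def
proof (intro exI[of _ "\<lambda>k. V ^ k"] conjI allI impI ballI)
  fix k show "V ^ k \<in> O2" by (rule polynomial2_O2) simp
next
  fix f assume f: "f \<in> O2"
  \<comment> \<open>The part of order at least \<open>n\<close> of the restriction of
    \<open>f\<close> to \<open>u = 0\<close>, divided by \<open>v ^ n\<close> and regarded as a
    series in \<open>v\<close> alone. After subtracting the Taylor polynomial and
    \<open>V ^ n * h\<close>, what is left of \<open>f\<close> is divisible by
    \<open>U\<close>.\<close>
  define h :: series2 where "h = Abs_fps (\<lambda>j. fps_const (coeff2 f 0 (j + n)))"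
  have h_coeff: "coeff2 h i j = (if i = 0 then coeff2 f 0 (j + n) else 0)" for i j
    by (simp add: h_def coeff2_def)
  obtain M R where MR: "R > 0" "M \<ge> 0" "\<forall>i j. norm (coeff2 f i j) \<le> M * R ^ (i + j)"
    using O2_bound[OF f] by blast
  have "norm (coeff2 h i j) \<le> (M * R ^ n) * R ^ (i + j)" for i j
    using MR(3)[rule_format, of 0 "j + n"] MR(1,2) by (auto simp: h_coeff power_add mult_ac)
  then have h: "h \<in> O2" using MR(1) by (auto simp: O2_iff)
  define s where "s = (\<Sum>k<n. const2 (coeff2 f 0 k) * V ^ k)"
  have "fps_nth (set_u_0 f) j = fps_nth (set_u_0 s + fps_X ^ n * set_u_0 h) j" for j
  proof -
    have "fps_nth (set_u_0 s) j = (if j < n then coeff2 f 0 j else 0)"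
    proof -
      have "set_u_0 s = (\<Sum>k<n. fps_const (coeff2 f 0 k) * fps_X ^ k)"
        unfolding s_def by (induction n) simp_all
      then show ?thesis by (simp add: fps_sum_nth fps_X_power_iff mult_delta_right)
    qed
    then show ?thesis
      by (simp add: fps_X_power_mult_nth) (simp add: set_u_0_def h_coeff)
  qed
  then have "set_u_0 (f - s - V ^ n * h) = 0"
    by (simp add: fps_eq_iff)
  then obtain g where g: "f - s - V ^ n * h = U * g"
    using U_dvd_iff by blast
  have Vk: "V ^ k \<in> O2" for k by (rule polynomial2_O2) simp
  then have "s \<in> O2" "V ^ n \<in> O2"
    unfolding s_def by (intro O2_sum O2_mult O2_const2 Vk)+
  then have "U * g \<in> O2" unfolding g[symmetric] using f h by (intro O2_diff O2_mult)
  then have "g \<in> O2" by (rule O2_divide_U)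
  moreover have "f - s = V ^ n * h + U * g" using g by (simp add: algebra_simps)
  ultimately have "f - s \<in> ideal_O2 (V ^ n) U" using h by (intro ideal_O2_I)
  then show "\<exists>c. f - (\<Sum>k<n. const2 (c k) * V ^ k) \<in> ideal_O2 (V ^ n) U"
    unfolding s_def by (rule exI[of _ "\<lambda>k. coeff2 f 0 k"])
next
  fix c k assume "(\<Sum>k<n. const2 (c k) * V ^ k) \<in> ideal_O2 (V ^ n) U" and k: "k < n"
  then obtain p q where "(\<Sum>k<n. const2 (c k) * V ^ k) = V ^ n * p + U * q"
    by (auto simp: ideal_O2_def)
  then have "set_u_0 (\<Sum>k<n. const2 (c k) * V ^ k) = fps_X ^ n * set_u_0 p" by simp
  moreover have "set_u_0 (\<Sum>k<n. const2 (c k) * V ^ k) = (\<Sum>k<n. fps_const (c k) * fps_X ^ k)"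
    by (induction n) simp_all
  ultimately have "fps_nth (\<Sum>k<n. fps_const (c k) * fps_X ^ k) k = fps_nth (fps_X ^ n * set_u_0 p) k"
    by simp
  also have "fps_nth (fps_X ^ n * set_u_0 p) k = 0"
    using k by (simp add: fps_X_power_mult_nth)
  finally show "c k = 0"
    using k by (simp add: fps_sum_nth fps_X_power_iff mult_delta_right)
qed

lemma quotient_has_dim_U:
  assumes "f = const2 c * V ^ n + U * r" "c \<noteq> 0" "r \<in> O2"
  shows "quotient_has_dim O2 (ideal_O2 f U) n"
proof -
  have "ideal_O2 f U = ideal_O2 (V ^ n) U"
  proof (intro subset_antisym ideal_O2_subset)
    show "f \<in> ideal_O2 (V ^ n) U"
      using assms by (intro ideal_O2_I[of _ _ "const2 c" _ r]) (simp_all add: mult.commute)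
    have "const2 (1 / c) * const2 c = 1"
      using assms(2) by (simp flip: const2_hom(7))
    then have "V ^ n = f * const2 (1 / c) + U * (- const2 (1 / c) * r)"
      unfolding assms(1) by (simp add: algebra_simps)
    then show "V ^ n \<in> ideal_O2 f U"
      by (rule ideal_O2_I) (use assms(3) in \<open>auto intro!: O2_intros\<close>)
    show "U \<in> ideal_O2 (V ^ n) U" "U \<in> ideal_O2 f U"
      by (rule ideal_O2_I[of _ _ 0 _ 1]; simp)+
  qed
  then show ?thesis using quotient_has_dim_V_power_U by simp
qed

subsection \<open>The Milnor number\<close>

lemma polynomial2_0 [simp]: "polynomial2 0"
  using polynomial2.const2[of 0] by simp

lemma ideal_O2_eqI:
  assumes "f = f' * a + g' * b" "g = f' * c + g' * d" "f' = f * a' + g * b'" "g' = f * c' + g * d'"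
    and "polynomial2 a" "polynomial2 b" "polynomial2 c" "polynomial2 d"
    and "polynomial2 a'" "polynomial2 b'" "polynomial2 c'" "polynomial2 d'"
  shows "ideal_O2 f g = ideal_O2 f' g'"
  using assms by (intro subset_antisym ideal_O2_subset)
    (rule ideal_O2_I[OF _ polynomial2_O2 polynomial2_O2]; assumption)+

text \<open>The germ is \<open>(a, U * b)\<close>, and \<open>a + V * b = - U * P0\<close>,
  \<open>(U - 2 * V) * P0 - b = U * T0 ^ 3\<close> and \<open>P0 = U ^ 6 + T0 * w\<close>. This is a
  Euclidean algorithm in which factors \<open>U\<close> are split off until only intersections with
  \<open>u = 0\<close> remain; these are read from the restrictions to that line, of orders 8, 7, 6
  and 2.\<close>

lemma milnor_number_N0: "has_milnor_number N0 57"
proof -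
  define b where "b = (U - 2 * V) * P0 - U * T0 ^ 3"
  define a where "a = P0 * (2 * V ^ 2 - U * V - U) + U * V * T0 ^ 3"
  define w where "w = T0 ^ 2 - 2 * U ^ 4 - V * U ^ 3"
  have pol: "polynomial2 a" "polynomial2 b" "polynomial2 w" by (simp_all add: a_def b_def w_def)
  note O2 = pol[THEN polynomial2_O2] polynomial2_aux(1,2)[THEN polynomial2_O2]
    polynomial2.U[THEN polynomial2_O2]
  have T0_eq: "T0 = const2 (- 1) * V ^ 2 + U * (V + 1)"
    by (simp add: T0_def algebra_simps)
  define p where "p = U ^ 5 - 2 * T0 * U ^ 3 - T0 * V * U ^ 2 + (U ^ 2 * (V + 1) ^ 3 - 3 * U * V ^ 2 * (V + 1) ^ 2
    + 3 * V ^ 4 * (V + 1))"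
  have P0_eq: "P0 = const2 (- 1) * V ^ 6 + U * p"
    by (simp add: P0_def p_def T0_def algebra_simps eval_nat_numeral)
  have b_eq: "b = const2 2 * V ^ 7 + U * (P0 - 2 * V * p - T0 ^ 3)"
    unfolding b_def by (subst P0_eq) (simp add: P0_eq algebra_simps eval_nat_numeral)
  have a_eq: "a = const2 (- 2) * V ^ 8 + U * (p * 2 * V ^ 2 - P0 * V - P0 + V * T0 ^ 3)"
    unfolding a_def by (simp add: P0_eq algebra_simps eval_nat_numeral)
  have p: "polynomial2 p" by (simp add: p_def)
  have dim_U: "quotient_has_dim O2 (ideal_O2 T0 U) 2" "quotient_has_dim O2 (ideal_O2 P0 U) 6"
    "quotient_has_dim O2 (ideal_O2 b U) 7" "quotient_has_dim O2 (ideal_O2 a U) 8"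
    by (rule quotient_has_dim_U[OF T0_eq], simp_all add: polynomial2_O2,
        rule quotient_has_dim_U[OF P0_eq], simp_all add: polynomial2_O2 p,
        rule quotient_has_dim_U[OF b_eq], simp_all add: polynomial2_O2 p,
        rule quotient_has_dim_U[OF a_eq], simp_all add: polynomial2_O2 p)
  have ndvd: "\<not> U dvd T0" "\<not> U dvd P0" "\<not> U dvd b" "\<not> U dvd a"
    by (simp_all add: U_dvd_iff T0_def P0_def a_def b_def)
  note nz = ndvd[THEN nonzerodivisor_mod_U]
  have P0_w: "P0 = U ^ 6 + T0 * w"
    by (simp add: P0_def w_def algebra_simps eval_nat_numeral)
  \<comment> \<open>The innermost intersection is computed with \<open>U ^ 6\<close> in place of
    \<open>P0\<close>, as the two differ by a multiple of \<open>T0\<close>.\<close>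
  have "quotient_has_dim O2 (ideal_O2 T0 (U ^ 6)) (6 * 2)"
    by (rule quotient_has_dim_power[OF O2(4,6) nz(1) dim_U(1)])
  also have "ideal_O2 T0 (U ^ 6) = ideal_O2 P0 T0"
    by (rule ideal_O2_eqI[where a = "0" and b = "1" and c = "1" and d = "- w" and a' = "w" and b' = "1" and c' = "1" and d' = "0"]) (simp_all add: P0_w pol)
  finally have "quotient_has_dim O2 (ideal_O2 P0 T0) (6 * 2)" .
  moreover have "nonzerodivisor_mod P0 T0"
    unfolding P0_w by (rule nonzerodivisor_mod_U_power_add[OF ndvd(1) O2(4,3)])
  ultimately have "quotient_has_dim O2 (ideal_O2 P0 (T0 ^ 3)) (3 * (6 * 2))"
    by (intro quotient_has_dim_power O2)
  then have "quotient_has_dim O2 (ideal_O2 P0 (U * T0 ^ 3)) (6 + 3 * (6 * 2))"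
    by (intro quotient_has_dim_mult O2 O2_power nz dim_U)
  also have "ideal_O2 P0 (U * T0 ^ 3) = ideal_O2 b P0"
    by (rule ideal_O2_eqI[where a = "0" and b = "1" and c = "- 1" and d = "U - 2 * V" and a' = "U - 2 * V" and b' = "- 1" and c' = "1" and d' = "0"])
      (simp_all add: b_def algebra_simps)
  finally have "quotient_has_dim O2 (ideal_O2 b (U * P0)) (7 + (6 + 3 * (6 * 2)))"
    by (intro quotient_has_dim_mult O2 nz dim_U)
  also have "ideal_O2 b (U * P0) = ideal_O2 a b"
    by (rule ideal_O2_eqI[where a = "0" and b = "1" and c = "- 1" and d = "- V" and a' = "- V" and b' = "- 1" and c' = "1" and d' = "0"])
      (simp_all add: a_def b_def algebra_simps eval_nat_numeral)
  finally have "quotient_has_dim O2 (ideal_O2 a (U * b)) (8 + (7 + (6 + 3 * (6 * 2))))"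
    by (intro quotient_has_dim_mult O2 nz dim_U)
  then show ?thesis by (simp add: N0_def a_def b_def)
qed

section \<open>The multiplicity of the germ\<close>

lemma vanishes_add: "vanishes n f \<Longrightarrow> vanishes n g \<Longrightarrow> vanishes n (f + g)"
  and vanishes_diff: "vanishes n f \<Longrightarrow> vanishes n g \<Longrightarrow> vanishes n (f - g)"
  by (simp_all add: vanishes_def)

lemma vanishes_mono: "vanishes n f \<Longrightarrow> m \<le> n \<Longrightarrow> vanishes m f"
  by (simp add: vanishes_def)

lemma vanishes_mult': "vanishes m f \<Longrightarrow> vanishes n g \<Longrightarrow> k \<le> m + n \<Longrightarrow> vanishes k (f * g)"
  using vanishes_mult vanishes_mono by blast

lemma enat_le_ord2_iff: "enat n \<le> ord2 f \<longleftrightarrow> vanishes n f"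
proof -
  have "enat n \<le> ord2 f \<longleftrightarrow> (\<forall>i j. coeff2 f i j \<noteq> 0 \<longrightarrow> enat n \<le> enat (i + j))"
    unfolding ord2_def le_Inf_iff by blast
  also have "\<dots> \<longleftrightarrow> vanishes n f"
    unfolding vanishes_def enat_ord_simps by (meson not_le)
  finally show ?thesis .
qed

lemma multiplicity_of_N0: "multiplicity_of N0 = 4"
proof -
  have v: "vanishes 0 f" "vanishes 1 U" "vanishes 1 V" for f
    by (simp_all add: vanishes_def)
  have T: "vanishes 1 T0"
    by (simp add: vanishes_def T0_def)
  have T3: "vanishes 3 (T0 ^ 3)" by (rule vanishes_power) (simp add: T0_def)
  have Un: "vanishes n (U ^ n)" for n by (rule vanishes_power) simp
  have P: "vanishes 3 P0"
    unfolding P0_def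
    by (intro vanishes_add vanishes_diff T3 vanishes_mult'[OF _ Un, of 0] v vanishes_mono[OF Un]) simp_all
  have 1: "vanishes 1 (2 * V ^ 2 - U * V - U)" "vanishes 1 (U - 2 * V)"
    by (simp_all add: vanishes_def)
  have "vanishes 4 (fst N0)"
    unfolding N0_def fst_conv
    by (intro vanishes_add vanishes_mult'[OF P 1(1)] vanishes_mult'[OF vanishes_mult[OF v(2,3)] T3]) simp_all
  moreover have "vanishes 4 (snd N0)"
    unfolding N0_def snd_conv
    by (intro vanishes_mult'[OF v(2), of 3] vanishes_diff vanishes_mult'[OF _ P, of 0]
        vanishes_mult'[OF v(2) T3] v) simp_all
  \<comment> \<open>On \<open>v = 0\<close> the coefficient of \<open>du\<close> starts with
    \<open>- u ^ 4\<close>, so its order does not exceed 4.\<close>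
  moreover have "\<not> vanishes 5 (fst N0)"
  proof
    assume "vanishes 5 (fst N0)"
    then have "fps_nth (set_v_0 (fst N0)) 4 = 0"
      by (simp add: vanishes_def set_v_0_def coeff2_def)
    moreover have "set_v_0 (fst N0) = - (fps_X ^ 4 * (1 - 2 * fps_X ^ 2 + fps_X ^ 3))"
    proof -
      have "(x ^ 6 - 2 * (x * 0 + x - 0 ^ 2) * x ^ 4 - (x * 0 + x - 0 ^ 2) * 0 * x ^ 3 + (x * 0 + x - 0 ^ 2) ^ 3) *
          (2 * 0 ^ 2 - x * 0 - x) + x * 0 * (x * 0 + x - 0 ^ 2) ^ 3 = - (x ^ 4 * (1 - 2 * x ^ 2 + x ^ 3))"
        for x :: "complex fps"
        by (simp add: algebra_simps eval_nat_numeral)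
      then show ?thesis
        by (simp only: N0_def P0_def T0_def fst_conv set_v_0_hom set_v_0_power)
    qed
    ultimately show False
      by (simp add: fps_X_power_mult_nth)
  qed
  ultimately have *: "enat 4 \<le> ord2 (fst N0)" "enat 4 \<le> ord2 (snd N0)" "\<not> enat 5 \<le> ord2 (fst N0)"
    by (simp_all only: enat_le_ord2_iff simp_thms)
  then have "ord2 (fst N0) = enat 4"
    by (cases "ord2 (fst N0)") auto
  then have "min (ord2 (fst N0)) (ord2 (snd N0)) = enat 4"
    using * by (simp add: min_def)
  then show ?thesis
    by (metis multiplicity_of.simps prod.collapse numeral_eq_enat)
qed

subsection \<open>A convergent implicit function theorem\<close>

text \<open>The truncated weighted norm is submultiplicative: restricting the product of two partial
  sums to total degree at most \<open>N\<close> only drops nonnegative terms.\<close>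

lemma sum_norm_fps_power_le:
  fixes f :: "complex fps" and r :: real
  assumes "r \<ge> 0"
  shows "(\<Sum>n\<le>N. norm (fps_nth (f ^ i) n) * r ^ n) \<le> (\<Sum>n\<le>N. norm (fps_nth f n) * r ^ n) ^ i"
proof (induction i)
  case 0
  have "(\<Sum>n\<le>N. norm (fps_nth (1 :: complex fps) n) * r ^ n) = (\<Sum>n\<in>{0}. norm (fps_nth (1 :: complex fps) n) * r ^ n)"
    by (rule sum.mono_neutral_right) auto
  then show ?case by simp
next
  case (Suc i)
  define a where "a n = norm (fps_nth f n) * r ^ n" for n
  define b where "b n = norm (fps_nth (f ^ i) n) * r ^ n" for n
  have nn: "a n \<ge> 0" "b n \<ge> 0" for n using assms by (simp_all add: a_def b_def)
  have "norm (fps_nth (f ^ Suc i) n) * r ^ n \<le> (\<Sum>k\<le>n. a k * b (n - k))" for n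
  proof -
    have "norm (fps_nth (f ^ Suc i) n) * r ^ n \<le> (\<Sum>k\<le>n. norm (fps_nth f k * fps_nth (f ^ i) (n - k))) * r ^ n"
      using assms by (simp add: fps_mult_nth atLeast0AtMost sum_norm_le mult_right_mono)
    also have "\<dots> = (\<Sum>k\<le>n. a k * b (n - k))"
      unfolding sum_distrib_right
    proof (rule sum.cong)
      fix k assume "k \<in> {..n}"
      then have "r ^ n = r ^ k * r ^ (n - k)" by (simp flip: power_add)
      then show "norm (fps_nth f k * fps_nth (f ^ i) (n - k)) * r ^ n = a k * b (n - k)"
        by (simp add: a_def b_def norm_mult)
    qed simp
    finally show ?thesis .
  qed
  then have "(\<Sum>n\<le>N. norm (fps_nth (f ^ Suc i) n) * r ^ n) \<le> (\<Sum>n\<le>N. \<Sum>k\<le>n. a k * b (n - k))"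
    by (rule sum_mono)
  also have "\<dots> = (\<Sum>(n, k)\<in>(SIGMA n:{..N}. {..n}). a k * b (n - k))"
    by (simp add: sum.Sigma)
  also have "\<dots> = (\<Sum>(k, l)\<in>{(k, l). k + l \<le> N}. a k * b l)"
    by (rule sum.reindex_bij_witness[where i = "\<lambda>(k, l). (k + l, k)" and j = "\<lambda>(n, k). (k, n - k)"]) auto
  also have "\<dots> \<le> (\<Sum>(k, l)\<in>{..N} \<times> {..N}. a k * b l)"
    using nn by (intro sum_mono2) auto
  also have "\<dots> = (\<Sum>n\<le>N. a n) * (\<Sum>n\<le>N. b n)"
    by (simp add: sum_product sum.cartesian_product)
  also have "\<dots> \<le> (\<Sum>n\<le>N. a n) * (\<Sum>n\<le>N. a n) ^ i"
    using Suc.IH nn by (intro mult_left_mono sum_nonneg) (simp_all add: a_def b_def)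
  finally show ?case by (simp add: a_def)
qed

text \<open>As \<open>f\<close> has no constant term, the coefficient of index \<open>N\<close> in a
  product of at least two factors never receives a contribution from \<open>fps_nth f N\<close>.
  Only the first power sees it, hence the exception at \<open>m = N\<close>.\<close>

lemma fps_power_nth_cutoff:
  fixes f :: "complex fps"
  assumes "fps_nth f 0 = 0" "m < N \<or> m = N \<and> i \<noteq> 1"
  shows "fps_nth (f ^ i) m = fps_nth (fps_cutoff N f ^ i) m"
  using assms(2)
proof (induction i arbitrary: m)
  case (Suc i)
  have "fps_nth f k * fps_nth (f ^ i) (m - k) =
      fps_nth (fps_cutoff N f) k * fps_nth (fps_cutoff N f ^ i) (m - k)" if "k \<le> m" for k
  proof (cases "k = 0")
    case True
    then show ?thesis using assms(1) by simp
  next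
    case k: False
    show ?thesis
    proof (cases "k < N")
      case True
      moreover have "m - k < N" using Suc.prems k that by linarith
      ultimately show ?thesis using Suc.IH[of "m - k"] by simp
    next
      case False
      then have "m = N" "k = m" "i \<noteq> 0" using that Suc.prems by auto
      moreover have "fps_nth (f ^ i) 0 = 0" using \<open>i \<noteq> 0\<close> assms(1) by simp
      ultimately show ?thesis by simp
    qed
  qed
  then show ?case by (simp add: fps_mult_nth)
qed simp

text \<open>The omitted pairs are the constant term and the linear term in the first variable. The
  others have \<open>j = 0\<close> and \<open>i \<ge> 2\<close>, contributing at most
  \<open>2 a^2\<close>, or \<open>j \<ge> 1\<close>, contributing at most \<open>4 b\<close>,
  because each geometric sum is at most 2.\<close>

lemma sum_power_le:
  fixes a b :: real
  assumes "0 \<le> a" "a \<le> 1 / 2" "0 \<le> b" "b \<le> 1 / 2"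
  shows "(\<Sum>(i, j)\<in>{..N} \<times> {..N} - {(0, 0), (1, 0)}. a ^ i * b ^ j) \<le> 2 * a ^ 2 + 4 * b"
proof -
  have 1: "(\<Sum>i\<le>N. x ^ i) \<le> 2" if "0 \<le> x" "x \<le> 1 / 2" for x :: real and N
  proof -
    have "1 / (1 - x) \<le> 2" using that by (simp add: field_simps)
    then show ?thesis using sum_geometric_le[of x N] that by linarith
  qed
  have "{..N} \<times> {..N} - {(0, 0), (1, 0)} \<subseteq>
      (\<lambda>i. (i + 2, 0)) ` {..N} \<union> (\<lambda>(i, j). (i, j + 1)) ` ({..N} \<times> {..N})"
  proof
    fix p assume p: "p \<in> {..N} \<times> {..N} - {(0, 0), (1, 0)}"
    obtain i j where ij: "p = (i, j)" by (cases p)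
    show "p \<in> (\<lambda>i. (i + 2, 0)) ` {..N} \<union> (\<lambda>(i, j). (i, j + 1)) ` ({..N} \<times> {..N})"
    proof (cases j)
      case 0
      then have "i \<ge> 2" "i \<le> N" using p ij by auto
      then have "p = (i - 2 + 2, 0)" "i - 2 \<in> {..N}" using ij 0 by auto
      then show ?thesis by blast
    next
      case (Suc j')
      then have "p = (\<lambda>(i, j). (i, j + 1)) (i, j')" "(i, j') \<in> {..N} \<times> {..N}" using p ij by auto
      then show ?thesis by blast
    qed
  qed
  then have "(\<Sum>(i, j)\<in>{..N} \<times> {..N} - {(0, 0), (1, 0)}. a ^ i * b ^ j) \<le>
     (\<Sum>(i, j)\<in>(\<lambda>i. (i + 2, 0)) ` {..N} \<union> (\<lambda>(i, j). (i, j + 1)) ` ({..N} \<times> {..N}). a ^ i * b ^ j)"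
    using assms by (intro sum_mono2) auto
  also have "\<dots> = (\<Sum>(i, j)\<in>(\<lambda>i. (i + 2, 0)) ` {..N}. a ^ i * b ^ j) +
      (\<Sum>(i, j)\<in>(\<lambda>(i, j). (i, j + 1)) ` ({..N} \<times> {..N}). a ^ i * b ^ j)"
    by (rule sum.union_disjoint) auto
  also have "(\<Sum>(i, j)\<in>(\<lambda>i. (i + 2, 0)) ` {..N}. a ^ i * b ^ j) = a ^ 2 * (\<Sum>i\<le>N. a ^ i)"
    by (subst sum.reindex) (auto simp: inj_on_def sum_distrib_left power_add power2_eq_square mult_ac)
  also have "(\<Sum>(i, j)\<in>(\<lambda>(i, j). (i, j + 1)) ` ({..N} \<times> {..N}). a ^ i * b ^ j) =
      b * ((\<Sum>i\<le>N. a ^ i) * (\<Sum>j\<le>N. b ^ j))"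
  proof -
    have "(\<Sum>i\<le>N. a ^ i) * (\<Sum>j\<le>N. b ^ j) = (\<Sum>(i, j)\<in>{..N} \<times> {..N}. a ^ i * b ^ j)"
      by (simp add: sum_product sum.cartesian_product)
    then show ?thesis
      by (subst sum.reindex) (auto simp: inj_on_def sum_distrib_left case_prod_unfold mult_ac)
  qed
  also have "a ^ 2 * (\<Sum>i\<le>N. a ^ i) \<le> a ^ 2 * 2"
    using 1 assms by (intro mult_left_mono) auto
  also have "b * ((\<Sum>i\<le>N. a ^ i) * (\<Sum>j\<le>N. b ^ j)) \<le> b * (2 * 2)"
    using assms by (intro mult_left_mono mult_mono 1 sum_nonneg) auto
  finally show ?thesis by simp
qed

text \<open>A majorant argument. The last hypothesis says that every coefficient of
  \<open>F(f(v), v)\<close> vanishes; solved for the linear term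
  \<open>coeff2 F 1 0 * fps_nth f n\<close>, it bounds each partial sum of the weighted norm of
  \<open>f\<close> in terms of the previous one, and the bound \<open>\<rho>\<close> reproduces
  itself.\<close>

lemma implicit_function_convergent:
  fixes f :: "complex fps"
  assumes F: "F \<in> O2" "coeff2 F 0 0 = 0" "coeff2 F 1 0 \<noteq> 0"
    and f0: "fps_nth f 0 = 0"
    and eq: "\<And>n. (\<Sum>j\<le>n. fps_nth (fps_nth F j oo f) (n - j)) = 0"
  shows "fps_conv_radius f > 0"
proof -
  define c where "c = norm (coeff2 F 1 0)"
  have c: "c > 0" using F(3) by (simp add: c_def)
  obtain M R where MR: "R > 0" "M \<ge> 0" "\<forall>i j. norm (coeff2 F i j) \<le> M * R ^ (i + j)"
    using O2_bound[OF F(1)] by blast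
  \<comment> \<open>The choice of \<open>\<rho>\<close> keeps the terms of degree at least 2 in
    \<open>u\<close> alone below \<open>c * \<rho> / 2\<close>; only then is \<open>r\<close>
    chosen, so that the terms containing \<open>v\<close> stay below \<open>c * \<rho> / 2\<close>
    too. Writing \<open>M + 1\<close> covers \<open>M = 0\<close>.\<close>
  define \<rho> where "\<rho> = min (1 / (2 * R)) (c / (4 * (M + 1) * R ^ 2))"
  define r where "r = min (1 / (2 * R)) (c * \<rho> / (8 * (M + 1) * R))"
  have \<rho>: "\<rho> > 0" using c MR by (simp add: \<rho>_def)
  have r: "r > 0" using c MR \<rho> by (simp add: r_def)
  have small: "R * r \<le> 1 / 2" "M * (2 * (R * \<rho>) ^ 2 + 4 * (R * r)) \<le> c * \<rho>" "R * \<rho> \<le> 1 / 2"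
  proof -
    have "\<rho> \<le> 1 / (2 * R)" "r \<le> 1 / (2 * R)" by (simp_all add: \<rho>_def r_def)
    then show "R * r \<le> 1 / 2" "R * \<rho> \<le> 1 / 2" using MR(1) by (simp_all add: field_simps)
    have "\<rho> \<le> c / (4 * (M + 1) * R ^ 2)" "r \<le> c * \<rho> / (8 * (M + 1) * R)" by (simp_all add: \<rho>_def r_def)
    then have *: "\<rho> * (4 * (M + 1) * R ^ 2) \<le> c" "r * (8 * (M + 1) * R) \<le> c * \<rho>"
      using MR(1,2) by (simp_all add: pos_le_divide_eq)
    have "\<rho> * (4 * M * R ^ 2) \<le> \<rho> * (4 * (M + 1) * R ^ 2)" "r * (8 * M * R) \<le> r * (8 * (M + 1) * R)"
      using MR(1,2) \<rho> r by (intro mult_left_mono mult_right_mono; simp)+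
    then have "\<rho> * (4 * M * R ^ 2) \<le> c" and r': "r * (8 * M * R) \<le> c * \<rho>"
      using * by linarith+
    then have "\<rho> * (4 * M * R ^ 2) * \<rho> \<le> c * \<rho>" using \<rho> by (intro mult_right_mono) auto
    moreover have "M * (2 * (R * \<rho>) ^ 2 + 4 * (R * r)) =
        (\<rho> * (4 * M * R ^ 2) * \<rho>) / 2 + (r * (8 * M * R)) / 2"
      by (simp add: field_simps power2_eq_square)
    ultimately show "M * (2 * (R * \<rho>) ^ 2 + 4 * (R * r)) \<le> c * \<rho>"
      using r' by linarith
  qed
  have bound: "(\<Sum>n<N. norm (fps_nth f n) * r ^ n) \<le> \<rho>" for N
  proof (induction N)
    case 0
    then show ?case using \<rho> by simp
  next
    case (Suc N)
    define g where "g = fps_cutoff N f"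
    define s where "s = (\<Sum>n\<le>N. norm (fps_nth g n) * r ^ n)"
    have "s = (\<Sum>n<N. norm (fps_nth f n) * r ^ n)"
      unfolding s_def by (rule sum.mono_neutral_cong_right) (auto simp: g_def)
    with Suc have s: "s \<le> \<rho>" by simp
    have s0: "s \<ge> 0" using r by (auto simp: s_def intro!: sum_nonneg)
    define I where "I = {..N} \<times> {..N} - {(0, 0), (1, 0 :: nat)}"
    have fn: "c * norm (fps_nth f n) \<le> (\<Sum>(i, j)\<in>I. norm (coeff2 F i j) *
        (if j \<le> n then norm (fps_nth (g ^ i) (n - j)) else 0))" if n: "n \<le> N" for n
    proof -
      define h where "h i j = (if j \<le> n then coeff2 F i j * fps_nth (f ^ i) (n - j) else 0)" for i j
      have "0 = (\<Sum>j\<le>n. \<Sum>i\<le>n - j. coeff2 F i j * fps_nth (f ^ i) (n - j))"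
        using eq[of n] by (simp add: fps_compose_nth coeff2_def atLeast0AtMost)
      also have "\<dots> = (\<Sum>j\<le>n. \<Sum>i\<le>N. h i j)"
      proof (rule sum.cong[OF refl])
        fix j assume "j \<in> {..n}"
        show "(\<Sum>i\<le>n - j. coeff2 F i j * fps_nth (f ^ i) (n - j)) = (\<Sum>i\<le>N. h i j)"
        proof (rule sum.mono_neutral_cong_left)
          show "\<forall>i\<in>{..N} - {..n - j}. h i j = 0"
          proof
            fix i assume "i \<in> {..N} - {..n - j}"
            then have "fps_nth (f ^ i) (n - j) = 0"
              using f0 by (intro startsby_zero_power_prefix[rule_format]) auto
            then show "h i j = 0" by (simp add: h_def)
          qed
        qed (use n \<open>j \<in> {..n}\<close> in \<open>auto simp: h_def\<close>)
      qed
      also have "\<dots> = (\<Sum>j\<le>N. \<Sum>i\<le>N. h i j)"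
        using n by (intro sum.mono_neutral_left) (auto simp: h_def)
      also have "\<dots> = (\<Sum>(i, j)\<in>{..N} \<times> {..N}. h i j)"
        by (subst sum.swap) (simp add: sum.cartesian_product)
      \<comment> \<open>For \<open>N = 0\<close> the pair \<open>(1, 0)\<close> lies outside the
        square; its term is then a multiple of \<open>fps_nth f 0\<close>, which vanishes.\<close>
      also have "\<dots> = (\<Sum>(i, j)\<in>insert (1, 0) I. h i j)"
      proof (rule sum.mono_neutral_cong)
        fix p assume "p \<in> insert (1, 0) I - {..N} \<times> {..N}"
        then have "p = (1, 0)" "n = 0" using n by (auto simp: I_def)
        then show "(case p of (i, j) \<Rightarrow> h i j) = 0" using f0 by (simp add: h_def)
      next
        fix p assume "p \<in> {..N} \<times> {..N} - insert (1, 0) I"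
        then have "p = (0, 0)" by (auto simp: I_def)
        then show "(case p of (i, j) \<Rightarrow> h i j) = 0" using F(2) by (simp add: h_def)
      qed (auto simp: I_def)
      also have "\<dots> = coeff2 F 1 0 * fps_nth f n + (\<Sum>(i, j)\<in>I. h i j)"
        by (subst sum.insert) (auto simp: I_def h_def)
      finally have "coeff2 F 1 0 * fps_nth f n = - (\<Sum>(i, j)\<in>I. h i j)"
        by (simp add: eq_neg_iff_add_eq_0)
      then have "c * norm (fps_nth f n) = norm (\<Sum>(i, j)\<in>I. h i j)"
        by (metis c_def norm_minus_cancel norm_mult)
      also have "\<dots> \<le> (\<Sum>(i, j)\<in>I. norm (h i j))"
        by (rule order_trans[OF norm_sum]) (simp add: case_prod_unfold)
      also have "\<dots> = (\<Sum>(i, j)\<in>I. norm (coeff2 F i j) *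
        (if j \<le> n then norm (fps_nth (g ^ i) (n - j)) else 0))"
      proof (rule sum.cong)
        fix p assume "p \<in> I"
        obtain i j where p: "p = (i, j)" by (cases p)
        have "fps_nth (f ^ i) (n - j) = fps_nth (g ^ i) (n - j)"
        proof (cases "i = 0")
          case False
          with \<open>p \<in> I\<close> p have "n - j < N \<or> n - j = N \<and> i \<noteq> 1"
            using n by (auto simp: I_def)
          then show ?thesis unfolding g_def using f0 by (intro fps_power_nth_cutoff)
        qed simp
        then show "(case p of (i, j) \<Rightarrow> norm (h i j)) = (case p of (i, j) \<Rightarrow> norm (coeff2 F i j) *
          (if j \<le> n then norm (fps_nth (g ^ i) (n - j)) else 0))"
          by (simp add: p h_def norm_mult)
      qed simp
      finally show ?thesis .
    qed
    have "c * (\<Sum>n\<le>N. norm (fps_nth f n) * r ^ n) \<le> (\<Sum>n\<le>N. (\<Sum>(i, j)\<in>I. norm (coeff2 F i j) *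
        (if j \<le> n then norm (fps_nth (g ^ i) (n - j)) else 0)) * r ^ n)"
      unfolding sum_distrib_left mult.assoc[symmetric]
      using fn r by (intro sum_mono mult_right_mono) auto
    also have "\<dots> = (\<Sum>(i, j)\<in>I. norm (coeff2 F i j) *
        (\<Sum>n\<le>N. (if j \<le> n then norm (fps_nth (g ^ i) (n - j)) else 0) * r ^ n))"
      unfolding sum_distrib_right by (subst sum.swap) (simp add: case_prod_unfold sum_distrib_left mult.assoc)
    also have "\<dots> \<le> (\<Sum>(i, j)\<in>I. M * ((R * \<rho>) ^ i * (R * r) ^ j))"
    proof (rule sum_mono)
      fix p assume "p \<in> I"
      obtain i j where p: "p = (i, j)" by (cases p)
      have j: "j \<le> N" using \<open>p \<in> I\<close> by (auto simp: p I_def)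
      have "(\<Sum>n\<le>N. (if j \<le> n then norm (fps_nth (g ^ i) (n - j)) else 0) * r ^ n) =
          (\<Sum>n\<in>{j..N}. norm (fps_nth (g ^ i) (n - j)) * r ^ n)"
        by (rule sum.mono_neutral_cong_right) auto
      also have "\<dots> = (\<Sum>n\<le>N - j. norm (fps_nth (g ^ i) n) * r ^ (n + j))"
        by (rule sum.reindex_bij_witness[where i = "\<lambda>n. n + j" and j = "\<lambda>n. n - j"]) (use j in auto)
      also have "\<dots> \<le> (\<Sum>n\<le>N. norm (fps_nth (g ^ i) n) * r ^ (n + j))"
        using r by (intro sum_mono2) auto
      also have "\<dots> = (\<Sum>n\<le>N. norm (fps_nth (g ^ i) n) * r ^ n) * r ^ j"
        by (simp add: sum_distrib_right power_add mult.assoc)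
      also have "\<dots> \<le> s ^ i * r ^ j"
        unfolding s_def using r by (intro mult_right_mono sum_norm_fps_power_le) auto
      also have "\<dots> \<le> \<rho> ^ i * r ^ j"
        using s s0 r by (intro mult_right_mono power_mono) auto
      finally have "norm (coeff2 F i j) * (\<Sum>n\<le>N. (if j \<le> n then norm (fps_nth (g ^ i) (n - j)) else 0) * r ^ n)
          \<le> (M * R ^ (i + j)) * (\<rho> ^ i * r ^ j)"
        using MR \<rho> r by (intro mult_mono) (auto intro!: sum_nonneg)
      then show "(case p of (i, j) \<Rightarrow> norm (coeff2 F i j) *
          (\<Sum>n\<le>N. (if j \<le> n then norm (fps_nth (g ^ i) (n - j)) else 0) * r ^ n)) \<le>
        (case p of (i, j) \<Rightarrow> M * ((R * \<rho>) ^ i * (R * r) ^ j))"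
        by (simp add: p power_mult_distrib power_add mult_ac)
    qed
    also have "\<dots> = M * (\<Sum>(i, j)\<in>I. (R * \<rho>) ^ i * (R * r) ^ j)"
      by (simp add: sum_distrib_left case_prod_unfold)
    also have "\<dots> \<le> M * (2 * (R * \<rho>) ^ 2 + 4 * (R * r))"
      unfolding I_def using small \<rho> r MR by (intro mult_left_mono sum_power_le) auto
    also have "\<dots> \<le> c * \<rho>" by (rule small)
    finally show ?case using c by (simp add: lessThan_Suc_atMost)
  qed
  have "norm (fps_nth f n) * r ^ n \<le> \<rho>" for n
  proof -
    have "norm (fps_nth f n) * r ^ n \<le> (\<Sum>n<Suc n. norm (fps_nth f n) * r ^ n)"
      using r by (intro member_le_sum) auto
    with bound[of "Suc n"] show ?thesis by linarith
  qed
  note b = this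
  define z where "z = complex_of_real (r / 2)"
  have "summable (\<lambda>n. fps_nth f n * z ^ n)"
  proof (rule summable_comparison_test)
    show "summable (\<lambda>n. \<rho> * (1 / 2) ^ n)"
      by (intro summable_mult summable_geometric) simp
    have "norm (fps_nth f n * z ^ n) \<le> \<rho> * (1 / 2) ^ n" for n
    proof -
      have "norm z = r * (1 / 2)" using r by (simp add: z_def)
      then have "norm (fps_nth f n * z ^ n) = norm (fps_nth f n) * r ^ n * (1 / 2) ^ n"
        by (simp only: norm_mult norm_power power_mult_distrib mult.assoc)
      also have "\<dots> \<le> \<rho> * (1 / 2) ^ n" using b by (intro mult_right_mono) auto
      finally show ?thesis .
    qed
    then show "\<exists>N. \<forall>n\<ge>N. norm (fps_nth f n * z ^ n) \<le> \<rho> * (1 / 2) ^ n" by blast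
  qed
  then have "conv_radius (fps_nth f) \<ge> ereal (norm z)"
    by (rule conv_radius_geI)
  moreover have "norm z > 0" using r by (simp add: z_def)
  ultimately show ?thesis
    unfolding fps_conv_radius_def by (meson ereal_less(2) less_le_trans)
qed

subsection \<open>Series in the second variable\<close>

definition lift_v :: "complex fps \<Rightarrow> series2" where
  "lift_v f = Abs_fps (\<lambda>j. fps_const (fps_nth f j))"

lemma lift_v_hom:
  "lift_v (f + g) = lift_v f + lift_v g" "lift_v (f - g) = lift_v f - lift_v g"
  "lift_v (- f) = - lift_v f" "lift_v (f * g) = lift_v f * lift_v g"
  "lift_v fps_X = V" "lift_v 0 = 0" "lift_v 1 = 1" "lift_v (numeral n) = numeral n"
proof -
  show "lift_v (f + g) = lift_v f + lift_v g" "lift_v (f - g) = lift_v f - lift_v g"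
    "lift_v (- f) = - lift_v f" "lift_v 0 = 0" "lift_v 1 = 1"
    by (simp_all add: lift_v_def fps_eq_iff[where 'a = "complex fps"])
  show "lift_v (f * g) = lift_v f * lift_v g"
  proof (rule fps_ext)
    fix n
    have "fps_const (\<Sum>i\<in>I. h i) = (\<Sum>i\<in>I. fps_const (h i))" for I :: "nat set" and h :: "nat \<Rightarrow> complex"
      by (induction I rule: infinite_finite_induct) (simp_all flip: fps_const_add)
    then show "fps_nth (lift_v (f * g)) n = fps_nth (lift_v f * lift_v g) n"
      by (simp add: lift_v_def fps_mult_nth)
  qed
  show "lift_v fps_X = V"
    by (rule fps_ext) (simp add: lift_v_def V_def)
  show "lift_v (numeral n) = numeral n"
    by (rule fps_ext) (simp add: lift_v_def fps_numeral_nth numeral_fps_const)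
qed

lemma lift_v_power: "lift_v (f ^ n) = lift_v f ^ n"
  by (induction n) (simp_all add: lift_v_hom)

lemma coeff2_lift_v: "coeff2 (lift_v f) i j = (if i = 0 then fps_nth f j else 0)"
  by (simp add: lift_v_def coeff2_def)

lemma deriv_lift_v: "deriv_u (lift_v f) = 0" "deriv_v (lift_v f) = lift_v (fps_deriv f)"
proof -
  show "deriv_u (lift_v f) = 0"
    by (rule fps_ext) (simp add: lift_v_def deriv_u_def)
  show "deriv_v (lift_v f) = lift_v (fps_deriv f)"
    by (rule series2_eqI) (simp add: deriv_v_def lift_v_def coeff2_def fps_of_nat[symmetric]
        del: fps_of_nat)
qed

text \<open>The substitution \<open>u = f(v)\<close> into a multiple of \<open>u - f(v)\<close>,
  written for the coefficient of \<open>v ^ n\<close> because the series are nested with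
  \<open>v\<close> outside. The contributions of \<open>w * U\<close> and
  \<open>w * lift_v f\<close> are reindexed to the same double sum \<open>S\<close>.\<close>

lemma graph_eq_vanishes:
  fixes f :: "complex fps" and w :: series2
  assumes "fps_nth f 0 = 0"
  shows "(\<Sum>j\<le>n. fps_nth (fps_nth (w * (U - lift_v f)) j oo f) (n - j)) = 0"
proof -
  define G where "G j = fps_nth w j oo f" for j
  define S where "S = (\<Sum>(k, j)\<in>{(k, j). k + j \<le> n}. fps_nth f k * fps_nth (G j) (n - k - j))"
  have "(fps_nth (w * U) j oo f) = f * G j" for j
    using assms by (simp add: G_def U_def fps_compose_mult_distrib mult.commute)
  then have "(\<Sum>j\<le>n. fps_nth (fps_nth (w * U) j oo f) (n - j)) =
      (\<Sum>j\<le>n. \<Sum>k\<le>n - j. fps_nth f k * fps_nth (G j) (n - j - k))"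
    by (simp add: fps_mult_nth atLeast0AtMost)
  also have "\<dots> = (\<Sum>(j, k)\<in>(SIGMA j:{..n}. {..n - j}). fps_nth f k * fps_nth (G j) (n - j - k))"
    by (simp add: sum.Sigma)
  also have "\<dots> = S"
    unfolding S_def
    by (rule sum.reindex_bij_witness[where i = "\<lambda>(k, j). (j, k)" and j = "\<lambda>(j, k). (k, j)"])
      (auto simp: diff_diff_eq add.commute)
  finally have 1: "(\<Sum>j\<le>n. fps_nth (fps_nth (w * U) j oo f) (n - j)) = S" .
  have "(fps_nth (w * lift_v f) j oo f) = (\<Sum>k\<le>j. fps_const (fps_nth f k) * G (j - k))" for j
    using assms by (simp add: G_def lift_v_def mult.commute[of w] fps_mult_nth[of "Abs_fps _"]
      atLeast0AtMost fps_compose_sum_distrib fps_compose_mult_distrib)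
  then have "(\<Sum>j\<le>n. fps_nth (fps_nth (w * lift_v f) j oo f) (n - j)) =
      (\<Sum>j\<le>n. \<Sum>k\<le>j. fps_nth f k * fps_nth (G (j - k)) (n - j))"
    by (simp add: fps_sum_nth)
  also have "\<dots> = (\<Sum>(j, k)\<in>(SIGMA j:{..n}. {..j}). fps_nth f k * fps_nth (G (j - k)) (n - j))"
    by (simp add: sum.Sigma)
  also have "\<dots> = S"
    unfolding S_def
    by (rule sum.reindex_bij_witness[where i = "\<lambda>(k, j). (k + j, k)" and j = "\<lambda>(j, k). (k, j - k)"])
      (auto simp: diff_diff_eq)
  finally have 2: "(\<Sum>j\<le>n. fps_nth (fps_nth (w * lift_v f) j oo f) (n - j)) = S" .
  show ?thesis
    using 1 2 by (simp add: right_diff_distrib fps_compose_sub_distrib sum_subtractf)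
qed

lemma series2_unit: "coeff2 f 0 0 \<noteq> 0 \<Longrightarrow> f dvd 1"
proof -
  assume "coeff2 f 0 0 \<noteq> 0"
  then have "fps_nth f 0 * inverse (fps_nth f 0) = 1"
    by (simp add: coeff2_def inverse_mult_eq_1' )
  then have "f * fps_right_inverse f (inverse (fps_nth f 0)) = 1"
    by (rule fps_right_inverse)
  then show ?thesis by (metis dvd_triv_left)
qed

lemma series2_unit_iff: "f dvd 1 \<longleftrightarrow> coeff2 f 0 0 \<noteq> 0"
proof
  assume "f dvd 1"
  then obtain g where "1 = f * g" ..
  then have "coeff2 f 0 0 * coeff2 g 0 0 = 1" by (metis coeff2_basic(2) coeff2_jet(1))
  then show "coeff2 f 0 0 \<noteq> 0" by auto
qed (rule series2_unit)

text \<open>A product of two nonunits has no linear terms, whereas the coefficient of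
  \<open>u\<close> is 1 here.\<close>

lemma irreducible_graph:
  assumes "fps_nth f 0 = 0"
  shows "irreducible (U - lift_v f)"
proof (rule irreducibleI)
  have 10: "coeff2 (U - lift_v f) (Suc 0) 0 = 1" by (simp add: coeff2_lift_v)
  then show "U - lift_v f \<noteq> 0" by (metis coeff2_linear(4) zero_neq_one)
  show "\<not> U - lift_v f dvd 1"
    using assms by (simp add: series2_unit_iff coeff2_lift_v)
  show "a dvd 1 \<or> b dvd 1" if "U - lift_v f = a * b" for a b
    using 10 unfolding that series2_unit_iff by auto
qed

text \<open>A unit \<open>w\<close> multiplies the coefficient of \<open>u\<close> by the nonzero
  value \<open>w(0)\<close>, so the implicit function theorem applies to every convergent equation
  of the curve.\<close>

lemma graph_divergent:
  assumes "fps_nth f 0 = 0" "\<not> fps_conv_radius f > 0"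
  shows "divergent_curve (U - lift_v f)"
  unfolding divergent_curve_def
proof (intro allI impI notI)
  fix w assume "w dvd 1" "w * (U - lift_v f) \<in> O2"
  moreover have "coeff2 (w * (U - lift_v f)) 0 0 = 0" "coeff2 (w * (U - lift_v f)) 1 0 = coeff2 w 0 0"
    using assms(1) by (simp_all add: coeff2_lift_v)
  ultimately have "fps_conv_radius f > 0"
    using assms(1) graph_eq_vanishes[OF assms(1)]
    by (intro implicit_function_convergent[of "w * (U - lift_v f)"]) (simp_all add: series2_unit_iff)
  then show False using assms(2) by simp
qed

subsection \<open>The divergent solution\<close>

text \<open>In the coordinates of the introduction, \<open>y = euler_series(t) / t\<close> is the formal solution with a
  pole at \<open>t = 0\<close>.\<close>

definition euler_series :: "complex fps" where
  "euler_series = Abs_fps (\<lambda>n. if n = 0 then 1 else if n = 1 then - 1 else if n = 2 then 0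
     else (- 1) ^ (n + 1) * fact (n - 2))"

text \<open>For \<open>n \<ge> 4\<close> the equation amounts to the recursion
  \<open>Y_n = - (n - 2) Y_(n-1)\<close>. The term \<open>t ^ 3\<close> makes the third coefficient
  1 after a vanishing second one, and so starts the factorial growth.\<close>

lemma euler_series_ode:
  "1 - 2 * fps_X - euler_series + fps_X ^ 3 =
     fps_X ^ 2 * fps_deriv euler_series - fps_X * euler_series"
proof (rule fps_ext)
  fix n :: nat
  consider "n = 0" | "n = 1" | "n = 2" | "n = 3" | m where "n = m + 4"
  proof -
    have "n = 0 \<or> n = 1 \<or> n = 2 \<or> n = 3 \<or> 4 \<le> n" by linarith
    moreover have "\<exists>m. n = m + 4" if "4 \<le> n"
      using that by (intro exI[of _ "n - 4"]) simp
    ultimately show ?thesis using that by blast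
  qed
  then show "fps_nth (1 - 2 * fps_X - euler_series + fps_X ^ 3) n =
      fps_nth (fps_X ^ 2 * fps_deriv euler_series - fps_X * euler_series) n"
    by cases (simp_all add: euler_series_def fps_X_power_mult_nth fps_X_power_nth fps_mult_numeral_left
        fps_one_nth fps_numeral_nth eval_nat_numeral algebra_simps)
qed

text \<open>Convergence would make the terms \<open>(n + 1)! r ^ (n + 3)\<close> tend to 0, as do
  the terms of the exponential series at \<open>1 / r\<close>. The product of the two sequences is
  the constant \<open>r ^ 2\<close>.\<close>

lemma euler_series_divergent: "\<not> fps_conv_radius euler_series > 0"
proof
  assume "fps_conv_radius euler_series > 0"
  then obtain r where r: "0 < ereal r" "ereal r < fps_conv_radius euler_series"
    using ereal_dense2 by blast
  define a where "a n = norm (fps_nth euler_series (n + 3)) * r ^ (n + 3)" for n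
  define b where "b n = (1 / r) ^ (n + 1) / fact (n + 1)" for n
  have "r > 0" using r(1) by simp
  have "summable (\<lambda>n. fps_nth euler_series n * of_real r ^ n)"
    using r \<open>r > 0\<close> by (intro summable_fps) simp
  then have "(\<lambda>n. fps_nth euler_series n * of_real r ^ n) \<longlonglongrightarrow> 0"
    by (rule summable_LIMSEQ_zero)
  then have "(\<lambda>n. norm (fps_nth euler_series (n + 3) * of_real r ^ (n + 3))) \<longlonglongrightarrow> 0"
    by (intro tendsto_norm_zero LIMSEQ_ignore_initial_segment)
  then have "a \<longlonglongrightarrow> 0"
    using \<open>r > 0\<close> by (simp add: a_def[abs_def] norm_mult norm_power)
  moreover have "b \<longlonglongrightarrow> 0"
  proof -
    have "(\<lambda>n. inverse (fact n) *\<^sub>R (1 / r) ^ n) \<longlonglongrightarrow> 0"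
      by (rule summable_LIMSEQ_zero[OF summable_exp_generic])
    then have "(\<lambda>n. inverse (fact (n + 1)) *\<^sub>R (1 / r) ^ (n + 1)) \<longlonglongrightarrow> 0"
      by (rule LIMSEQ_ignore_initial_segment)
    then show ?thesis by (simp add: b_def[abs_def] field_simps)
  qed
  ultimately have "(\<lambda>n. a n * b n) \<longlonglongrightarrow> 0 * 0" by (rule tendsto_mult)
  moreover have "a n * b n = r ^ 2" for n
  proof -
    have "fps_nth euler_series (n + 3) = (- 1) ^ (n + 4) * fact (n + 1)"
      by (simp add: euler_series_def add.commute del: fact_Suc)
    then have "norm (fps_nth euler_series (n + 3)) = fact (n + 1)"
      by (simp only: norm_mult norm_power norm_minus_cancel norm_one power_one mult_1 norm_fact)
    then have a: "a n = fact (n + 1) * r ^ (n + 1) * r ^ 2"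
      by (simp add: a_def power_add eval_nat_numeral del: fact_Suc)
    have r1: "r ^ (n + 1) * (1 / r) ^ (n + 1) = 1"
      using \<open>r > 0\<close> by (simp flip: power_mult_distrib)
    have cancel: "F * p * s * (q / F) = s" if "F \<noteq> 0" "p * q = 1" for F p q s :: real
    proof -
      have "F * p * s * (q / F) = (p * q) * s" using that(1) by simp
      then show ?thesis using that(2) by simp
    qed
    show ?thesis
      unfolding a b_def by (rule cancel[OF fact_nonzero r1])
  qed
  ultimately have "(\<lambda>n::nat. r ^ 2) \<longlonglongrightarrow> 0" by simp
  then show False using \<open>r > 0\<close> by (simp add: LIMSEQ_const_iff)
qed

text \<open>The coefficients of \<open>N0\<close> as polynomial functions over any commutative ring,
  since they are evaluated at \<open>U\<close> and \<open>V\<close>, at series in the parameter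
  \<open>t\<close>, and at series in \<open>v\<close> with their lifts.\<close>

definition "poly_t u v = u * v + u - v ^ 2" for u v :: "'a::comm_ring_1"
definition "poly_p u v = u ^ 6 - 2 * poly_t u v * u ^ 4 - poly_t u v * v * u ^ 3 + poly_t u v ^ 3"
  for u v :: "'a::comm_ring_1"
definition "poly_a u v = poly_p u v * (2 * v ^ 2 - u * v - u) + u * v * poly_t u v ^ 3"
  for u v :: "'a::comm_ring_1"
definition "poly_b u v = u * ((u - 2 * v) * poly_p u v - u * poly_t u v ^ 3)"
  for u v :: "'a::comm_ring_1"

lemmas poly_defs = poly_a_def poly_b_def poly_p_def poly_t_def

lemma N0_eq: "N0 = (poly_a U V, poly_b U V)"
  by (simp only: N0_def P0_def T0_def poly_defs)

text \<open>Here \<open>y\<close> is the numerator \<open>Y\<close>: the affine coordinates of the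
  solution are \<open>y / t\<close> and \<open>d / t ^ 2\<close>, which become
  \<open>u = t ^ 2 / d\<close> and \<open>v = t y / d\<close> in the chart at the singular point.
  Primed letters are ring elements in the role of derivatives, so both claims are algebraic
  consequences of the hypotheses.\<close>

lemma parametrized_identity:
  fixes t y y' d d' e q :: "'a::comm_ring_1"
  assumes d: "d = t ^ 3 - t * y + y ^ 2" and e: "d * e = 1"
    and d': "d' = 3 * t ^ 2 - y - t * y' + 2 * y * y'"
    and q: "1 - 2 * t - y + t ^ 3 = q" "q = t ^ 2 * y' - t * y"
  defines "u \<equiv> t ^ 2 * e" and "v \<equiv> t * y * e" and "e' \<equiv> - d' * e ^ 2"
  shows "poly_t u v = u ^ 2 * t"
    and "poly_a u v * (2 * t * e + t ^ 2 * e') + poly_b u v * (y * e + t * y' * e + t * y * e') = 0"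
proof -
  have u: "u = t ^ 2 * e ^ 2 * d"
    using e by (simp add: u_def power2_eq_square mult.assoc mult.commute[of e d])
  have "poly_t u v = u * v + t ^ 2 * e ^ 2 * d - v ^ 2"
    unfolding poly_t_def using u by simp
  also have "\<dots> = t ^ 5 * e ^ 2"
    by (simp add: u_def v_def d algebra_simps eval_nat_numeral)
  finally have T: "poly_t u v = t ^ 5 * e ^ 2" .
  then show "poly_t u v = u ^ 2 * t"
    by (simp add: u_def algebra_simps eval_nat_numeral)
  have "poly_p u v = t ^ 12 * e ^ 6 * (1 - 2 * t - y + t ^ 3)"
    unfolding poly_p_def T by (simp add: u_def v_def algebra_simps eval_nat_numeral)
  then have P: "poly_p u v = t ^ 12 * e ^ 6 * q" by (simp only: q(1))
  define A where "A = q * (y ^ 2 - t ^ 3) + t ^ 4 * y"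
  define B where "B = (t - 2 * y) * q - t ^ 4"
  have V: "2 * v ^ 2 - u * v - u = v ^ 2 - poly_t u v"
    by (simp add: poly_t_def)
  then have "poly_a u v = t ^ 14 * e ^ 8 * A"
    unfolding poly_a_def P V T A_def by (simp add: u_def v_def algebra_simps eval_nat_numeral)
  moreover have "poly_b u v = t ^ 15 * e ^ 8 * B"
    unfolding poly_b_def P T B_def by (simp add: u_def v_def algebra_simps eval_nat_numeral)
  ultimately have "poly_a u v * (2 * t * e + t ^ 2 * e') + poly_b u v * (y * e + t * y' * e + t * y * e') =
      t ^ 15 * e ^ 9 * (2 * A + B * (y + t * y')) + t ^ 16 * e ^ 8 * e' * (A + B * y)"
    by (simp add: algebra_simps eval_nat_numeral)
  \<comment> \<open>The terms with \<open>e'\<close> stem from the common factor \<open>e\<close> of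
    \<open>u\<close> and \<open>v\<close> and see only this combination; \<open>d * e = 1\<close>
    then absorbs the factor \<open>d\<close>.\<close>
  also have "A + B * y = - (q * d)"
    by (simp add: A_def B_def d algebra_simps eval_nat_numeral)
  also have "t ^ 16 * e ^ 8 * e' * (- (q * d)) = t ^ 16 * e ^ 9 * q * d' * (d * e)"
    by (simp add: e'_def algebra_simps eval_nat_numeral)
  also have "t ^ 15 * e ^ 9 * (2 * A + B * (y + t * y')) + t ^ 16 * e ^ 9 * q * d' * (d * e) =
      t ^ 15 * e ^ 9 * (2 * A + B * (y + t * y') + t * q * d')"
    unfolding e by (simp add: algebra_simps eval_nat_numeral)
  also have "2 * A + B * (y + t * y') + t * q * d' = t ^ 3 * (q - (t ^ 2 * y' - t * y))"
    by (simp add: A_def B_def d' algebra_simps eval_nat_numeral)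
  finally show "poly_a u v * (2 * t * e + t ^ 2 * e') + poly_b u v * (y * e + t * y' * e + t * y * e') = 0"
    by (simp only: q(2) diff_self mult_zero_right)
qed

lemma fps_compose_numeral: "numeral n oo (c :: complex fps) = numeral n"
  by (simp add: numeral_fps_const)

lemma poly_compose:
  fixes c :: "complex fps"
  assumes "fps_nth c 0 = 0"
  shows "poly_t u v oo c = poly_t (u oo c) (v oo c)" "poly_a u v oo c = poly_a (u oo c) (v oo c)"
    "poly_b u v oo c = poly_b (u oo c) (v oo c)"
  by (simp_all only: poly_defs fps_compose_add_distrib fps_compose_sub_distrib fps_compose_numeral
      fps_compose_mult_distrib[OF assms] fps_compose_power[OF assms, symmetric])

lemma poly_lift: "poly_a (lift_v f) (lift_v g) = lift_v (poly_a f g)"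
  "poly_b (lift_v f) (lift_v g) = lift_v (poly_b f g)"
  by (simp_all only: poly_defs lift_v_hom lift_v_power)

lemma dvd_diff_mult:
  fixes a b c d g :: "'a::comm_ring_1"
  assumes "g dvd a - b" "g dvd c - d"
  shows "g dvd a * c - b * d"
proof -
  have "a * c - b * d = (a - b) * c + b * (c - d)" by (simp add: algebra_simps)
  then show ?thesis using assms by simp
qed

lemma dvd_diff_arith:
  fixes a b c d g :: "'a::comm_ring_1"
  assumes "g dvd a - b" "g dvd c - d"
  shows "g dvd (a + c) - (b + d)" "g dvd (a - c) - (b - d)"
proof -
  have e: "(a + c) - (b + d) = (a - b) + (c - d)" "(a - c) - (b - d) = (a - b) - (c - d)"
    by (simp_all add: algebra_simps)
  show "g dvd (a + c) - (b + d)" unfolding e using assms by (rule dvd_add)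
  show "g dvd (a - c) - (b - d)" unfolding e using assms by (rule dvd_diff)
qed

lemma dvd_diff_power: "(g :: 'a::comm_ring_1) dvd a - b \<Longrightarrow> g dvd a ^ n - b ^ n"
  by (induction n) (auto intro: dvd_diff_mult)

lemma poly_cong:
  fixes u u' v g :: "'a::comm_ring_1"
  assumes g: "g dvd u - u'"
  shows "g dvd poly_a u v - poly_a u' v" "g dvd poly_b u v - poly_b u' v"
proof -
  note i = dvd_diff_mult dvd_diff_arith dvd_diff_power g
  have v: "g dvd v - v" "g dvd 2 - 2" by simp_all
  have t: "g dvd poly_t u v - poly_t u' v"
    unfolding poly_t_def by (intro i v)
  have p: "g dvd poly_p u v - poly_p u' v"
    unfolding poly_p_def by (intro i v t)
  show "g dvd poly_a u v - poly_a u' v" "g dvd poly_b u v - poly_b u' v"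
    unfolding poly_a_def poly_b_def by (intro i v t p)+
qed

text \<open>Modulo \<open>U - lift_v f\<close> the coefficients of \<open>N0\<close> may be replaced
  by their restrictions to the graph, and the hypothesis says that the form pulled back along
  \<open>v \<mapsto> (f(v), v)\<close> vanishes.\<close>

lemma invariant_graph:
  assumes "poly_a f fps_X * fps_deriv f + poly_b f fps_X = 0"
  shows "invariant_germ N0 (U - lift_v f)"
proof -
  have g: "U - lift_v f dvd U - lift_v f" by simp
  have "U - lift_v f dvd poly_a U V - lift_v (poly_a f fps_X)"
    "U - lift_v f dvd poly_b U V - lift_v (poly_b f fps_X)"
    using poly_cong[OF g, of V] by (simp_all add: lift_v_hom(5) flip: poly_lift)
  then have "U - lift_v f dvd (poly_a U V - lift_v (poly_a f fps_X)) * lift_v (fps_deriv f) +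
      (poly_b U V - lift_v (poly_b f fps_X))"
    by (intro dvd_add dvd_mult2)
  also have "\<dots> = poly_a U V * lift_v (fps_deriv f) + poly_b U V -
      lift_v (poly_a f fps_X * fps_deriv f + poly_b f fps_X)"
    by (simp add: lift_v_hom algebra_simps)
  also have "\<dots> = - (poly_a U V * deriv_v (U - lift_v f) - poly_b U V * deriv_u (U - lift_v f))"
    unfolding assms by (simp add: deriv_lift_v lift_v_hom(6))
  finally show ?thesis
    unfolding N0_eq invariant_germ.simps dvd_minus_iff .
qed

subsection \<open>Convergence\<close>

abbreviation convergent_fps :: "complex fps \<Rightarrow> bool" where
  "convergent_fps f \<equiv> fps_conv_radius f > 0"

lemma convergent_fps_arith:
  assumes "convergent_fps f" "convergent_fps g"
  shows "convergent_fps (f + g)" "convergent_fps (f - g)" "convergent_fps (f * g)"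
proof -
  have m: "min (fps_conv_radius f) (fps_conv_radius g) > 0" using assms by simp
  show "convergent_fps (f + g)" using less_le_trans[OF m fps_conv_radius_add] .
  show "convergent_fps (f - g)" using less_le_trans[OF m fps_conv_radius_diff] .
  show "convergent_fps (f * g)" using less_le_trans[OF m fps_conv_radius_mult] .
qed

lemma convergent_fps_power: "convergent_fps f \<Longrightarrow> convergent_fps (f ^ n)"
  using less_le_trans[OF _ fps_conv_radius_power] .

lemma convergent_fps_shift: "convergent_fps f \<Longrightarrow> convergent_fps (fps_shift n f)"
  by simp

lemma convergent_fps_inverse: "convergent_fps f \<Longrightarrow> fps_nth f 0 \<noteq> 0 \<Longrightarrow> convergent_fps (inverse f)"
  by (rule fps_conv_radius_inverse_pos)

lemma convergent_fps_compose:
  assumes "convergent_fps f" "convergent_fps g" "fps_nth g 0 = 0"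
  shows "convergent_fps (f oo g)"
proof -
  have "(eval_fps f \<circ> eval_fps g) has_fps_expansion (f oo g)"
    using assms by (intro has_fps_expansion_compose eval_fps_has_fps_expansion)
  then show ?thesis by (simp add: has_fps_expansion_def)
qed

lemma fps_const_O2:
  assumes "convergent_fps f"
  shows "fps_const f \<in> O2"
proof -
  obtain r where r: "0 < ereal r" "ereal r < fps_conv_radius f"
    using assms ereal_dense2 by blast
  have "r > 0" using r(1) by simp
  have "summable (\<lambda>n. fps_nth f n * of_real r ^ n)"
    using r \<open>r > 0\<close> by (intro summable_fps) simp
  then have "Bseq (\<lambda>n. fps_nth f n * of_real r ^ n)"
    using summable_LIMSEQ_zero convergentI convergent_imp_Bseq by blast
  then obtain M where M: "M > 0" "\<forall>n. norm (fps_nth f n * of_real r ^ n) \<le> M"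
    by (rule BseqE)
  have "norm (coeff2 (fps_const f) i j) \<le> M * (1 / r) ^ (i + j)" for i j
  proof (cases "j = 0")
    case True
    have "norm (fps_nth f i) * r ^ i \<le> M"
      using M(2)[rule_format, of i] \<open>r > 0\<close> by (simp add: norm_mult norm_power)
    then show ?thesis using \<open>r > 0\<close> True by (simp add: coeff2_def field_simps)
  next
    case False
    then show ?thesis using M(1) \<open>r > 0\<close> by (simp add: coeff2_def)
  qed
  then show ?thesis
    using \<open>r > 0\<close> unfolding O2_iff by (intro exI[of _ M] exI[of _ "1 / r"] conjI allI) simp_all
qed

text \<open>The inverse function is the solution \<open>u = g(v)\<close> of
  \<open>f(u) - v = 0\<close>, with \<open>fps_const f\<close> the series \<open>f\<close> in the
  inner variable \<open>u\<close>.\<close>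

lemma convergent_fps_inverse_function:
  assumes "convergent_fps f" "fps_nth f 0 = 0" "fps_nth f 1 \<noteq> 0" "fps_nth g 0 = 0" "f oo g = fps_X"
  shows "convergent_fps g"
proof (rule implicit_function_convergent)
  show "fps_const f - V \<in> O2"
    using assms(1) by (intro O2_diff fps_const_O2 polynomial2_O2) simp_all
  show "coeff2 (fps_const f - V) 0 0 = 0" "coeff2 (fps_const f - V) 1 0 \<noteq> 0"
    using assms(2,3) by (simp_all add: coeff2_def[of "fps_const f"])
  show "fps_nth g 0 = 0" by fact
  fix n
  have "fps_nth (fps_const f - V) j oo g = (if j = 0 then fps_X else if j = 1 then - 1 else 0)" for j
    using assms(5) by (simp add: V_def fps_compose_uminus)
  then have "(\<Sum>j\<le>n. fps_nth (fps_nth (fps_const f - V) j oo g) (n - j)) =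
      (\<Sum>j\<le>n. if j = 0 then fps_nth fps_X n else if j = 1 then - (if n = 1 then 1 else 0) else 0)"
    by (intro sum.cong) (auto simp: fps_one_nth)
  also have "\<dots> = (\<Sum>j\<le>n. (if j = 0 then fps_nth fps_X n else 0) + (if j = 1 then - (if n = 1 then 1 else 0) else 0))"
    by (intro sum.cong) auto
  also have "\<dots> = 0"
    by (simp add: sum.distrib)
  finally show "(\<Sum>j\<le>n. fps_nth (fps_nth (fps_const f - V) j oo g) (n - j)) = 0" .
qed

subsection \<open>The divergent separatrix\<close>

lemma divergent_separatrix: "\<exists>f. separatrix N0 f \<and> divergent_curve f"
proof -
  define y where "y = euler_series"
  define d where "d = fps_X ^ 3 - fps_X * y + y ^ 2"
  define e where "e = inverse d"
  define u where "u = fps_X ^ 2 * e"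
  define v where "v = fps_X * y * e"
  have y0: "fps_nth y 0 = 1" by (simp add: y_def euler_series_def)
  then have d0: "fps_nth d 0 = 1" by (simp add: d_def power2_eq_square)
  have de: "d * e = 1" using d0 by (simp add: e_def inverse_mult_eq_1')
  have e0: "fps_nth e 0 = 1" using d0 by (simp add: e_def)
  have d': "fps_deriv d = 3 * fps_X ^ 2 - y - fps_X * fps_deriv y + 2 * y * fps_deriv y"
    by (simp add: d_def fps_deriv_power power2_eq_square algebra_simps)
  have e': "fps_deriv e = - fps_deriv d * e ^ 2"
    using d0 unfolding e_def by (subst fps_inverse_deriv) (simp_all add: power2_eq_square)
  have u': "fps_deriv u = 2 * fps_X * e + fps_X ^ 2 * (- fps_deriv d * e ^ 2)"
    by (simp add: u_def e' fps_deriv_power algebra_simps)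
  have v': "fps_deriv v = y * e + fps_X * fps_deriv y * e + fps_X * y * (- fps_deriv d * e ^ 2)"
    by (simp add: v_def e' algebra_simps)
  have ode: "1 - 2 * fps_X - y + fps_X ^ 3 = fps_X ^ 2 * fps_deriv y - fps_X * y"
    unfolding y_def by (rule euler_series_ode)
  have uv1: "poly_t u v = u ^ 2 * fps_X"
    unfolding u_def v_def by (rule parametrized_identity(1)[OF d_def de d' ode refl])
  have uv2: "poly_a u v * fps_deriv u + poly_b u v * fps_deriv v = 0"
    unfolding u' v' unfolding u_def v_def
    by (rule parametrized_identity(2)[OF d_def de d' ode refl])
  have v0: "fps_nth v 0 = 0" and v1: "fps_nth v 1 = 1"
    using y0 e0 by (simp_all add: v_def mult.assoc)
  \<comment> \<open>As \<open>v\<close> starts with \<open>t\<close>, it may serve as the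
    coordinate: \<open>\<theta>\<close> is \<open>t\<close> as a series in \<open>v\<close>, and the
    curve becomes the graph of \<open>f\<close>.\<close>
  define \<theta> where "\<theta> = fps_inv v"
  have \<theta>0: "fps_nth \<theta> 0 = 0" by (simp add: \<theta>_def fps_inv_def)
  have \<theta>1: "fps_nth \<theta> 1 = 1" using v1 by (simp add: \<theta>_def fps_inv_def)
  have v\<theta>: "v oo \<theta> = fps_X" and \<theta>v: "\<theta> oo v = fps_X"
    unfolding \<theta>_def using v0 v1 by (auto intro!: fps_inv_right fps_inv)
  define f where "f = u oo \<theta>"
  have f0: "fps_nth f 0 = 0" by (simp add: f_def u_def)
  have "poly_a f fps_X * fps_deriv f + poly_b f fps_X = 0"
  proof -
    have "(poly_a u v * fps_deriv u + poly_b u v * fps_deriv v) oo \<theta> = 0"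
      by (simp add: uv2)
    then have "(poly_a f fps_X * (fps_deriv u oo \<theta>) + poly_b f fps_X * (fps_deriv v oo \<theta>)) * fps_deriv \<theta> = 0"
      by (simp add: fps_compose_add_distrib fps_compose_mult_distrib[OF \<theta>0] poly_compose[OF \<theta>0] v\<theta>
          flip: f_def)
    moreover have "(fps_deriv u oo \<theta>) * fps_deriv \<theta> = fps_deriv f"
      unfolding f_def by (rule fps_compose_deriv[symmetric]) (rule \<theta>0)
    moreover have "(fps_deriv v oo \<theta>) * fps_deriv \<theta> = 1"
      using fps_compose_deriv[OF \<theta>0, of v] by (simp add: v\<theta>)
    ultimately show ?thesis by (simp add: distrib_right mult.assoc)
  qed
  then have "separatrix N0 (U - lift_v f)"
    unfolding separatrix_def using irreducible_graph[OF f0] invariant_graph by blast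
  moreover have "\<not> convergent_fps f"
  proof
    assume f: "convergent_fps f"
    define \<theta>s where "\<theta>s = fps_shift 1 \<theta>"
    have \<theta>s: "\<theta> = fps_X * \<theta>s" using \<theta>0
      by (intro fps_ext) (simp add: \<theta>s_def)
    define fs where "fs = \<theta>s ^ 2 * (e oo \<theta>)"
    have fs0: "fps_nth fs 0 = 1" using \<theta>1 e0 by (simp add: fs_def \<theta>s_def power2_eq_square)
    have "f = \<theta> ^ 2 * (e oo \<theta>)"
      by (simp only: f_def u_def fps_compose_mult_distrib[OF \<theta>0] fps_compose_power[OF \<theta>0, symmetric]
          fps_X_fps_compose_startby0[OF \<theta>0])
    also have "\<theta> ^ 2 = fps_X ^ 2 * \<theta>s ^ 2"
      by (subst \<theta>s) (rule power_mult_distrib)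
    finally have fs: "f = fps_X ^ 2 * fs"
      by (simp only: fs_def mult.assoc)
    have fs_conv: "convergent_fps fs"
      using convergent_fps_shift[OF f, of 2] by (simp add: fs fps_shift_times_fps_X_power' mult.commute)
    \<comment> \<open>On the graph this is \<open>u v + u - v ^ 2 = t u ^ 2\<close>. Since
      \<open>f\<close> has order 2, dividing by \<open>f ^ 2\<close> is a shift by 4 and
      multiplication by the inverse of a convergent unit, so \<open>\<theta>\<close>
      converges.\<close>
    define k where "k = f * fps_X + f - fps_X ^ 2"
    have "poly_t f fps_X = (u ^ 2 * fps_X) oo \<theta>"
      using poly_compose(1)[OF \<theta>0, of u v] by (simp only: uv1 v\<theta> f_def)
    also have "\<dots> = f ^ 2 * \<theta>"
      by (simp only: fps_compose_mult_distrib[OF \<theta>0] fps_compose_power[OF \<theta>0, symmetric]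
          fps_X_fps_compose_startby0[OF \<theta>0] f_def)
    finally have "k = f ^ 2 * \<theta>"
      by (simp only: poly_t_def k_def)
    also have "f ^ 2 = fps_X ^ 4 * fs ^ 2"
      unfolding fs power_mult_distrib by (simp flip: power_mult)
    finally have "k = (fs ^ 2 * \<theta>) * fps_X ^ 4"
      by (simp only: mult_ac)
    then have k: "fps_shift 4 k = fs ^ 2 * \<theta>"
      by (simp add: fps_shift_times_fps_X_power)
    have fs2: "fps_nth (fs ^ 2) 0 \<noteq> 0" using fs0 by (simp add: power2_eq_square)
    have "fps_shift 4 k * inverse (fs ^ 2) = \<theta> * (fs ^ 2 * inverse (fs ^ 2))"
      by (simp only: k mult_ac)
    then have \<theta>: "\<theta> = fps_shift 4 k * inverse (fs ^ 2)"
      by (simp only: inverse_mult_eq_1'[OF fs2] mult_1_right)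
    have k_conv: "convergent_fps k"
      unfolding k_def by (intro convergent_fps_arith convergent_fps_power f) simp_all
    have \<theta>_conv: "convergent_fps \<theta>"
      by (subst \<theta>) (intro convergent_fps_arith(3) convergent_fps_shift k_conv convergent_fps_inverse
          convergent_fps_power fs_conv fs2)
    \<comment> \<open>From \<open>t v = Y u\<close> on the curve, \<open>Y\<close> as a series in
      \<open>v\<close> is a quotient of convergent series; the common factor \<open>v ^ 2\<close> is
      cancelled to divide by a unit.\<close>
    have "(fps_X * v) oo \<theta> = (y * u) oo \<theta>" by (simp add: u_def v_def power2_eq_square mult_ac)
    then have \<theta>f: "\<theta> * fps_X = (y oo \<theta>) * f"
      by (simp only: fps_compose_mult_distrib[OF \<theta>0] v\<theta> fps_X_fps_compose_startby0[OF \<theta>0] f_def)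
    have "fps_X ^ 2 * \<theta>s = \<theta> * fps_X"
      by (subst \<theta>s) (simp only: power2_eq_square mult_ac)
    also note \<theta>f
    also have "(y oo \<theta>) * f = fps_X ^ 2 * ((y oo \<theta>) * fs)"
      by (subst fs) (simp only: mult_ac)
    finally have "fps_X ^ 2 * \<theta>s = fps_X ^ 2 * ((y oo \<theta>) * fs)" .
    then have "\<theta>s = (y oo \<theta>) * fs" by simp
    then have "y oo \<theta> = \<theta>s * inverse fs"
      using fs0 by (simp add: mult.assoc inverse_mult_eq_1')
    moreover have "convergent_fps (\<theta>s * inverse fs)"
      unfolding \<theta>s_def using fs0
      by (intro convergent_fps_arith(3) convergent_fps_shift \<theta>_conv convergent_fps_inverse fs_conv) simp
    ultimately have y\<theta>: "convergent_fps (y oo \<theta>)" by (simp only:)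
    \<comment> \<open>The way back from the variable \<open>v\<close> to \<open>t\<close>:
      \<open>v\<close> is the inverse of the convergent series \<open>\<theta>\<close>.\<close>
    have v: "convergent_fps v"
      by (rule convergent_fps_inverse_function[OF \<theta>_conv \<theta>0 _ v0 \<theta>v]) (simp only: \<theta>1, simp)
    have "(y oo \<theta>) oo v = y oo (\<theta> oo v)"
      by (rule fps_compose_assoc[OF v0 \<theta>0, symmetric])
    then have "(y oo \<theta>) oo v = y"
      by (simp only: \<theta>v fps_compose_fps_X)
    then have "convergent_fps y"
      using convergent_fps_compose[OF y\<theta> v v0] by (simp only:)
    then show False using euler_series_divergent by (simp only: y_def)
  qed
  then have "divergent_curve (U - lift_v f)"
    by (intro graph_divergent f0)
  ultimately show ?thesis by blast
qed

theorem mainTheorem1: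
  shows "foliation 7 \<omega>_tilde
    \<and> singular_points \<omega>_tilde = {proj_pt (0, 0, 1)}
    \<and> \<not> dicritical (germ_at \<omega>_tilde (0, 0, 1))
    \<and> multiplicity_of (germ_at \<omega>_tilde (0, 0, 1)) = 4
    \<and> has_milnor_number (germ_at \<omega>_tilde (0, 0, 1)) 57
    \<and> (\<exists>f. separatrix (germ_at \<omega>_tilde (0, 0, 1)) f \<and> divergent_curve f)
    \<and> invariant_curve \<omega>_tilde X
    \<and> \<not> second_type \<omega>_tilde"
proof -
  have "\<not> second_type \<omega>_tilde"
  proof
    assume "second_type \<omega>_tilde"
    moreover have "(0, 0, 1) \<noteq> ((0, 0, 0) :: pt3)" "zero_of_form \<omega>_tilde (0, 0, 1)"
      by (simp, simp only: zero_of_form_iff)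
    ultimately have "second_type_germ (germ_at \<omega>_tilde (0, 0, 1))"
      unfolding second_type_def by blast
    then show False
      using not_second_type_N0 by (simp only: germ_at_origin)
  qed
  then show ?thesis
    unfolding germ_at_origin
    using foliation_\<omega>_tilde singular_points_eq not_dicritical_N0 multiplicity_of_N0 milnor_number_N0
      divergent_separatrix invariant_line
    by blast
qed

end
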